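(* Let $N>0$, $\alpha>0$, $k_2>0$, and let $\phi$ be one of the following kernels: (a) $\phi(x)=\frac{1}{2N}\chi_{[-N,N]}(x)$, $x\in\mathbb{R}$ (so $n=1$); (b) $\phi(x,y)=\frac{1}{2N}\chi_{[-N,N]}(x)\,\frac{\alpha}{2}e^{-\alpha|y|}$, $x,y\in\mathbb{R}$ (so $n=2$); (c) $\phi(x,y)=\frac{1}{2N}\chi_{[-N,N]}(x)\,\sqrt{\frac{\alpha}{\pi}}\,e^{-\alpha y^2}$, $x,y\in\mathbb{R}$ (so $n=2$); (d) $\phi(x,y)=\frac{1}{2N}\chi_{[-N,N]}(x)\,\frac{\alpha^3}{8\pi}e^{-\alpha|y|}$, $x\in\mathbb{R}$, $y\in\mathbb{R}^3$ (so $n=4$). Consider the operator $\mathcal{L}\psi=-\Delta\psi+k_2\int_{\mathbb{R}^n}\phi(x-y)\psi(y)\,dy$ on $L^2(\mathbb{R}^n)$ (this is the linearization $\mathcal L$ below with $k_1=0$). Let $z_1$ be the unique solution of $\tan z=\frac{z}{3}$ in the interval $(\pi,\frac{3\pi}{2})$. Then the spectral problem $\mathcal{L}\psi=\lambda\psi$ is spectrally stable if $\frac{1}{k_2}\ge -N^2\frac{\sin z_1}{z_1^3}$ and spectrally unstable if $\frac{1}{k_2}< -N^2\frac{\sin z_1}{z_1^3}$.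
   Context: $\chi_A$ denotes the characteristic function of a set $A$. The operator arises from the equation $\partial_t u=\Delta u+ku^2\bigl(1-au-b\int_{\mathbb{R}^n}\phi(x-y)u(y,t)\,dy\bigr)$ with $k,b>0$, $a\ge 0$, linearized about the constant solution $u=\frac{1}{a+b}$ via $u=\frac{1}{a+b}+\psi(x)e^{-\lambda t}$, giving $\mathcal{L}\psi=-\Delta\psi+k_1\psi+k_2\int\phi(x-y)\psi(y)dy$ with $k_1=\frac{ka}{(a+b)^2}$, $k_2=\frac{kb}{(a+b)^2}$; here $k_1=0$ (i.e. $a=0$). $\mathcal{L}$ is the self-adjoint operator on $L^2(\mathbb{R}^n)$ with domain $H^2(\mathbb{R}^n)$. The spectral problem $\mathcal{L}\psi=\lambda\psi$ is called spectrally stable if the spectrum $\sigma(\mathcal{L})\subseteq[0,\infty)$, and spectrally unstable if $\sigma(\mathcal{L})$ contains some $\lambda<0$. *)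

theory Defs
  imports "HOL-Analysis.Analysis"
begin

definition partial_d :: "'a::euclidean_space \<Rightarrow> ('a \<Rightarrow> real) \<Rightarrow> 'a \<Rightarrow> real" where
  "partial_d i f x = frechet_derivative f (at x) i"

fun iter_pd :: "'a::euclidean_space list \<Rightarrow> ('a \<Rightarrow> real) \<Rightarrow> 'a \<Rightarrow> real" where
  "iter_pd [] f = f"
| "iter_pd (i # is) f = partial_d i (iter_pd is f)"

definition smooth_fun :: "('a::euclidean_space \<Rightarrow> real) \<Rightarrow> bool" where
  "smooth_fun f \<longleftrightarrow> (\<forall>is. set is \<subseteq> Basis \<longrightarrow> (\<forall>x. iter_pd is f differentiable (at x)))"

definition test_fun :: "('a::euclidean_space \<Rightarrow> real) \<Rightarrow> bool" where
  "test_fun w \<longleftrightarrow> smooth_fun w \<and> bounded {x. w x \<noteq> 0}"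

definition laplace_fun :: "('a::euclidean_space \<Rightarrow> real) \<Rightarrow> 'a \<Rightarrow> real" where
  "laplace_fun w x = (\<Sum>i\<in>Basis. iter_pd [i, i] w x)"

definition L2 :: "('a::euclidean_space \<Rightarrow> complex) \<Rightarrow> bool" where
  "L2 f \<longleftrightarrow> f \<in> borel_measurable lebesgue \<and> integrable lebesgue (\<lambda>x. (cmod (f x))\<^sup>2)"

definition L2norm :: "('a::euclidean_space \<Rightarrow> complex) \<Rightarrow> real" where
  "L2norm f = sqrt (integral\<^sup>L lebesgue (\<lambda>x. (cmod (f x))\<^sup>2))"

definition has_weak_deriv :: "'a::euclidean_space list \<Rightarrow> ('a \<Rightarrow> complex) \<Rightarrow> ('a \<Rightarrow> complex) \<Rightarrow> bool" where
  "has_weak_deriv is \<psi> g \<longleftrightarrow>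
     (\<forall>w. test_fun w \<longrightarrow>
        integral\<^sup>L lebesgue (\<lambda>x. \<psi> x * complex_of_real (iter_pd is w x))
        = (-1) ^ length is * integral\<^sup>L lebesgue (\<lambda>x. g x * complex_of_real (w x)))"

definition H2 :: "('a::euclidean_space \<Rightarrow> complex) \<Rightarrow> bool" where
  "H2 \<psi> \<longleftrightarrow> L2 \<psi> \<and>
     (\<forall>is. set is \<subseteq> Basis \<and> length is \<le> 2 \<longrightarrow> (\<exists>g. L2 g \<and> has_weak_deriv is \<psi> g))"

definition has_weak_laplacian :: "('a::euclidean_space \<Rightarrow> complex) \<Rightarrow> ('a \<Rightarrow> complex) \<Rightarrow> bool" where
  "has_weak_laplacian \<psi> d \<longleftrightarrow>
     (\<forall>w. test_fun w \<longrightarrow>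
        integral\<^sup>L lebesgue (\<lambda>x. \<psi> x * complex_of_real (laplace_fun w x))
        = integral\<^sup>L lebesgue (\<lambda>x. d x * complex_of_real (w x)))"

definition conv :: "('a::euclidean_space \<Rightarrow> real) \<Rightarrow> ('a \<Rightarrow> complex) \<Rightarrow> 'a \<Rightarrow> complex" where
  "conv \<phi> \<psi> x = integral\<^sup>L lebesgue (\<lambda>y. complex_of_real (\<phi> (x - y)) * \<psi> y)"

definition L_op :: "real \<Rightarrow> ('a::euclidean_space \<Rightarrow> real) \<Rightarrow> ('a \<Rightarrow> complex) \<Rightarrow> ('a \<Rightarrow> complex) \<Rightarrow> bool" where
  "L_op k2 \<phi> \<psi> h \<longleftrightarrow> H2 \<psi> \<and>
     (\<exists>d. L2 d \<and> has_weak_laplacian \<psi> d \<and>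
          (AE x in lebesgue. h x = - d x + complex_of_real k2 * conv \<phi> \<psi> x))"

definition L_resolvent :: "real \<Rightarrow> ('a::euclidean_space \<Rightarrow> real) \<Rightarrow> complex \<Rightarrow> bool" where
  "L_resolvent k2 \<phi> \<mu> \<longleftrightarrow>
     (\<forall>g. L2 g \<longrightarrow> (\<exists>\<psi> h. L_op k2 \<phi> \<psi> h \<and> (AE x in lebesgue. h x - \<mu> * \<psi> x = g x))) \<and>
     (\<forall>\<psi> h. L_op k2 \<phi> \<psi> h \<and> (AE x in lebesgue. h x = \<mu> * \<psi> x) \<longrightarrow> (AE x in lebesgue. \<psi> x = 0)) \<and>
     (\<exists>C. \<forall>\<psi> h. L_op k2 \<phi> \<psi> h \<longrightarrow> L2norm \<psi> \<le> C * L2norm (\<lambda>x. h x - \<mu> * \<psi> x))"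

definition L_spectrum :: "real \<Rightarrow> ('a::euclidean_space \<Rightarrow> real) \<Rightarrow> complex set" where
  "L_spectrum k2 \<phi> = {\<mu>. \<not> L_resolvent k2 \<phi> \<mu>}"

definition spectrally_stable :: "real \<Rightarrow> ('a::euclidean_space \<Rightarrow> real) \<Rightarrow> bool" where
  "spectrally_stable k2 \<phi> \<longleftrightarrow> L_spectrum k2 \<phi> \<subseteq> complex_of_real ` {0..}"

definition spectrally_unstable :: "real \<Rightarrow> ('a::euclidean_space \<Rightarrow> real) \<Rightarrow> bool" where
  "spectrally_unstable k2 \<phi> \<longleftrightarrow> (\<exists>\<mu>::real. \<mu> < 0 \<and> complex_of_real \<mu> \<in> L_spectrum k2 \<phi>)"

definition phi_a :: "real \<Rightarrow> real \<Rightarrow> real" where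
  "phi_a N x = 1 / (2 * N) * indicator {-N..N} x"

definition phi_b :: "real \<Rightarrow> real \<Rightarrow> real \<times> real \<Rightarrow> real" where
  "phi_b N \<alpha> p = 1 / (2 * N) * indicator {-N..N} (fst p) * (\<alpha> / 2 * exp (- \<alpha> * \<bar>snd p\<bar>))"

definition phi_c :: "real \<Rightarrow> real \<Rightarrow> real \<times> real \<Rightarrow> real" where
  "phi_c N \<alpha> p = 1 / (2 * N) * indicator {-N..N} (fst p) * (sqrt (\<alpha> / pi) * exp (- \<alpha> * (snd p)\<^sup>2))"

definition phi_d :: "real \<Rightarrow> real \<Rightarrow> real \<times> (real ^ 3) \<Rightarrow> real" where
  "phi_d N \<alpha> p = 1 / (2 * N) * indicator {-N..N} (fst p) * (\<alpha> ^ 3 / (8 * pi) * exp (- \<alpha> * norm (snd p)))"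

end

theory Submission
  imports Defs "HOL-Probability.Characteristic_Functions"
begin

text \<open>On the Fourier side the operator is multiplication by \<open>m \<xi> = |\<xi>|\<^sup>2 + k2 * \<phi>hat \<xi>\<close>, so its
  spectrum is the closure of the range of \<open>m\<close>. In the variable carrying the indicator, \<open>\<phi>hat\<close> is
  \<open>sin z / z\<close> with \<open>z = N \<xi>\<close>, and the remaining factor has a transform between 0 and 1 that equals 1 at the
  origin: it is a Gaussian or, for the exponentials, a positive mixture of Gaussians. Hence \<open>m \<ge> 0\<close>
  everywhere iff \<open>1 / k2 \<ge> - N\<^sup>2 sin z / z\<^sup>3\<close> for all \<open>z > 0\<close>, and the right-hand side is maximal at \<open>z1\<close>.
  The unitary Fourier transform on \<open>L\<^sup>2\<close> is obtained from Gaussian regularisation; a point of the range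
  of \<open>m\<close> is shown to be spectral by wave packets with transform supported near it.\<close>

section \<open>Gaussians and their Fourier transforms\<close>

text \<open>The kernels jump and \<open>L_op\<close> refers only to weak derivatives, so pointwise
  inversion and classical calculus are not at hand. Everything rests on three properties of the L2
  transform: it is isometric, it is onto (from the multiplication formula and the isometry alone),
  and it turns convolution and the weak Laplacian into multiplications. Solving the resolvent
  equation is then division by \<open>m - \<mu>\<close>, and the solution stays in \<open>H2\<close>
  because \<open>m\<close> differs from |xi|^2 by a bounded function. All four kernels share one
  threshold because a factor in [0,1] can only damp the negative lobes of \<open>sin z / z\<close>,
  while the extra variables only increase |xi|^2; the least favourable frequencies have these
  variables 0, where the factor is 1. There, for nonzero z, the sign of \<open>m\<close> is that of
  \<open>1 / k2 + N\<^sup>2 * sin z / z ^ 3\<close>, and the derivative of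
  \<open>sin z / z ^ 3\<close> has numerator \<open>z * cos z - 3 * sin z\<close>, which is the
  origin of \<open>tan z = z / 3\<close>.\<close>

lemma lborel_integral_affine:
  fixes f :: "'a::euclidean_space \<Rightarrow> 'b::{banach, second_countable_topology}"
  assumes "c \<noteq> 0" and [measurable]: "f \<in> borel_measurable borel"
  shows "integral\<^sup>L lborel f = \<bar>c\<bar> ^ DIM('a) *\<^sub>R (\<integral>x. f (t + c *\<^sub>R x) \<partial>lborel)"
  by (subst lborel_affine[OF assms(1), of t], subst integral_density)
     (auto simp: integral_distr)

lemma lborel_integrable_affine:
  fixes f :: "'a::euclidean_space \<Rightarrow> 'b::{banach, second_countable_topology}"
  assumes "c \<noteq> 0" and [measurable]: "f \<in> borel_measurable borel"
  shows "integrable lborel f \<longleftrightarrow> integrable lborel (\<lambda>x. f (t + c *\<^sub>R x))"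
proof -
  have "integrable lborel f \<longleftrightarrow> integrable lborel (\<lambda>x. \<bar>c\<bar> ^ DIM('a) *\<^sub>R f (t + c *\<^sub>R x))"
    by (subst lborel_affine[OF assms(1), of t], subst integrable_density)
       (auto simp: integrable_distr_eq)
  also have "\<dots> \<longleftrightarrow> integrable lborel (\<lambda>x. f (t + c *\<^sub>R x))"
    using assms(1) integrable_scaleR_right[of "inverse (\<bar>c\<bar> ^ DIM('a))" lborel "\<lambda>x. \<bar>c\<bar> ^ DIM('a) *\<^sub>R f (t + c *\<^sub>R x)"]
    by auto
  finally show ?thesis .
qed

text \<open>Fubini by coordinates, as \<open>lborel\<close> is the image of the product measure over
  \<open>Basis\<close>. It reduces Gaussian transforms to one variable.\<close>

lemma lborel_integral_prod_Basis:
  fixes f :: "'a::euclidean_space \<Rightarrow> real \<Rightarrow> 'b::{real_normed_field, banach, second_countable_topology}"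
  assumes [measurable]: "\<And>b. b \<in> Basis \<Longrightarrow> f b \<in> borel_measurable borel"
    and "\<And>b. b \<in> Basis \<Longrightarrow> integrable lborel (f b)"
  shows "(\<integral>x. (\<Prod>b\<in>Basis. f b (x \<bullet> b)) \<partial>lborel) = (\<Prod>b\<in>Basis. integral\<^sup>L lborel (f b))"
proof -
  interpret product_sigma_finite "\<lambda>_::'a. lborel :: real measure"
    by standard
  have "(\<integral>x. (\<Prod>b\<in>Basis. f b (x \<bullet> b)) \<partial>lborel) =
     (\<integral>x. (\<Prod>b\<in>Basis. f b ((\<Sum>b\<in>Basis. x b *\<^sub>R b) \<bullet> b)) \<partial>(\<Pi>\<^sub>M b\<in>(Basis::'a set). lborel))"
    by (subst lborel_eq, subst integral_distr) auto
  also have "\<dots> = (\<integral>x. (\<Prod>b\<in>Basis. f b (x b)) \<partial>(\<Pi>\<^sub>M b\<in>(Basis::'a set). lborel))"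
    by (intro Bochner_Integration.integral_cong prod.cong refl) simp
  also have "\<dots> = (\<Prod>b\<in>Basis. integral\<^sup>L lborel (f b))"
    by (rule product_integral_prod) (use assms in auto)
  finally show ?thesis .
qed

text \<open>Left unnormalised: this scaling turns a convolution into a plain product and gives a
  probability density the value 1 at the origin. The unitary scaling is \<open>ft\<close>.\<close>

definition hat :: "('a::euclidean_space \<Rightarrow> complex) \<Rightarrow> 'a \<Rightarrow> complex" where
  "hat f \<xi> = (\<integral>x. f x * cis (- (\<xi> \<bullet> x)) \<partial>lborel)"

abbreviation rhat :: "('a::euclidean_space \<Rightarrow> real) \<Rightarrow> 'a \<Rightarrow> complex" where
  "rhat f \<equiv> hat (\<lambda>x. of_real (f x))"

lemma cis_measurable [measurable]: "cis \<in> borel_measurable borel"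
  by (intro borel_measurable_continuous_onI continuous_intros)

lemma integrable_exp_square: "integrable lborel (\<lambda>x::real. exp (- (x\<^sup>2 / 2)))"
proof -
  have "integrable lborel (\<lambda>x. sqrt (2 * pi) * std_normal_density x)"
    by (intro integrable_mult_right integrable_normal_density) simp
  then show ?thesis
    by (simp add: std_normal_density_def)
qed

lemma integrable_cis_mult:
  fixes f :: "'a::euclidean_space \<Rightarrow> complex"
  assumes "integrable lborel f" and [measurable]: "g \<in> borel_measurable borel"
  shows "integrable lborel (\<lambda>x. f x * cis (g x))"
proof -
  note [measurable] = borel_measurable_integrable[OF assms(1)]
  show ?thesis
    by (rule Bochner_Integration.integrable_bound[OF assms(1)]) (auto simp: norm_mult)
qed

text \<open>Read off from the characteristic function of the standard normal law at
  \<open>-t\<close>, after clearing the factor \<open>1 / sqrt (2 * pi)\<close> of the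
  density.\<close>

lemma hat_gaussian_1:
  "(\<integral>x. of_real (exp (- (x\<^sup>2 / 2))) * cis (- (t * x)) \<partial>lborel) =
     complex_of_real (sqrt (2 * pi) * exp (- (t\<^sup>2 / 2)))"
proof -
  have "complex_of_real (exp (- ((t\<^sup>2) / 2))) = char std_normal_distribution (-t)"
    by (simp add: char_std_normal_distribution)
  also have "\<dots> = (\<integral>x. std_normal_density x *\<^sub>R cis (- (t * x)) \<partial>lborel)"
    unfolding char_def
    by (subst integral_density) (auto simp: cis_conv_exp)
  also have "\<dots> = (\<integral>x. (1 / sqrt (2 * pi)) *\<^sub>R (of_real (exp (- (x\<^sup>2 / 2))) * cis (- (t * x))) \<partial>lborel)"
    by (intro Bochner_Integration.integral_cong) (auto simp: std_normal_density_def scaleR_conv_of_real)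
  also have "\<dots> = (1 / sqrt (2 * pi)) *\<^sub>R (\<integral>x. (of_real (exp (- (x\<^sup>2 / 2))) * cis (- (t * x))) \<partial>lborel)"
    by (rule integral_scaleR_right)
  finally show ?thesis
    by (simp add: scaleR_conv_of_real field_simps)
qed

lemma exp_norm_square_prod:
  fixes x :: "'a::euclidean_space"
  shows "exp (- ((norm x)\<^sup>2 / 2)) = (\<Prod>b\<in>Basis. exp (- ((x \<bullet> b)\<^sup>2 / 2)))"
proof -
  have "(norm x)\<^sup>2 = (\<Sum>b\<in>Basis. (x \<bullet> b)\<^sup>2)"
    unfolding power2_norm_eq_inner by (subst euclidean_inner) (simp add: power2_eq_square)
  then show ?thesis
    by (simp add: exp_sum[symmetric] sum_negf sum_divide_distrib)
qed

lemma cis_sum: "finite A \<Longrightarrow> cis (\<Sum>b\<in>A. f b) = (\<Prod>b\<in>A. cis (f b))"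
  by (induction A rule: finite_induct) (auto simp: cis_mult[symmetric])

text \<open>The nonnegative integral factors over coordinates without any integrability premise, so
  it later yields both integrability and the value of the Bochner integral.\<close>

lemma nn_integral_gaussian:
  "(\<integral>\<^sup>+(x::'a::euclidean_space). exp (- ((norm x)\<^sup>2 / 2)) \<partial>lborel) = ennreal (sqrt (2 * pi) ^ DIM('a))"
proof -
  have 1: "(\<integral>\<^sup>+(x::real). exp (- (x\<^sup>2 / 2)) \<partial>lborel) = ennreal (sqrt (2 * pi))"
  proof -
    have "complex_of_real (\<integral>x. exp (- (x\<^sup>2 / 2)) \<partial>lborel) = complex_of_real (sqrt (2 * pi))"
      using hat_gaussian_1[of 0] by (simp del: of_real_exp)
    then have "(\<integral>x. exp (- (x\<^sup>2 / 2)) \<partial>lborel) = sqrt (2 * pi)"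
      using of_real_eq_iff by blast
    then show ?thesis
      using integrable_exp_square by (subst nn_integral_eq_integral) auto
  qed
  have "(\<integral>\<^sup>+(x::'a). exp (- ((norm x)\<^sup>2 / 2)) \<partial>lborel) =
      (\<integral>\<^sup>+(x::'a). (\<Prod>b\<in>Basis. ennreal (exp (- ((x \<bullet> b)\<^sup>2 / 2)))) \<partial>lborel)"
    unfolding exp_norm_square_prod by (intro nn_integral_cong) (simp add: prod_ennreal)
  also have "\<dots> = (\<Prod>b\<in>(Basis::'a set). (\<integral>\<^sup>+x. exp (- (x\<^sup>2 / 2)) \<partial>lborel))"
    by (rule nn_integral_lborel_prod) auto
  also have "\<dots> = ennreal (sqrt (2 * pi) ^ DIM('a))"
    by (simp add: 1 ennreal_power)
  finally show ?thesis .
qed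

lemma integrable_gaussian_std:
  "integrable lborel (\<lambda>x::'a::euclidean_space. exp (- ((norm x)\<^sup>2 / 2)))"
  by (rule integrableI_nonneg) (auto simp: nn_integral_gaussian)

lemma hat_gaussian_std:
  fixes \<xi> :: "'a::euclidean_space"
  shows "hat (\<lambda>x. of_real (exp (- ((norm x)\<^sup>2 / 2)))) \<xi> =
    complex_of_real (sqrt (2 * pi) ^ DIM('a) * exp (- ((norm \<xi>)\<^sup>2 / 2)))"
proof -
  have "hat (\<lambda>x. of_real (exp (- ((norm x)\<^sup>2 / 2)))) \<xi> =
     (\<integral>x. (\<Prod>b\<in>Basis. of_real (exp (- ((x \<bullet> b)\<^sup>2 / 2))) * cis (- ((\<xi> \<bullet> b) * (x \<bullet> b)))) \<partial>lborel)"
    unfolding hat_def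
  proof (intro Bochner_Integration.integral_cong refl)
    fix x :: 'a
    have "cis (- (\<xi> \<bullet> x)) = (\<Prod>b\<in>Basis. cis (- ((\<xi> \<bullet> b) * (x \<bullet> b))))"
      by (subst cis_sum[symmetric]) (auto simp: euclidean_inner[of \<xi> x] sum_negf)
    then show "of_real (exp (- ((norm x)\<^sup>2 / 2))) * cis (- (\<xi> \<bullet> x)) =
      (\<Prod>b\<in>Basis. of_real (exp (- ((x \<bullet> b)\<^sup>2 / 2))) * cis (- ((\<xi> \<bullet> b) * (x \<bullet> b))))"
      by (simp only: exp_norm_square_prod prod.distrib of_real_prod)
  qed
  also have "\<dots> = (\<Prod>b\<in>(Basis::'a set). \<integral>x. of_real (exp (- (x\<^sup>2 / 2))) * cis (- ((\<xi> \<bullet> b) * x)) \<partial>lborel)"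
    by (rule lborel_integral_prod_Basis)
       (auto intro!: integrable_cis_mult integrable_of_real integrable_exp_square simp del: of_real_exp)
  also have "\<dots> = complex_of_real (sqrt (2 * pi) ^ DIM('a) * exp (- ((norm \<xi>)\<^sup>2 / 2)))"
    unfolding hat_gaussian_1 exp_norm_square_prod
    by (simp add: prod.distrib of_real_prod del: of_real_exp)
  finally show ?thesis .
qed

lemma integrable_gaussian:
  assumes "s > 0"
  shows "integrable lborel (\<lambda>x::'a::euclidean_space. exp (- ((s * norm x)\<^sup>2 / 2)))"
  using lborel_integrable_affine[of s "\<lambda>x::'a. exp (- ((norm x)\<^sup>2 / 2))" 0] integrable_gaussian_std[where 'a='a] assms
  by simp

lemma hat_gaussian:
  fixes \<xi> :: "'a::euclidean_space"
  assumes "s > 0"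
  shows "hat (\<lambda>x. of_real (exp (- ((s * norm x)\<^sup>2 / 2)))) \<xi> =
    complex_of_real ((sqrt (2 * pi) / s) ^ DIM('a) * exp (- ((norm \<xi> / s)\<^sup>2 / 2)))"
proof -
  let ?f = "\<lambda>x::'a. of_real (exp (- ((norm x)\<^sup>2 / 2))) * cis (- ((\<xi> /\<^sub>R s) \<bullet> x))"
  have "hat (\<lambda>x. of_real (exp (- ((norm x)\<^sup>2 / 2)))) (\<xi> /\<^sub>R s) =
     s ^ DIM('a) *\<^sub>R (\<integral>x. ?f (0 + s *\<^sub>R x) \<partial>lborel)"
    unfolding hat_def using assms by (subst lborel_integral_affine[where c=s and t=0]) auto
  also have "(\<lambda>x. ?f (0 + s *\<^sub>R x)) = (\<lambda>x. of_real (exp (- ((s * norm x)\<^sup>2 / 2))) * cis (- (\<xi> \<bullet> x)))"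
    using assms by (auto simp: fun_eq_iff mult.assoc[symmetric])
  finally have "hat (\<lambda>x. of_real (exp (- ((norm x)\<^sup>2 / 2)))) (\<xi> /\<^sub>R s) =
     s ^ DIM('a) *\<^sub>R hat (\<lambda>x. of_real (exp (- ((s * norm x)\<^sup>2 / 2)))) \<xi>"
    unfolding hat_def .
  then show ?thesis
    using assms unfolding hat_gaussian_std by (simp add: scaleR_conv_of_real field_simps del: of_real_exp)
qed

section \<open>Plancherel's identity for bounded continuous integrable functions\<close>

lemma integrable_pair_mult:
  fixes u :: "'a::euclidean_space \<Rightarrow> 'c::{real_normed_algebra, banach, second_countable_topology}"
    and v :: "'b::euclidean_space \<Rightarrow> 'c"
  assumes "integrable lborel u" "integrable lborel v"
  shows "integrable (lborel \<Otimes>\<^sub>M lborel) (\<lambda>(x, y). u x * v y)"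
proof -
  note [measurable] = borel_measurable_integrable[OF assms(1)] borel_measurable_integrable[OF assms(2)]
  have "integrable (lborel \<Otimes>\<^sub>M lborel) (\<lambda>(x, y). norm (u x) * norm (v y))"
  proof (rule lborel_pair.Fubini_integrable)
    have *: "(\<lambda>x. LINT y|lborel. norm (norm (u x) * norm (v y))) = (\<lambda>x. norm (u x) * (LINT y|lborel. norm (v y)))"
      by (intro ext) simp
    show "integrable lborel (\<lambda>x. LINT y|lborel. norm (case (x, y) of (x, y) \<Rightarrow> norm (u x) * norm (v y)))"
      unfolding prod.case * using assms by (intro integrable_mult_left integrable_norm) auto
  qed (use assms in auto)
  then show ?thesis
    by (rule Bochner_Integration.integrable_bound) (auto simp: norm_mult_ineq)
qed

lemma cnj_measurable [measurable]: "cnj \<in> borel_measurable borel"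
  by (intro borel_measurable_continuous_onI continuous_intros)

lemma hat_measurable [measurable]:
  assumes [measurable]: "f \<in> borel_measurable borel"
  shows "hat f \<in> borel_measurable borel"
  unfolding hat_def[abs_def] by measurable

lemma hat_bound:
  assumes "integrable lborel f"
  shows "cmod (hat f \<xi>) \<le> (\<integral>x. cmod (f x) \<partial>lborel)"
proof -
  have "cmod (hat f \<xi>) \<le> (\<integral>x. cmod (f x * cis (- (\<xi> \<bullet> x))) \<partial>lborel)"
    unfolding hat_def by (rule integral_norm_bound)
  then show ?thesis by (simp add: norm_mult)
qed

lemma hat_diff:
  assumes "integrable lborel f" "integrable lborel g"
  shows "hat (\<lambda>x. f x - g x) \<xi> = hat f \<xi> - hat g \<xi>"
  unfolding hat_def using assms
  by (subst Bochner_Integration.integral_diff[symmetric])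
     (auto simp: algebra_simps intro!: integrable_cis_mult)

lemma hat_add:
  assumes "integrable lborel f" "integrable lborel g"
  shows "hat (\<lambda>x. f x + g x) \<xi> = hat f \<xi> + hat g \<xi>"
  unfolding hat_def using assms
  by (subst Bochner_Integration.integral_add[symmetric])
     (auto simp: algebra_simps intro!: integrable_cis_mult)

lemma hat_cmult: "hat (\<lambda>x. c * f x) \<xi> = c * hat f \<xi>"
  unfolding hat_def by (simp add: mult.assoc)

text \<open>Fubini, since the exponential kernel is symmetric in its two variables. With a Gaussian
  factor in \<open>v\<close> it leads to Plancherel; its extension to L2 gives surjectivity.\<close>

lemma hat_mult_formula:
  fixes u v :: "'a::euclidean_space \<Rightarrow> complex"
  assumes "integrable lborel u" "integrable lborel v"
  shows "(\<integral>\<xi>. hat u \<xi> * v \<xi> \<partial>lborel) = (\<integral>x. u x * hat v x \<partial>lborel)"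
proof -
  note [measurable] = borel_measurable_integrable[OF assms(1)] borel_measurable_integrable[OF assms(2)]
  let ?F = "\<lambda>x \<xi>. u x * v \<xi> * cis (- (\<xi> \<bullet> x))"
  have "integrable (lborel \<Otimes>\<^sub>M lborel) (\<lambda>(x, \<xi>). ?F x \<xi>)"
    by (rule Bochner_Integration.integrable_bound[OF integrable_pair_mult[OF assms]])
       (auto simp: norm_mult)
  from lborel_pair.Fubini_integral[OF this]
  have "(\<integral>\<xi>. \<integral>x. ?F x \<xi> \<partial>lborel \<partial>lborel) = (\<integral>x. \<integral>\<xi>. ?F x \<xi> \<partial>lborel \<partial>lborel)" .
  moreover have "(\<integral>x. ?F x \<xi> \<partial>lborel) = hat u \<xi> * v \<xi>" for \<xi>
    unfolding hat_def by (subst integral_mult_left_zero[symmetric]) (simp add: ac_simps)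
  moreover have "(\<integral>\<xi>. ?F x \<xi> \<partial>lborel) = u x * hat v x" for x
    unfolding hat_def by (subst integral_mult_right_zero[symmetric]) (simp add: ac_simps inner_commute)
  ultimately show ?thesis by simp
qed

text \<open>Continuity makes Gaussian means converge at every point, boundedness dominates them and
  puts the function into L2, integrability gives \<open>hat\<close> its meaning. The class is dense
  in L2, contains the test functions and is stable under convolution with integrable
  kernels.\<close>

definition core :: "('a::euclidean_space \<Rightarrow> complex) \<Rightarrow> bool" where
  "core f \<longleftrightarrow> continuous_on UNIV f \<and> bounded (range f) \<and> integrable lborel f"

lemma core_measurable: "core f \<Longrightarrow> f \<in> borel_measurable borel"
  by (auto simp: core_def intro: borel_measurable_continuous_onI)

text \<open>Convolution with a Gaussian of width \<open>s\<close>, written after the substitution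
  \<open>y = x + s z\<close> so that \<open>s\<close> can tend to 0 inside a bounded function. The
  total mass is \<open>sqrt (2 * pi) ^ DIM('a)\<close>, not 1.\<close>

definition gauss_mean :: "real \<Rightarrow> ('a::euclidean_space \<Rightarrow> complex) \<Rightarrow> 'a \<Rightarrow> complex" where
  "gauss_mean s f x = (\<integral>z. f (x + s *\<^sub>R z) * exp (- ((norm z)\<^sup>2 / 2)) \<partial>lborel)"

lemma hat_modulated_gaussian:
  fixes \<xi> :: "'a::euclidean_space"
  assumes "s > 0"
  shows "hat (\<lambda>\<xi>. of_real (exp (- ((s * norm \<xi>)\<^sup>2 / 2))) * cis (x \<bullet> \<xi>)) y =
     complex_of_real ((sqrt (2 * pi) / s) ^ DIM('a) * exp (- ((norm (y - x :: 'a) / s)\<^sup>2 / 2)))"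
proof -
  have "hat (\<lambda>\<xi>. of_real (exp (- ((s * norm \<xi>)\<^sup>2 / 2))) * cis (x \<bullet> \<xi>)) y =
      hat (\<lambda>\<xi>. of_real (exp (- ((s * norm \<xi>)\<^sup>2 / 2)))) (y - x)"
    unfolding hat_def
    by (intro Bochner_Integration.integral_cong) (auto simp: cis_mult inner_diff_left mult.assoc)
  then show ?thesis
    using hat_gaussian[OF assms, of "y - x"] by simp
qed

text \<open>A regularised inversion formula: the multiplication formula moves the transform onto a
  modulated Gaussian, whose own transform is a Gaussian of width \<open>s\<close> centred at
  \<open>x\<close>.\<close>

lemma gauss_mean_eq:
  fixes f :: "'a::euclidean_space \<Rightarrow> complex"
  assumes s: "s > 0" and f: "integrable lborel f"
  shows "(\<integral>\<xi>. hat f \<xi> * (of_real (exp (- ((s * norm \<xi>)\<^sup>2 / 2))) * cis (x \<bullet> \<xi>)) \<partial>lborel) =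
    complex_of_real (sqrt (2 * pi) ^ DIM('a)) * gauss_mean s f x"
proof -
  note [measurable] = borel_measurable_integrable[OF f]
  let ?G = "\<lambda>y. f y * complex_of_real ((sqrt (2 * pi) / s) ^ DIM('a) * exp (- ((norm (y - x) / s)\<^sup>2 / 2)))"
  have "(\<integral>\<xi>. hat f \<xi> * (of_real (exp (- ((s * norm \<xi>)\<^sup>2 / 2))) * cis (x \<bullet> \<xi>)) \<partial>lborel) =
     (\<integral>y. ?G y \<partial>lborel)"
    by (subst hat_mult_formula[OF f])
       (auto intro!: integrable_cis_mult integrable_of_real integrable_gaussian s
             simp: hat_modulated_gaussian[OF s] simp del: of_real_exp)
  also have "\<dots> = s ^ DIM('a) *\<^sub>R (\<integral>z. ?G (x + s *\<^sub>R z) \<partial>lborel)"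
    using s by (subst lborel_integral_affine[where c=s and t=x]) auto
  also have "(\<lambda>z. ?G (x + s *\<^sub>R z)) = (\<lambda>z. complex_of_real ((sqrt (2 * pi) / s) ^ DIM('a)) * (f (x + s *\<^sub>R z) * exp (- ((norm z)\<^sup>2 / 2))))"
    using s by (auto simp: fun_eq_iff)
  finally show ?thesis
    using s unfolding gauss_mean_def integral_mult_right_zero
    by (simp add: scaleR_conv_of_real power_divide del: of_real_exp)
qed

text \<open>Plancherel with a Gaussian weight. At this stage \<open>hat f\<close> is known only to
  be bounded; the weight makes \<open>?v\<close> integrable, so that the multiplication formula
  applies to it.\<close>

lemma hat_square_regularised:
  fixes f :: "'a::euclidean_space \<Rightarrow> complex"
  assumes s: "s > 0" and f: "integrable lborel f"
  shows "of_real (\<integral>\<xi>. (cmod (hat f \<xi>))\<^sup>2 * exp (- ((s * norm \<xi>)\<^sup>2 / 2)) \<partial>lborel) =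
     of_real (sqrt (2 * pi) ^ DIM('a)) * (\<integral>x. f x * cnj (gauss_mean s f x) \<partial>lborel)"
    and "integrable lborel (\<lambda>\<xi>. (cmod (hat f \<xi>))\<^sup>2 * exp (- ((s * norm \<xi>)\<^sup>2 / 2)))"
proof -
  note [measurable] = borel_measurable_integrable[OF f]
  let ?B = "\<integral>x. cmod (f x) \<partial>lborel"
  let ?v = "\<lambda>\<xi>. cnj (hat f \<xi>) * of_real (exp (- ((s * norm \<xi>)\<^sup>2 / 2)))"
  have B: "?B \<ge> 0" by simp
  have g: "integrable lborel (\<lambda>x::'a. ?B * exp (- ((s * norm x)\<^sup>2 / 2)))"
    by (intro integrable_mult_right integrable_gaussian s)
  have v: "integrable lborel ?v"
    by (rule Bochner_Integration.integrable_bound[OF g])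
       (auto simp: norm_mult abs_mult intro!: mult_right_mono hat_bound f)
  show "integrable lborel (\<lambda>\<xi>. (cmod (hat f \<xi>))\<^sup>2 * exp (- ((s * norm \<xi>)\<^sup>2 / 2)))"
  proof (rule Bochner_Integration.integrable_bound[OF integrable_mult_right[OF g, of ?B]])
    show "AE \<xi> in lborel. norm ((cmod (hat f \<xi>))\<^sup>2 * exp (- ((s * norm \<xi>)\<^sup>2 / 2))) \<le>
        norm (?B * (?B * exp (- ((s * norm \<xi>)\<^sup>2 / 2))))"
      using hat_bound[OF f] B by (auto simp: abs_mult power2_eq_square mult.assoc[symmetric] intro!: mult_right_mono mult_mono)
  qed auto
  have "of_real (\<integral>\<xi>. (cmod (hat f \<xi>))\<^sup>2 * exp (- ((s * norm \<xi>)\<^sup>2 / 2)) \<partial>lborel) =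
      (\<integral>\<xi>. hat f \<xi> * ?v \<xi> \<partial>lborel)"
    by (subst integral_complex_of_real[symmetric])
       (simp add: complex_norm_square mult.assoc del: of_real_exp of_real_power)
  also have "\<dots> = (\<integral>x. f x * hat ?v x \<partial>lborel)"
    by (rule hat_mult_formula[OF f v])
  also have "\<dots> = (\<integral>x. of_real (sqrt (2 * pi) ^ DIM('a)) * (f x * cnj (gauss_mean s f x)) \<partial>lborel)"
  proof (intro Bochner_Integration.integral_cong refl)
    fix x
    have "hat ?v x = (\<integral>\<xi>. cnj (hat f \<xi> * (of_real (exp (- ((s * norm \<xi>)\<^sup>2 / 2))) * cis (x \<bullet> \<xi>))) \<partial>lborel)"
      unfolding hat_def by (intro Bochner_Integration.integral_cong) (auto simp: cis_cnj)
    also have "\<dots> = cnj (of_real (sqrt (2 * pi) ^ DIM('a)) * gauss_mean s f x)"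
      by (subst Bochner_Integration.integral_cnj, subst gauss_mean_eq[OF s f]) simp
    finally show "f x * hat ?v x = of_real (sqrt (2 * pi) ^ DIM('a)) * (f x * cnj (gauss_mean s f x))"
      by simp
  qed
  finally show "of_real (\<integral>\<xi>. (cmod (hat f \<xi>))\<^sup>2 * exp (- ((s * norm \<xi>)\<^sup>2 / 2)) \<partial>lborel) =
     of_real (sqrt (2 * pi) ^ DIM('a)) * (\<integral>x. f x * cnj (gauss_mean s f x) \<partial>lborel)"
    by simp
qed

lemma integral_gaussian_std:
  "(\<integral>x. exp (- ((norm (x::'a::euclidean_space))\<^sup>2 / 2)) \<partial>lborel) = sqrt (2 * pi) ^ DIM('a)"
  using nn_integral_gaussian[where 'a='a] nn_integral_eq_integral[OF integrable_gaussian_std[where 'a='a]] by simp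

lemma gauss_mean_bound:
  fixes f :: "'a::euclidean_space \<Rightarrow> complex"
  assumes "\<And>x. cmod (f x) \<le> B" and [measurable]: "f \<in> borel_measurable borel"
  shows "cmod (gauss_mean s f x) \<le> B * sqrt (2 * pi) ^ DIM('a)"
proof -
  have "B \<ge> 0"
    using assms(1)[of 0] norm_ge_zero[of "f 0"] by linarith
  have "cmod (gauss_mean s f x) \<le> (\<integral>z. cmod (f (x + s *\<^sub>R z) * exp (- ((norm z)\<^sup>2 / 2))) \<partial>lborel)"
    unfolding gauss_mean_def by (rule integral_norm_bound)
  also have "\<dots> \<le> (\<integral>(z::'a). B * exp (- ((norm z)\<^sup>2 / 2)) \<partial>lborel)"
    by (rule integral_mono_AE')
       (auto intro!: integrable_mult_right integrable_gaussian_std mult_right_mono assms mult_nonneg_nonneg \<open>B \<ge> 0\<close> simp: norm_mult)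
  also have "\<dots> = B * sqrt (2 * pi) ^ DIM('a)"
    by (simp add: integral_gaussian_std)
  finally show ?thesis .
qed

lemma gauss_mean_tendsto:
  fixes f :: "'a::euclidean_space \<Rightarrow> complex"
  assumes "core f" "S \<longlonglongrightarrow> 0"
  shows "(\<lambda>n. gauss_mean (S n) f x) \<longlonglongrightarrow> complex_of_real (sqrt (2 * pi) ^ DIM('a)) * f x"
proof -
  note [measurable] = core_measurable[OF assms(1)]
  obtain B where B: "\<And>x. cmod (f x) \<le> B"
    using assms(1) by (auto simp: core_def bounded_iff)
  have "(\<lambda>n. gauss_mean (S n) f x) \<longlonglongrightarrow> (\<integral>(z::'a). f x * exp (- ((norm z)\<^sup>2 / 2)) \<partial>lborel)"
    unfolding gauss_mean_def
  proof (rule integral_dominated_convergence)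
    show "integrable lborel (\<lambda>z::'a. B * exp (- ((norm z)\<^sup>2 / 2)))"
      by (intro integrable_mult_right integrable_gaussian_std)
    show "AE z in lborel. (\<lambda>n. f (x + S n *\<^sub>R z) * exp (- ((norm z)\<^sup>2 / 2))) \<longlonglongrightarrow> f x * exp (- ((norm z)\<^sup>2 / 2))"
    proof (intro AE_I2 tendsto_intros)
      fix z
      have "isCont f x"
        using assms(1) by (simp add: core_def continuous_on_eq_continuous_at)
      moreover have "(\<lambda>n. x + S n *\<^sub>R z) \<longlonglongrightarrow> x"
        using tendsto_add[OF tendsto_const[of x] tendsto_scaleR[OF assms(2) tendsto_const[of z]]] by simp
      ultimately show "(\<lambda>n. f (x + S n *\<^sub>R z)) \<longlonglongrightarrow> f x"
        by (rule isCont_tendsto_compose)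
    qed
    show "AE z in lborel. norm (f (x + S n *\<^sub>R z) * exp (- ((norm z)\<^sup>2 / 2))) \<le> B * exp (- ((norm z)\<^sup>2 / 2))" for n
      by (auto simp: norm_mult intro!: mult_right_mono B)
  qed auto
  also have "(\<integral>(z::'a). f x * exp (- ((norm z)\<^sup>2 / 2)) \<partial>lborel) = complex_of_real (sqrt (2 * pi) ^ DIM('a)) * f x"
    by (subst integral_mult_right_zero, subst integral_complex_of_real, subst integral_gaussian_std) simp
  finally show ?thesis .
qed

text \<open>Let \<open>s\<close> tend to 0 in the weighted identity. On the side of \<open>f\<close>
  convergence is dominated; on the side of \<open>hat f\<close> the weights increase to 1 because
  \<open>S\<close> decreases, and monotone convergence also delivers the integrability of the
  square.\<close>

theorem plancherel_core:
  fixes f :: "'a::euclidean_space \<Rightarrow> complex"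
  assumes "core f"
  shows "has_bochner_integral lborel (\<lambda>\<xi>. (cmod (hat f \<xi>))\<^sup>2) ((2 * pi) ^ DIM('a) * (\<integral>x. (cmod (f x))\<^sup>2 \<partial>lborel))"
proof -
  note [measurable] = core_measurable[OF assms]
  have f: "integrable lborel f"
    using assms by (simp add: core_def)
  obtain B where B: "\<And>x. cmod (f x) \<le> B"
    using assms(1) by (auto simp: core_def bounded_iff)
  define S where "S n = 1 / real (Suc n)" for n
  have S: "S n > 0" for n by (simp add: S_def)
  have S0: "S \<longlonglongrightarrow> 0"
    unfolding S_def by (rule lim_1_over_n[THEN LIMSEQ_Suc])
  let ?c = "sqrt (2 * pi) ^ DIM('a)"
  have cc: "?c * ?c = (2 * pi) ^ DIM('a)"
    by (subst power_mult_distrib[symmetric]) simp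
  have [measurable]: "gauss_mean s f \<in> borel_measurable borel" for s
    unfolding gauss_mean_def[abs_def] by measurable
  have "(\<lambda>n. \<integral>x. f x * cnj (gauss_mean (S n) f x) \<partial>lborel) \<longlonglongrightarrow> (\<integral>x. f x * cnj (?c * f x) \<partial>lborel)"
  proof (rule integral_dominated_convergence)
    show "integrable lborel (\<lambda>x. cmod (f x) * (B * ?c))"
      by (intro integrable_mult_left integrable_norm f)
    show "AE x in lborel. (\<lambda>n. f x * cnj (gauss_mean (S n) f x)) \<longlonglongrightarrow> f x * cnj (?c * f x)"
      by (intro AE_I2 tendsto_mult tendsto_const tendsto_cnj gauss_mean_tendsto assms S0)
    show "AE x in lborel. norm (f x * cnj (gauss_mean (S n) f x)) \<le> cmod (f x) * (B * ?c)" for n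
      by (auto simp: norm_mult intro!: mult_left_mono gauss_mean_bound B)
  qed auto
  then have "(\<lambda>n. of_real ?c * (\<integral>x. f x * cnj (gauss_mean (S n) f x) \<partial>lborel)) \<longlonglongrightarrow> ?c * (\<integral>x. f x * cnj (?c * f x) \<partial>lborel)"
    by (intro tendsto_mult tendsto_const)
  also have "(\<lambda>n. of_real ?c * (\<integral>x. f x * cnj (gauss_mean (S n) f x) \<partial>lborel)) =
     (\<lambda>n. of_real (\<integral>\<xi>. (cmod (hat f \<xi>))\<^sup>2 * exp (- ((S n * norm \<xi>)\<^sup>2 / 2)) \<partial>lborel))"
    by (subst hat_square_regularised[OF S f]) simp
  also have "(\<lambda>x. f x * cnj (?c * f x)) = (\<lambda>x. of_real (?c * (cmod (f x))\<^sup>2))"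
    by (auto simp: complex_norm_square fun_eq_iff simp del: of_real_power)
  also have "?c * (\<integral>x. complex_of_real (?c * (cmod (f x))\<^sup>2) \<partial>lborel) =
      complex_of_real ((2 * pi) ^ DIM('a) * (\<integral>x. (cmod (f x))\<^sup>2 \<partial>lborel))"
    by (subst integral_complex_of_real) (simp only: cc[symmetric] of_real_mult integral_mult_right_zero mult.assoc)
  finally have lim: "(\<lambda>n. \<integral>\<xi>. (cmod (hat f \<xi>))\<^sup>2 * exp (- ((S n * norm \<xi>)\<^sup>2 / 2)) \<partial>lborel) \<longlonglongrightarrow>
      (2 * pi) ^ DIM('a) * (\<integral>x. (cmod (f x))\<^sup>2 \<partial>lborel)"
    by (subst (asm) tendsto_of_real_iff)
  show ?thesis
  proof (rule has_bochner_integral_monotone_convergence[OF _ _ _ lim])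
    show "integrable lborel (\<lambda>\<xi>. (cmod (hat f \<xi>))\<^sup>2 * exp (- ((S n * norm \<xi>)\<^sup>2 / 2)))" for n
      by (rule hat_square_regularised[OF S f])
    have "S m \<le> S n" if "n \<le> m" for n m
      using that by (simp add: S_def field_simps)
    then show "AE \<xi> in lborel. mono (\<lambda>n. (cmod (hat f \<xi>))\<^sup>2 * exp (- ((S n * norm \<xi>)\<^sup>2 / 2)))"
      using S[THEN less_imp_le] by (intro AE_I2 monoI mult_left_mono) (auto intro!: power_mono mult_right_mono)
    show "AE \<xi> in lborel. (\<lambda>n. (cmod (hat f \<xi>))\<^sup>2 * exp (- ((S n * norm \<xi>)\<^sup>2 / 2))) \<longlonglongrightarrow> (cmod (hat f \<xi>))\<^sup>2"
    proof (intro AE_I2)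
      fix \<xi>
      have "(\<lambda>n. (cmod (hat f \<xi>))\<^sup>2 * exp (- ((S n * norm \<xi>)\<^sup>2 / 2))) \<longlonglongrightarrow> (cmod (hat f \<xi>))\<^sup>2 * exp (- ((0 * norm \<xi>)\<^sup>2 / 2))"
        by (intro tendsto_intros S0) auto
      then show "(\<lambda>n. (cmod (hat f \<xi>))\<^sup>2 * exp (- ((S n * norm \<xi>)\<^sup>2 / 2))) \<longlonglongrightarrow> (cmod (hat f \<xi>))\<^sup>2"
        by simp
    qed
  qed auto
qed

section \<open>The space L2\<close>

definition nsq :: "('a::euclidean_space \<Rightarrow> complex) \<Rightarrow> real" where
  "nsq f = (\<integral>x. (cmod (f x))\<^sup>2 \<partial>lebesgue)"

lemma L2norm_nsq: "L2norm f = sqrt (nsq f)"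
  by (simp add: L2norm_def nsq_def)

lemma nsq_nonneg [simp]: "0 \<le> nsq f"
  by (simp add: nsq_def)

text \<open>Carries no membership in L2: \<open>nsq\<close> is 0 by default when the square is not
  integrable. Lemmas about limits therefore state \<open>L2\<close> of the terms and of the limit
  separately.\<close>

abbreviation tends_L2 :: "(nat \<Rightarrow> 'a::euclidean_space \<Rightarrow> complex) \<Rightarrow> ('a \<Rightarrow> complex) \<Rightarrow> bool" where
  "tends_L2 F f \<equiv> (\<lambda>n. nsq (\<lambda>x. F n x - f x)) \<longlonglongrightarrow> 0"

lemma L2_measurable: "L2 f \<Longrightarrow> f \<in> borel_measurable lebesgue"
  and L2_integrable: "L2 f \<Longrightarrow> integrable lebesgue (\<lambda>x. (cmod (f x))\<^sup>2)"
  by (simp_all add: L2_def)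

lemma cmod_add_square_le: "(cmod (a + b))\<^sup>2 \<le> 2 * (cmod a)\<^sup>2 + 2 * (cmod b)\<^sup>2"
proof -
  have "(cmod (a + b))\<^sup>2 \<le> (cmod a + cmod b)\<^sup>2"
    by (intro power_mono norm_triangle_ineq) auto
  also have "\<dots> \<le> 2 * (cmod a)\<^sup>2 + 2 * (cmod b)\<^sup>2"
    using sum_squares_bound[of "cmod a" "cmod b"] by (simp add: power2_sum)
  finally show ?thesis .
qed

lemma L2_bounded_by:
  assumes f: "L2 f" and g: "g \<in> borel_measurable lebesgue" and le: "AE x in lebesgue. cmod (g x) \<le> C * cmod (f x)"
  shows "L2 g" and "nsq g \<le> C\<^sup>2 * nsq f"
proof -
  have i: "integrable lebesgue (\<lambda>x. C\<^sup>2 * (cmod (f x))\<^sup>2)"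
    by (intro integrable_mult_right L2_integrable f)
  have le': "AE x in lebesgue. (cmod (g x))\<^sup>2 \<le> C\<^sup>2 * (cmod (f x))\<^sup>2"
    using le by eventually_elim (metis norm_ge_zero power_mono power_mult_distrib)
  have "integrable lebesgue (\<lambda>x. (cmod (g x))\<^sup>2)"
    by (rule Bochner_Integration.integrable_bound[OF i]) (use g le' in auto)
  then show "L2 g" using g by (simp add: L2_def)
  have "nsq g \<le> (\<integral>x. C\<^sup>2 * (cmod (f x))\<^sup>2 \<partial>lebesgue)"
    unfolding nsq_def by (rule integral_mono_AE) fact+
  then show "nsq g \<le> C\<^sup>2 * nsq f" by (simp add: nsq_def)
qed

lemma L2_cmult: "L2 f \<Longrightarrow> L2 (\<lambda>x. c * f x)"
  by (rule L2_bounded_by(1)[where C="cmod c" and f=f]) (auto simp: norm_mult dest: L2_measurable)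

lemma nsq_cmult: "nsq (\<lambda>x. c * f x) = (cmod c)\<^sup>2 * nsq f"
  by (simp add: nsq_def norm_mult power_mult_distrib)

lemma L2_cnj: "L2 f \<Longrightarrow> L2 (\<lambda>x. cnj (f x))"
  by (rule L2_bounded_by(1)[where C=1 and f=f]) (auto dest: L2_measurable)

lemma L2_add:
  assumes "L2 f" "L2 g"
  shows "L2 (\<lambda>x. f x + g x)" and "nsq (\<lambda>x. f x + g x) \<le> 2 * nsq f + 2 * nsq g"
proof -
  have i: "integrable lebesgue (\<lambda>x. 2 * (cmod (f x))\<^sup>2 + 2 * (cmod (g x))\<^sup>2)"
    using assms by (auto simp: L2_def)
  have 1: "integrable lebesgue (\<lambda>x. (cmod (f x + g x))\<^sup>2)"
    by (rule Bochner_Integration.integrable_bound[OF i])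
       (use assms cmod_add_square_le in \<open>auto simp: L2_def\<close>)
  then show "L2 (\<lambda>x. f x + g x)"
    using assms by (auto simp: L2_def)
  have "nsq (\<lambda>x. f x + g x) \<le> (\<integral>x. 2 * (cmod (f x))\<^sup>2 + 2 * (cmod (g x))\<^sup>2 \<partial>lebesgue)"
    unfolding nsq_def by (rule integral_mono[OF 1 i]) (rule cmod_add_square_le)
  then show "nsq (\<lambda>x. f x + g x) \<le> 2 * nsq f + 2 * nsq g"
    using assms by (simp add: nsq_def L2_def)
qed

lemma L2_diff:
  assumes "L2 f" "L2 g"
  shows "L2 (\<lambda>x. f x - g x)" and "nsq (\<lambda>x. f x - g x) \<le> 2 * nsq f + 2 * nsq g"
  using L2_add[OF assms(1) L2_cmult[OF assms(2), of "-1"]] nsq_cmult[of "-1" g] by auto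

lemma nsq_diff_commute: "nsq (\<lambda>x. f x - g x) = nsq (\<lambda>x. g x - f x)"
  by (simp add: nsq_def norm_minus_commute)

text \<open>Squared norms satisfy the triangle inequality up to a factor 2; this is the source of
  the \<open>e / 4\<close> in later estimates.\<close>

lemma nsq_triangle:
  assumes "L2 f" "L2 g" "L2 h"
  shows "nsq (\<lambda>x. f x - h x) \<le> 2 * nsq (\<lambda>x. f x - g x) + 2 * nsq (\<lambda>x. g x - h x)"
  using L2_add(2)[OF L2_diff(1)[OF assms(1,2)] L2_diff(1)[OF assms(2,3)]] by simp

text \<open>Holds for arbitrary functions: as \<open>lebesgue\<close> is complete, both squares are
  measurable or neither is, and in the latter case both integrals take the default value 0.\<close>

lemma nsq_cong_AE:
  assumes "AE x in lebesgue. f x = g x"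
  shows "nsq f = nsq g"
proof -
  have fg: "AE x in lebesgue. (cmod (f x))\<^sup>2 = (cmod (g x))\<^sup>2" "AE x in lebesgue. (cmod (g x))\<^sup>2 = (cmod (f x))\<^sup>2"
    using assms by (auto elim: eventually_mono)
  have m: "(\<lambda>x. (cmod (f x))\<^sup>2) \<in> borel_measurable lebesgue \<longleftrightarrow> (\<lambda>x. (cmod (g x))\<^sup>2) \<in> borel_measurable lebesgue"
    using borel_measurable_AE[OF _ fg(1)] borel_measurable_AE[OF _ fg(2)] by blast
  show ?thesis
  proof (cases "(\<lambda>x. (cmod (f x))\<^sup>2) \<in> borel_measurable lebesgue")
    case True
    then show ?thesis
      unfolding nsq_def using fg(1) m by (intro integral_cong_AE) auto
  next
    case False
    then show ?thesis
      unfolding nsq_def using m by (metis borel_measurable_integrable not_integrable_integral_eq)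
  qed
qed

lemma L2_cong_AE:
  assumes "L2 f" "AE x in lebesgue. f x = g x"
  shows "L2 g"
proof -
  have g: "g \<in> borel_measurable lebesgue"
    by (rule borel_measurable_AE[OF L2_measurable[OF assms(1)] assms(2)])
  show ?thesis
    by (rule L2_bounded_by(1)[OF assms(1) g, of 1]) (use assms(2) in auto)
qed

lemma nsq_eq_0_iff:
  assumes "L2 f"
  shows "nsq f = 0 \<longleftrightarrow> (AE x in lebesgue. f x = 0)"
  unfolding nsq_def using integral_nonneg_eq_0_iff_AE[OF L2_integrable[OF assms]] by simp

lemma L2_prod_integrable:
  assumes "L2 f" "L2 g"
  shows "integrable lebesgue (\<lambda>x. f x * g x)"
proof -
  have i: "integrable lebesgue (\<lambda>x. (cmod (f x))\<^sup>2 + (cmod (g x))\<^sup>2)"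
    using assms by (auto simp: L2_def)
  show ?thesis
  proof (rule Bochner_Integration.integrable_bound[OF i])
    show "AE x in lebesgue. norm (f x * g x) \<le> norm ((cmod (f x))\<^sup>2 + (cmod (g x))\<^sup>2)"
    proof (intro AE_I2)
      fix x
      show "norm (f x * g x) \<le> norm ((cmod (f x))\<^sup>2 + (cmod (g x))\<^sup>2)"
        using sum_squares_bound[of "cmod (f x)" "cmod (g x)"] mult_nonneg_nonneg[of "cmod (f x)" "cmod (g x)"]
        unfolding norm_mult real_norm_def by linarith
    qed
  qed (use assms in \<open>auto simp: L2_def\<close>)
qed

lemma L2_prod_bound:
  assumes "L2 f" "L2 g" "t > 0"
  shows "2 * cmod (\<integral>x. f x * g x \<partial>lebesgue) \<le> t * nsq f + nsq g / t"
proof -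
  have "cmod (\<integral>x. f x * g x \<partial>lebesgue) \<le> (\<integral>x. cmod (f x * g x) \<partial>lebesgue)"
    by (rule integral_norm_bound)
  also have "\<dots> \<le> (\<integral>x. (t / 2) * (cmod (f x))\<^sup>2 + (1 / (2 * t)) * (cmod (g x))\<^sup>2 \<partial>lebesgue)"
  proof (rule integral_mono)
    show "integrable lebesgue (\<lambda>x. cmod (f x * g x))"
      by (intro integrable_norm L2_prod_integrable assms)
    show "integrable lebesgue (\<lambda>x. (t / 2) * (cmod (f x))\<^sup>2 + (1 / (2 * t)) * (cmod (g x))\<^sup>2)"
      by (intro Bochner_Integration.integrable_add integrable_mult_right L2_integrable assms)
    fix x
    have "0 \<le> (t * cmod (f x) - cmod (g x))\<^sup>2 / (2 * t)"
      using assms(3) by simp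
    also have "\<dots> = (t / 2) * (cmod (f x))\<^sup>2 + (1 / (2 * t)) * (cmod (g x))\<^sup>2 - cmod (f x * g x)"
      using assms(3) by (simp add: field_simps power2_eq_square norm_mult)
    finally show "cmod (f x * g x) \<le> (t / 2) * (cmod (f x))\<^sup>2 + (1 / (2 * t)) * (cmod (g x))\<^sup>2"
      by simp
  qed
  also have "\<dots> = (t / 2) * nsq f + (1 / (2 * t)) * nsq g"
    unfolding nsq_def using assms by (subst Bochner_Integration.integral_add) (auto simp: L2_def)
  finally show ?thesis by (simp add: field_simps)
qed

text \<open>Optimisation over \<open>t\<close>, with minimum at \<open>sqrt b / sqrt a\<close>. If
  \<open>a\<close> or \<open>b\<close> is 0 there is no optimal \<open>t\<close>, and one extreme
  enough to push the bound below \<open>2 * I\<close> is taken. It serves Cauchy-Schwarz in L2 and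
  the pointwise estimate of a convolution.\<close>

lemma le_sqrt_mult_sqrtI:
  assumes ab: "a \<ge> 0" "b \<ge> 0" "I \<ge> 0" and *: "\<And>t. t > 0 \<Longrightarrow> 2 * I \<le> t * a + b / t"
  shows "I \<le> sqrt a * sqrt b"
proof (cases "a = 0 \<or> b = 0")
  case False
  then have "a > 0" "b > 0" using ab by auto
  have "2 * I \<le> sqrt b / sqrt a * a + b / (sqrt b / sqrt a)"
    using \<open>a > 0\<close> \<open>b > 0\<close> by (intro *) auto
  also have "sqrt b / sqrt a * a = sqrt a * sqrt b"
    using \<open>a > 0\<close> by (simp add: field_simps)
  also have "b / (sqrt b / sqrt a) = sqrt a * sqrt b"
    using \<open>b > 0\<close> by (simp add: field_simps)
  finally show ?thesis by simp
next
  case True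
  have "I \<le> 0"
  proof (rule ccontr)
    assume "\<not> I \<le> 0" then have "I > 0" by simp
    from True show False
    proof
      assume "a = 0"
      have "2 * I \<le> b / ((b + 1) / I)"
        using *[of "(b + 1) / I"] \<open>a = 0\<close> ab \<open>I > 0\<close> by simp
      also have "\<dots> \<le> I" using \<open>I > 0\<close> ab by (simp add: field_simps)
      finally show False using \<open>I > 0\<close> by simp
    next
      assume "b = 0"
      have "2 * I \<le> I / (a + 1) * a"
        using *[of "I / (a + 1)"] \<open>b = 0\<close> ab \<open>I > 0\<close> by simp
      also have "\<dots> \<le> I" using \<open>I > 0\<close> ab by (simp add: field_simps)
      finally show False using \<open>I > 0\<close> by simp
    qed
  qed
  then show ?thesis using ab by (meson mult_nonneg_nonneg order_trans real_sqrt_ge_zero)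
qed

lemma L2_cauchy_schwarz:
  assumes "L2 f" "L2 g"
  shows "cmod (\<integral>x. f x * g x \<partial>lebesgue) \<le> sqrt (nsq f) * sqrt (nsq g)"
  by (intro le_sqrt_mult_sqrtI L2_prod_bound assms) auto

lemma L2_prod_tendsto:
  assumes F: "\<And>n. L2 (F n)" "L2 f" "tends_L2 F f"
    and G: "\<And>n. L2 (G n)" "L2 g" "tends_L2 G g"
  shows "(\<lambda>n. \<integral>x. F n x * G n x \<partial>lebesgue) \<longlonglongrightarrow> (\<integral>x. f x * g x \<partial>lebesgue)"
proof -
  let ?a = "\<lambda>n. nsq (\<lambda>x. F n x - f x)" and ?b = "\<lambda>n. nsq (\<lambda>x. G n x - g x)"
  have "(\<lambda>n. (\<integral>x. F n x * G n x \<partial>lebesgue) - (\<integral>x. f x * g x \<partial>lebesgue)) \<longlonglongrightarrow> 0"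
  proof (rule Lim_null_comparison)
    show "\<forall>\<^sub>F n in sequentially. norm ((\<integral>x. F n x * G n x \<partial>lebesgue) - (\<integral>x. f x * g x \<partial>lebesgue)) \<le>
      sqrt (?a n) * sqrt (2 * ?b n + 2 * nsq g) + sqrt (nsq f) * sqrt (?b n)"
    proof (intro always_eventually allI)
      fix n
      have "(\<integral>x. F n x * G n x \<partial>lebesgue) - (\<integral>x. f x * g x \<partial>lebesgue) =
        (\<integral>x. (F n x - f x) * G n x \<partial>lebesgue) + (\<integral>x. f x * (G n x - g x) \<partial>lebesgue)"
        by (subst Bochner_Integration.integral_add[symmetric] Bochner_Integration.integral_diff[symmetric];
            (intro L2_prod_integrable L2_diff F G)?)+
           (simp add: algebra_simps)
      also have "cmod \<dots> \<le> sqrt (?a n) * sqrt (nsq (G n)) + sqrt (nsq f) * sqrt (?b n)"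
        by (intro norm_triangle_mono L2_cauchy_schwarz L2_diff F G)
      also have "nsq (G n) \<le> 2 * ?b n + 2 * nsq g"
        using L2_add(2)[OF L2_diff(1)[OF G(1) G(2)] G(2), of n] by simp
      then have "sqrt (?a n) * sqrt (nsq (G n)) \<le> sqrt (?a n) * sqrt (2 * ?b n + 2 * nsq g)"
        by (intro mult_left_mono) auto
      finally show "norm ((\<integral>x. F n x * G n x \<partial>lebesgue) - (\<integral>x. f x * g x \<partial>lebesgue)) \<le>
          sqrt (?a n) * sqrt (2 * ?b n + 2 * nsq g) + sqrt (nsq f) * sqrt (?b n)" by simp
    qed
    have "(\<lambda>n. sqrt (?a n) * sqrt (2 * ?b n + 2 * nsq g) + sqrt (nsq f) * sqrt (?b n)) \<longlonglongrightarrow>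
       sqrt 0 * sqrt (2 * 0 + 2 * nsq g) + sqrt (nsq f) * sqrt 0"
      by (intro tendsto_intros F G)
    then show "(\<lambda>n. sqrt (?a n) * sqrt (2 * ?b n + 2 * nsq g) + sqrt (nsq f) * sqrt (?b n)) \<longlonglongrightarrow> 0"
      by simp
  qed
  then show ?thesis by (simp add: LIM_zero_iff)
qed

lemma nsq_eq_prod: "of_real (nsq f) = (\<integral>x. f x * cnj (f x) \<partial>lebesgue)"
  unfolding nsq_def by (subst integral_complex_of_real[symmetric]) (simp only: complex_norm_square)

lemma nsq_tendsto:
  assumes F: "\<And>n. L2 (F n)" "L2 f" "tends_L2 F f"
  shows "(\<lambda>n. nsq (F n)) \<longlonglongrightarrow> nsq f"
proof -
  have "(\<lambda>n. complex_of_real (nsq (F n))) \<longlonglongrightarrow> complex_of_real (nsq f)"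
    unfolding nsq_eq_prod
  proof (rule L2_prod_tendsto[OF F L2_cnj[OF F(1)] L2_cnj[OF F(2)]])
    have "nsq (\<lambda>x. cnj (F n x) - cnj (f x)) = nsq (\<lambda>x. F n x - f x)" for n
      by (simp add: nsq_def flip: complex_cnj_diff)
    then show "(\<lambda>n. nsq (\<lambda>x. cnj (F n x) - cnj (f x))) \<longlonglongrightarrow> 0"
      using F(3) by simp
  qed
  then show ?thesis by (simp only: tendsto_of_real_iff)
qed

section \<open>Fatou's lemma and completeness of L2\<close>

lemma nn_integral_le_AE_limit:
  fixes u :: "nat \<Rightarrow> 'a \<Rightarrow> real"
  assumes [measurable]: "\<And>n. u n \<in> borel_measurable M"
    and lim: "AE x in M. (\<lambda>n. u n x) \<longlonglongrightarrow> v x"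
    and le: "\<forall>\<^sub>F n in sequentially. (\<integral>\<^sup>+x. ennreal (u n x) \<partial>M) \<le> e"
  shows "(\<integral>\<^sup>+x. ennreal (v x) \<partial>M) \<le> e"
proof -
  have "(\<integral>\<^sup>+x. ennreal (v x) \<partial>M) = (\<integral>\<^sup>+x. liminf (\<lambda>n. ennreal (u n x)) \<partial>M)"
    using lim by (intro nn_integral_cong_AE, eventually_elim)
      (metis tendsto_ennrealI lim_imp_Liminf trivial_limit_sequentially)
  also have "\<dots> \<le> liminf (\<lambda>n. \<integral>\<^sup>+x. ennreal (u n x) \<partial>M)"
    by (rule nn_integral_liminf) simp
  also have "\<dots> \<le> e"
    using le by (intro Liminf_le) auto
  finally show ?thesis .
qed

lemma nn_integral_nsq: "L2 f \<Longrightarrow> (\<integral>\<^sup>+x. ennreal ((cmod (f x))\<^sup>2) \<partial>lebesgue) = ennreal (nsq f)"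
  unfolding nsq_def by (rule nn_integral_eq_integral[OF L2_integrable]) auto

lemma L2I_nn_integral:
  assumes "f \<in> borel_measurable lebesgue" "(\<integral>\<^sup>+x. ennreal ((cmod (f x))\<^sup>2) \<partial>lebesgue) \<le> ennreal e" "e \<ge> 0"
  shows "L2 f" "nsq f \<le> e"
proof -
  have "(\<integral>\<^sup>+x. ennreal ((cmod (f x))\<^sup>2) \<partial>lebesgue) < \<infinity>"
    using assms(2) by (rule le_less_trans) simp
  then show f: "L2 f"
    using assms(1) unfolding L2_def by (auto intro!: integrableI_nonneg)
  show "nsq f \<le> e"
    using assms(2,3) unfolding nn_integral_nsq[OF f] by simp
qed

text \<open>Riesz-Fischer. Along a subsequence with squared gaps below \<open>(1/4) ^ n\<close>, the
  weights \<open>2 ^ n\<close> keep the total integral finite and still force pointwise gaps of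
  order \<open>(1 / sqrt 2) ^ n\<close>, hence convergence almost everywhere. Fatou then bounds the
  distance to the limit.\<close>

lemma L2_complete:
  fixes f :: "nat \<Rightarrow> 'a::euclidean_space \<Rightarrow> complex"
  assumes L2: "\<And>n. L2 (f n)"
    and cauchy: "\<And>e. e > 0 \<Longrightarrow> \<exists>N. \<forall>m\<ge>N. \<forall>n\<ge>N. nsq (\<lambda>x. f m x - f n x) < e"
  shows "\<exists>g. L2 g \<and> tends_L2 f g"
proof -
  note [measurable] = L2_measurable[OF L2]
  have "\<forall>j. \<exists>N. \<forall>m\<ge>N. \<forall>n\<ge>N. nsq (\<lambda>x. f m x - f n x) < (1/4) ^ j"
    using cauchy by simp
  then obtain N where N: "\<And>j m n. m \<ge> N j \<Longrightarrow> n \<ge> N j \<Longrightarrow> nsq (\<lambda>x. f m x - f n x) < (1/4) ^ j"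
    by metis
  \<comment> \<open>The maximum makes \<open>r n\<close> at least every \<open>N j\<close> with
    \<open>j \<le> n\<close>, so \<open>r n\<close> and \<open>r (Suc n)\<close> both lie beyond
    \<open>N n\<close>.\<close>
  define r where "r n = Max (N ` {..n})" for n
  have r: "N j \<le> r n" if "j \<le> n" for j n
    using that by (auto simp: r_def)
  define D where "D n x = (cmod (f (r (Suc n)) x - f (r n) x))\<^sup>2" for n x
  have [measurable]: "D n \<in> borel_measurable lebesgue" for n
    unfolding D_def[abs_def] by measurable
  have D0: "D n x \<ge> 0" for n x by (simp add: D_def)
  have "(\<integral>\<^sup>+x. (\<Sum>n. ennreal (2 ^ n * D n x)) \<partial>lebesgue) = (\<Sum>n. \<integral>\<^sup>+x. ennreal (2 ^ n * D n x) \<partial>lebesgue)"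
    by (rule nn_integral_suminf) simp
  also have "\<dots> \<le> (\<Sum>n. ennreal ((1/2) ^ n))"
  proof (intro suminf_le allI)
    fix n
    have "(\<integral>\<^sup>+x. ennreal (2 ^ n * D n x) \<partial>lebesgue) = ennreal (2 ^ n) * (\<integral>\<^sup>+x. ennreal (D n x) \<partial>lebesgue)"
      by (simp add: ennreal_mult D0 nn_integral_cmult)
    also have "\<dots> = ennreal (2 ^ n) * ennreal (nsq (\<lambda>x. f (r (Suc n)) x - f (r n) x))"
      unfolding D_def by (subst nn_integral_nsq) (auto intro!: L2_diff L2)
    also have "\<dots> \<le> ennreal (2 ^ n) * ennreal ((1/4) ^ n)"
      by (intro mult_left_mono ennreal_leI less_imp_le[OF N] r) auto
    also have "\<dots> = ennreal ((1/2) ^ n)"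
      by (simp add: ennreal_mult[symmetric] power_mult_distrib[symmetric])
    finally show "(\<integral>\<^sup>+x. ennreal (2 ^ n * D n x) \<partial>lebesgue) \<le> ennreal ((1/2) ^ n)" .
  qed auto
  also have "\<dots> = ennreal (\<Sum>n. (1/2) ^ n)"
    by (rule suminf_ennreal2) (auto intro: summable_geometric)
  also have "\<dots> < \<infinity>" by simp
  finally have "(\<integral>\<^sup>+x. (\<Sum>n. ennreal (2 ^ n * D n x)) \<partial>lebesgue) \<noteq> \<infinity>" by simp
  then have fin: "AE x in lebesgue. (\<Sum>n. ennreal (2 ^ n * D n x)) \<noteq> \<infinity>"
    by (rule nn_integral_PInf_AE[rotated]) measurable
  define g where "g x = lim (\<lambda>n. f (r n) x)" for x
  have [measurable]: "g \<in> borel_measurable lebesgue"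
    unfolding g_def[abs_def] by measurable
  have lim: "AE x in lebesgue. (\<lambda>n. f (r n) x) \<longlonglongrightarrow> g x"
    using fin
  proof eventually_elim
    fix x assume "(\<Sum>n. ennreal (2 ^ n * D n x)) \<noteq> \<infinity>"
    then obtain T where T: "T \<ge> 0" "(\<Sum>n. ennreal (2 ^ n * D n x)) = ennreal T"
      by (metis ennreal_cases infinity_ennreal_def)
    have "ennreal (2 ^ n * D n x) \<le> ennreal T" for n
      unfolding T(2)[symmetric] using sum_le_suminf[OF summableI, of "{n}" "\<lambda>n. ennreal (2 ^ n * D n x)"] by simp
    then have le: "2 ^ n * D n x \<le> T" for n
      using T(1) by (simp add: ennreal_le_iff)
    have bd: "norm (f (r (Suc n)) x - f (r n) x) \<le> sqrt T * (1 / sqrt 2) ^ n" for n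
    proof -
      have "cmod (f (r (Suc n)) x - f (r n) x) = sqrt (D n x)"
        by (simp add: D_def)
      also have "\<dots> \<le> sqrt (T / 2 ^ n)"
        using le[of n] by (simp add: field_simps)
      also have "\<dots> = sqrt T * (1 / sqrt 2) ^ n"
        by (simp add: real_sqrt_divide power_divide real_sqrt_power)
      finally show ?thesis .
    qed
    have "summable (\<lambda>n. sqrt T * (1 / sqrt 2) ^ n)"
      by (intro summable_mult summable_geometric) simp
    then have "summable (\<lambda>n. f (r (Suc n)) x - f (r n) x)"
      by (rule summable_comparison_test'[where N=0]) (rule bd)
    then have "convergent (\<lambda>n. (f (r n) x - f (r 0) x) + f (r 0) x)"
      unfolding summable_iff_convergent sum_lessThan_telescope[of "\<lambda>n. f (r n) x"]
      by (intro convergent_add convergent_const)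
    then have "convergent (\<lambda>n. f (r n) x)"
      by simp
    then show "(\<lambda>n. f (r n) x) \<longlonglongrightarrow> g x"
      unfolding g_def by (simp add: convergent_LIMSEQ_iff)
  qed
  have close: "L2 (\<lambda>x. f k x - g x) \<and> nsq (\<lambda>x. f k x - g x) \<le> (1/4) ^ j" if "k \<ge> N j" for j k
  proof -
    have "(\<integral>\<^sup>+x. ennreal ((cmod (f k x - g x))\<^sup>2) \<partial>lebesgue) \<le> ennreal ((1/4) ^ j)"
    proof (rule nn_integral_le_AE_limit[where u="\<lambda>n x. (cmod (f k x - f (r n) x))\<^sup>2"])
      show "AE x in lebesgue. (\<lambda>n. (cmod (f k x - f (r n) x))\<^sup>2) \<longlonglongrightarrow> (cmod (f k x - g x))\<^sup>2"
        using lim by eventually_elim (intro tendsto_intros)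
      show "\<forall>\<^sub>F n in sequentially. (\<integral>\<^sup>+x. ennreal ((cmod (f k x - f (r n) x))\<^sup>2) \<partial>lebesgue) \<le> ennreal ((1/4) ^ j)"
        using eventually_ge_at_top[of j]
      proof eventually_elim
        case (elim n)
        show ?case
          by (subst nn_integral_nsq) (auto intro!: L2_diff L2 ennreal_leI less_imp_le[OF N] that r elim)
      qed
    qed measurable
    then show ?thesis
      using L2I_nn_integral[of "\<lambda>x. f k x - g x" "(1/4) ^ j"] by simp
  qed
  have "L2 g"
    using L2_diff(1)[OF L2 close[THEN conjunct1, OF order_refl], of 0 "N 0"]
    using L2_diff(1)[OF L2[of "N 0"] close[THEN conjunct1, OF order_refl[of "N 0"]]] by simp
  moreover have "tends_L2 f g"
  proof (rule LIMSEQ_I)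
    fix e :: real assume "e > 0"
    obtain j where "(1/4) ^ j < e"
      using real_arch_pow_inv[OF \<open>e > 0\<close>, of "1/4"] by auto
    then have "\<forall>n\<ge>N j. norm (nsq (\<lambda>x. f n x - g x) - 0) < e"
      using close by (auto intro: le_less_trans)
    then show "\<exists>no. \<forall>n\<ge>no. norm (nsq (\<lambda>x. f n x - g x) - 0) < e" by blast
  qed
  ultimately show ?thesis by blast
qed

section \<open>Density of bounded continuous integrable functions in L2\<close>

lemma borel_imp_lebesgue_measurable: "f \<in> borel_measurable borel \<Longrightarrow> f \<in> borel_measurable lebesgue"
  by (auto intro: measurable_completion)

lemma core_bound:
  assumes "core f"
  obtains B where "B > 0" "\<And>x. cmod (f x) \<le> B"
  using assms unfolding core_def bounded_pos by auto

lemma core_L2: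
  assumes "core f"
  shows "L2 f"
proof -
  note [measurable] = core_measurable[OF assms]
  obtain B where B: "B > 0" "\<And>x. cmod (f x) \<le> B"
    by (rule core_bound[OF assms]) blast
  have f: "integrable lborel f" using assms by (simp add: core_def)
  have "integrable lborel (\<lambda>x. (cmod (f x))\<^sup>2)"
  proof (rule Bochner_Integration.integrable_bound[OF integrable_mult_right[OF integrable_norm[OF f], of B]])
    show "AE x in lborel. norm ((cmod (f x))\<^sup>2) \<le> norm (B * cmod (f x))"
      using B by (auto simp: power2_eq_square intro!: mult_right_mono)
  qed auto
  then show ?thesis
    unfolding L2_def by (auto simp: integrable_completion intro: measurable_completion)
qed

lemma nsq_borel:
  assumes [measurable]: "f \<in> borel_measurable borel"
  shows "nsq f = (\<integral>x. (cmod (f x))\<^sup>2 \<partial>lborel)"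
  unfolding nsq_def by (rule integral_completion) measurable

lemma L2_approx_bounded:
  fixes f :: "'a::euclidean_space \<Rightarrow> complex"
  assumes "L2 f" "e > 0"
  shows "\<exists>k>0. nsq (\<lambda>x. f x - (if norm x \<le> k \<and> cmod (f x) \<le> k then f x else 0)) < e"
proof -
  note [measurable] = L2_measurable[OF assms(1)]
  have [measurable]: "(\<lambda>x::'a. norm x) \<in> borel_measurable lebesgue"
    by (intro borel_imp_lebesgue_measurable) simp
  define F where "F n x = (if norm x \<le> real n \<and> cmod (f x) \<le> real n then f x else 0)" for n x
  have [measurable]: "F n \<in> borel_measurable lebesgue" for n
    unfolding F_def[abs_def] by measurable
  have "(\<lambda>n. nsq (\<lambda>x. f x - F n x)) \<longlonglongrightarrow> (\<integral>(x::'a). 0 \<partial>lebesgue)"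
    unfolding nsq_def
  proof (rule integral_dominated_convergence)
    show "integrable lebesgue (\<lambda>x. (cmod (f x))\<^sup>2)"
      by (rule L2_integrable[OF assms(1)])
    show "AE x in lebesgue. (\<lambda>n. (cmod (f x - F n x))\<^sup>2) \<longlonglongrightarrow> 0"
    proof (intro AE_I2)
      fix x
      obtain m where m: "max (norm x) (cmod (f x)) \<le> real m"
        using real_arch_simple by blast
      have "\<forall>\<^sub>F n in sequentially. (cmod (f x - F n x))\<^sup>2 = 0"
        using eventually_ge_at_top[of m]
      proof eventually_elim
        case (elim n)
        then have "real m \<le> real n" by simp
        with m show ?case by (simp add: F_def)
      qed
      then show "(\<lambda>n. (cmod (f x - F n x))\<^sup>2) \<longlonglongrightarrow> 0"
        by (rule tendsto_eventually)
    qed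
    show "AE x in lebesgue. norm ((cmod (f x - F n x))\<^sup>2) \<le> (cmod (f x))\<^sup>2" for n
      by (auto simp: F_def)
  qed measurable
  then have "\<forall>\<^sub>F n in sequentially. nsq (\<lambda>x. f x - F n x) < e"
    using assms(2) by (intro order_tendstoD) auto
  then have "\<forall>\<^sub>F n in sequentially. nsq (\<lambda>x. f x - F n x) < e \<and> n > 0"
    using eventually_gt_at_top[of 0] by eventually_elim auto
  then obtain n where "nsq (\<lambda>x. f x - F n x) < e" "n > 0"
    using eventually_happens trivial_limit_sequentially by blast
  then show ?thesis
    by (intro exI[of _ "real n"]) (auto simp: F_def)
qed

text \<open>\<open>measurable_on\<close> gives continuous functions converging to \<open>F\<close>
  off a negligible set, with no control of size or support. \<open>clip\<close> bounds the modulus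
  by \<open>k\<close> and \<open>cut\<close> removes everything beyond radius \<open>k + 1\<close>;
  both are continuous and leave the limit alone, as \<open>F\<close> is bounded by \<open>k\<close>
  and \<open>cut\<close> is 1 on the ball of radius \<open>k\<close>.\<close>

lemma bounded_support_approx_core:
  fixes F :: "'a::euclidean_space \<Rightarrow> complex"
  assumes F: "F \<in> borel_measurable lebesgue" and k: "k > 0"
    and bd: "\<And>x. cmod (F x) \<le> k" and supp: "\<And>x. norm x > k \<Longrightarrow> F x = 0" and e: "e > 0"
  shows "\<exists>h. core h \<and> nsq (\<lambda>x. F x - h x) < e"
proof -
  note [measurable] = F
  have "F measurable_on UNIV"
    using F lebesgue_measurable_imp_measurable_on[of F UNIV] by (simp add: lebesgue_on_UNIV_eq)
  then obtain N g where N: "negligible N" and g: "\<And>n. continuous_on UNIV (g n)"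
    and lim: "\<And>x. x \<notin> N \<Longrightarrow> (\<lambda>n. g n x) \<longlonglongrightarrow> F x"
    unfolding measurable_on_def by auto
  define clip where "clip z = z * complex_of_real (k / max k (cmod z))" for z
  define cut where "cut x = max 0 (min 1 (k + 1 - norm x))" for x :: 'a
  define h where "h n x = clip (g n x) * complex_of_real (cut x)" for n x
  have clip_cont: "isCont clip z" for z
    unfolding clip_def using k by (intro continuous_intros) auto
  have clip_bd: "cmod (clip z) \<le> k" for z
  proof -
    have "cmod z * k \<le> max k (cmod z) * k" using k by (intro mult_right_mono) auto
    moreover have "cmod (clip z) = cmod z * k / max k (cmod z)"
      using k unfolding clip_def norm_mult norm_of_real by simp
    moreover have "max k (cmod z) > 0" using k by auto
    ultimately show ?thesis by (simp only: pos_divide_le_eq mult.commute)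
  qed
  have clip_id: "clip z = z" if "cmod z \<le> k" for z
    using that k by (simp add: clip_def max_def)
  have cut_bd: "0 \<le> cut x" "cut x \<le> 1" for x by (auto simp: cut_def)
  have h_cont: "continuous_on UNIV (h n)" for n
    unfolding h_def[abs_def] cut_def
    by (intro continuous_intros continuous_on_compose2[OF continuous_at_imp_continuous_on[of UNIV clip] g])
       (auto intro: clip_cont)
  have h_meas: "h n \<in> borel_measurable borel" for n
    by (rule borel_measurable_continuous_onI[OF h_cont])
  have h_bd: "cmod (h n x) \<le> k" for n x
    unfolding h_def norm_mult using mult_mono[OF clip_bd[of "g n x"] cut_bd(2)[of x]] k cut_bd[of x] by simp
  have h_supp: "h n x = 0" if "x \<notin> cball 0 (k + 1)" for n x
    using that by (simp add: h_def cut_def)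
  have h_le: "cmod (h n x) \<le> k * indicator (cball 0 (k+1)) x" for n x
    using h_bd[of n x] h_supp[of x n] by (auto split: split_indicator)
  have ib: "integrable lborel (\<lambda>x::'a. c * indicator (cball 0 (k+1)) x :: real)" for c
    by (intro integrable_mult_right integrable_real_indicator) (use emeasure_bounded_finite[OF bounded_cball[of 0 "k + 1"]] in auto)
  have core: "core (h n)" for n
    unfolding core_def
  proof (intro conjI h_cont)
    show "bounded (range (h n))" using h_bd by (auto simp: bounded_iff)
    show "integrable lborel (h n)"
      by (rule Bochner_Integration.integrable_bound[OF ib[of k]]) (use h_le k h_meas in auto)
  qed
  have "(\<lambda>n. nsq (\<lambda>x. F x - h n x)) \<longlonglongrightarrow> (\<integral>(x::'a). 0 \<partial>lebesgue)"
    unfolding nsq_def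
  proof (rule integral_dominated_convergence)
    show "integrable lebesgue (\<lambda>x::'a. (2 * k)\<^sup>2 * indicator (cball 0 (k+1)) x)"
      by (rule integrable_completion[THEN iffD2, OF borel_measurable_integrable[OF ib] ib])
    have "AE x in lebesgue. x \<notin> N"
      using N by (simp add: negligible_iff_null_sets AE_not_in)
    then show "AE x in lebesgue. (\<lambda>n. (cmod (F x - h n x))\<^sup>2) \<longlonglongrightarrow> 0"
    proof eventually_elim
      case (elim x)
      have "(\<lambda>n. h n x) \<longlonglongrightarrow> clip (F x) * complex_of_real (cut x)"
        unfolding h_def by (intro tendsto_intros isCont_tendsto_compose[OF clip_cont] lim elim)
      also have "clip (F x) * complex_of_real (cut x) = F x"
        unfolding clip_id[OF bd] using supp[of x] by (cases "norm x > k") (auto simp: cut_def)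
      finally have "(\<lambda>n. (cmod (F x - h n x))\<^sup>2) \<longlonglongrightarrow> (cmod (F x - F x))\<^sup>2"
        by (intro tendsto_intros)
      then show ?case by simp
    qed
    fix n
    show "AE x in lebesgue. norm ((cmod (F x - h n x))\<^sup>2) \<le> (2 * k)\<^sup>2 * indicator (cball 0 (k+1)) x"
    proof (intro AE_I2)
      fix x
      have "cmod (F x - h n x) \<le> 2 * k * indicator (cball 0 (k+1)) x"
        using norm_triangle_ineq4[of "F x" "h n x"] bd[of x] h_bd[of n x] supp[of x] h_supp[of x n] k
        by (auto split: split_indicator)
      from power_mono[OF this norm_ge_zero, of 2]
      show "norm ((cmod (F x - h n x))\<^sup>2) \<le> (2 * k)\<^sup>2 * indicator (cball 0 (k+1)) x"
        by (auto split: split_indicator simp: power_mult_distrib)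
    qed
    show "(\<lambda>x. (cmod (F x - h n x))\<^sup>2) \<in> borel_measurable lebesgue"
      using borel_imp_lebesgue_measurable[OF h_meas[of n]] by measurable
  qed auto
  then have "\<forall>\<^sub>F n in sequentially. nsq (\<lambda>x. F x - h n x) < e"
    using e by (intro order_tendstoD) auto
  then obtain n where "nsq (\<lambda>x. F x - h n x) < e"
    using eventually_happens trivial_limit_sequentially by blast
  then show ?thesis using core by blast
qed

lemma core_dense:
  fixes f :: "'a::euclidean_space \<Rightarrow> complex"
  assumes "L2 f" "e > 0"
  shows "\<exists>h. core h \<and> nsq (\<lambda>x. f x - h x) < e"
proof -
  note [measurable] = L2_measurable[OF assms(1)]
  obtain k where k: "k > 0" "nsq (\<lambda>x. f x - (if norm x \<le> k \<and> cmod (f x) \<le> k then f x else 0)) < e / 4"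
    using L2_approx_bounded[OF assms(1), of "e / 4"] assms(2) by auto
  have [measurable]: "(\<lambda>x::'a. norm x) \<in> borel_measurable lebesgue"
    by (intro borel_imp_lebesgue_measurable) simp
  define F where "F x = (if norm x \<le> k \<and> cmod (f x) \<le> k then f x else 0)" for x
  have [measurable]: "F \<in> borel_measurable lebesgue"
    unfolding F_def[abs_def] by measurable
  have F: "L2 F"
    by (rule L2_bounded_by(1)[OF assms(1), of _ 1]) (auto simp: F_def)
  have "cmod (F x) \<le> k" "norm x > k \<Longrightarrow> F x = 0" for x
    using k by (auto simp: F_def)
  then obtain h where h: "core h" "nsq (\<lambda>x. F x - h x) < e / 4"
    using bounded_support_approx_core[of F k "e / 4"] k assms(2) by auto
  have "nsq (\<lambda>x. f x - h x) \<le> 2 * nsq (\<lambda>x. f x - F x) + 2 * nsq (\<lambda>x. F x - h x)"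
    by (intro nsq_triangle assms F core_L2 h)
  also have "\<dots> < e"
    using k(2) h(2) unfolding F_def by linarith
  finally show ?thesis using h(1) by blast
qed

lemma core_dense_seq:
  assumes "L2 f"
  obtains F where "\<And>n. core (F n)" "tends_L2 F f"
proof -
  have "\<forall>n. \<exists>h. core h \<and> nsq (\<lambda>x. f x - h x) < 1 / real (Suc n)"
    using core_dense[OF assms] by simp
  then obtain F where F: "\<And>n. core (F n)" "\<And>n. nsq (\<lambda>x. f x - F n x) < 1 / real (Suc n)"
    by metis
  have "tends_L2 F f"
  proof (rule Lim_null_comparison)
    show "\<forall>\<^sub>F n in sequentially. norm (nsq (\<lambda>x. F n x - f x)) \<le> 1 / real (Suc n)"
      using F(2) by (intro always_eventually allI) (simp add: nsq_diff_commute less_imp_le)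
    show "(\<lambda>n. 1 / real (Suc n)) \<longlonglongrightarrow> 0"
      by (rule lim_1_over_n[THEN LIMSEQ_Suc])
  qed
  then show thesis using that F by blast
qed

section \<open>The Fourier transform on L2\<close>

definition ft :: "('a::euclidean_space \<Rightarrow> complex) \<Rightarrow> 'a \<Rightarrow> complex" where
  "ft f \<xi> = of_real (1 / sqrt (2 * pi) ^ DIM('a)) * hat f \<xi>"

lemma ft_measurable [measurable]:
  "f \<in> borel_measurable borel \<Longrightarrow> ft f \<in> borel_measurable borel"
  unfolding ft_def[abs_def] by simp

lemma ft_core:
  fixes f :: "'a::euclidean_space \<Rightarrow> complex"
  assumes "core f"
  shows "L2 (ft f)" "nsq (ft f) = nsq f"
proof -
  note [measurable] = core_measurable[OF assms]
  let ?c = "1 / sqrt (2 * pi) ^ DIM('a)"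
  have "sqrt (2 * pi) ^ DIM('a) * sqrt (2 * pi) ^ DIM('a) = (2 * pi) ^ DIM('a)"
    by (subst power_mult_distrib[symmetric]) simp
  then have c: "?c\<^sup>2 * (2 * pi) ^ DIM('a) = 1"
    by (simp add: power2_eq_square)
  have eq: "(cmod (ft f \<xi>))\<^sup>2 = ?c\<^sup>2 * (cmod (hat f \<xi>))\<^sup>2" for \<xi>
    unfolding ft_def norm_mult norm_of_real power_mult_distrib by simp
  have "has_bochner_integral lborel (\<lambda>\<xi>. ?c\<^sup>2 * (cmod (hat f \<xi>))\<^sup>2) (?c\<^sup>2 * ((2 * pi) ^ DIM('a) * (\<integral>x. (cmod (f x))\<^sup>2 \<partial>lborel)))"
    by (intro has_bochner_integral_mult_right plancherel_core assms)
  then have *: "has_bochner_integral lborel (\<lambda>\<xi>. (cmod (ft f \<xi>))\<^sup>2) (nsq f)"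
    unfolding eq[symmetric] mult.assoc[symmetric] c by (simp add: nsq_borel)
  then show "L2 (ft f)"
    unfolding L2_def by (auto simp: integrable_completion has_bochner_integral_iff intro!: borel_imp_lebesgue_measurable)
  show "nsq (ft f) = nsq f"
    using * by (simp add: nsq_borel[of "ft f"] has_bochner_integral_iff)
qed

lemma core_lin:
  assumes "core f" "core g"
  shows "core (\<lambda>x. a * f x + b * g x)"
proof -
  obtain B where B: "B > 0" "\<And>x. cmod (f x) \<le> B"
    by (rule core_bound[OF assms(1)]) blast
  obtain C where C: "C > 0" "\<And>x. cmod (g x) \<le> C"
    by (rule core_bound[OF assms(2)]) blast
  have "cmod (a * f x + b * g x) \<le> cmod a * B + cmod b * C" for x
    by (intro order_trans[OF norm_triangle_ineq] add_mono) (auto simp: norm_mult intro!: mult_left_mono B C)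
  then have "bounded (range (\<lambda>x. a * f x + b * g x))"
    by (auto simp: bounded_iff)
  with assms show ?thesis
    unfolding core_def by (auto intro!: continuous_intros)
qed

lemma ft_lin:
  assumes "core f" "core g"
  shows "ft (\<lambda>x. a * f x + b * g x) \<xi> = a * ft f \<xi> + b * ft g \<xi>"
  using assms unfolding ft_def core_def by (subst hat_add) (auto simp: hat_cmult ring_distribs add_divide_distrib)

lemma core_diff: "core f \<Longrightarrow> core g \<Longrightarrow> core (\<lambda>x. f x - g x)"
  using core_lin[of f g 1 "-1"] by simp

lemma ft_diff: "core f \<Longrightarrow> core g \<Longrightarrow> ft (\<lambda>x. f x - g x) \<xi> = ft f \<xi> - ft g \<xi>"
  using ft_lin[of f g 1 "-1"] by simp

text \<open>A relation rather than a function, since the transform is determined only almost everywhere.\<close>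

definition fourier_pair :: "('a::euclidean_space \<Rightarrow> complex) \<Rightarrow> ('a \<Rightarrow> complex) \<Rightarrow> bool" where
  "fourier_pair f g \<longleftrightarrow> L2 f \<and> L2 g \<and> (\<exists>F. (\<forall>n. core (F n)) \<and>
     tends_L2 F f \<and> tends_L2 (\<lambda>n. ft (F n)) g)"

lemma fourier_pair_L2:
  assumes "fourier_pair f g"
  shows "L2 f" "L2 g"
  using assms by (auto simp: fourier_pair_def)

lemma fourier_pairE:
  assumes "fourier_pair f g"
  obtains F where "\<And>n. core (F n)" "tends_L2 F f" "tends_L2 (\<lambda>n. ft (F n)) g"
  using assms by (auto simp: fourier_pair_def)

lemma fourier_pair_core: "core f \<Longrightarrow> fourier_pair f (ft f)"
  unfolding fourier_pair_def by (auto intro!: core_L2 ft_core exI[of _ "\<lambda>n. f"] simp: nsq_def)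

text \<open>The isometry on \<open>core\<close> makes the transforms of an approximating sequence
  Cauchy, and completeness supplies their limit.\<close>

lemma fourier_pair_exists:
  fixes f :: "'a::euclidean_space \<Rightarrow> complex"
  assumes "L2 f"
  shows "\<exists>g. fourier_pair f g"
proof -
  obtain F where F: "\<And>n. core (F n)" and lim: "tends_L2 F f"
    by (rule core_dense_seq[OF assms]) blast
  have "\<exists>g. L2 g \<and> tends_L2 (\<lambda>n. ft (F n)) g"
  proof (rule L2_complete[OF ft_core(1)[OF F]])
    fix e :: real assume "e > 0"
    then obtain N where N: "nsq (\<lambda>x. F n x - f x) < e / 4" if "n \<ge> N" for n
      using LIMSEQ_D[OF lim, of "e / 4"] by auto
    have "nsq (\<lambda>x. ft (F m) x - ft (F n) x) < e" if "m \<ge> N" "n \<ge> N" for m n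
    proof -
      have "nsq (\<lambda>x. ft (F m) x - ft (F n) x) = nsq (ft (\<lambda>x. F m x - F n x))"
        by (rule arg_cong[where f=nsq]) (simp add: fun_eq_iff ft_diff[OF F F])
      also have "\<dots> = nsq (\<lambda>x. F m x - F n x)"
        by (rule ft_core(2)[OF core_diff[OF F F]])
      also have "\<dots> \<le> 2 * nsq (\<lambda>x. F m x - f x) + 2 * nsq (\<lambda>x. f x - F n x)"
        by (intro nsq_triangle core_L2 F assms)
      also have "\<dots> < e"
        using N[OF that(1)] N[OF that(2)] nsq_diff_commute[of f "F n"] by simp
      finally show ?thesis .
    qed
    then show "\<exists>N. \<forall>m\<ge>N. \<forall>n\<ge>N. nsq (\<lambda>x. ft (F m) x - ft (F n) x) < e" by blast
  qed
  then show ?thesis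
    unfolding fourier_pair_def using assms F lim by blast
qed

lemma fourier_pair_nsq:
  assumes "fourier_pair f g"
  shows "nsq g = nsq f"
proof -
  obtain F where F: "\<And>n. core (F n)" "tends_L2 F f" "tends_L2 (\<lambda>n. ft (F n)) g"
    by (rule fourier_pairE[OF assms]) blast
  have "(\<lambda>n. nsq (F n)) \<longlonglongrightarrow> nsq f"
    by (intro nsq_tendsto core_L2 F fourier_pair_L2[OF assms])
  moreover have "(\<lambda>n. nsq (ft (F n))) \<longlonglongrightarrow> nsq g"
    by (intro nsq_tendsto ft_core F fourier_pair_L2[OF assms])
  ultimately show ?thesis
    by (simp add: ft_core(2)[OF F(1)] LIMSEQ_unique)
qed

lemma fourier_pair_mult_formula:
  assumes "fourier_pair u u'" "fourier_pair v v'"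
  shows "(\<integral>x. u' x * v x \<partial>lebesgue) = (\<integral>x. u x * v' x \<partial>lebesgue)"
proof -
  obtain F where F: "\<And>n. core (F n)" "tends_L2 F u" "tends_L2 (\<lambda>n. ft (F n)) u'"
    by (rule fourier_pairE[OF assms(1)]) blast
  obtain G where G: "\<And>n. core (G n)" "tends_L2 G v" "tends_L2 (\<lambda>n. ft (G n)) v'"
    by (rule fourier_pairE[OF assms(2)]) blast
  note L2 = fourier_pair_L2[OF assms(1)] fourier_pair_L2[OF assms(2)]
  have "(\<lambda>n. \<integral>x. ft (F n) x * G n x \<partial>lebesgue) \<longlonglongrightarrow> (\<integral>x. u' x * v x \<partial>lebesgue)"
    by (intro L2_prod_tendsto core_L2 ft_core F G L2)
  moreover have "(\<integral>x. ft (F n) x * G n x \<partial>lebesgue) = (\<integral>x. F n x * ft (G n) x \<partial>lebesgue)" for n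
  proof -
    note [measurable] = core_measurable[OF F(1)] core_measurable[OF G(1)]
    have "(\<integral>x. ft (F n) x * G n x \<partial>lborel) = (\<integral>x. F n x * ft (G n) x \<partial>lborel)"
      using F(1)[of n] G(1)[of n] hat_mult_formula[of "F n" "G n"]
      unfolding core_def by (simp add: ft_def mult.assoc mult.left_commute)
    then show ?thesis
      by (subst (1 2) integral_completion) auto
  qed
  moreover have "(\<lambda>n. \<integral>x. F n x * ft (G n) x \<partial>lebesgue) \<longlonglongrightarrow> (\<integral>x. u x * v' x \<partial>lebesgue)"
    by (intro L2_prod_tendsto core_L2 ft_core F G L2)
  ultimately show ?thesis
    by (simp add: LIMSEQ_unique)
qed

lemma L2_lin:
  assumes "L2 f" "L2 g"
  shows "L2 (\<lambda>x. a * f x + b * g x)"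
  by (intro L2_add L2_cmult assms)

lemma nsq_lin_tendsto_0:
  assumes F: "\<And>n. L2 (F n)" "L2 f" "tends_L2 F f"
    and G: "\<And>n. L2 (G n)" "L2 g" "tends_L2 G g"
  shows "(\<lambda>n. nsq (\<lambda>x. (a * F n x + b * G n x) - (a * f x + b * g x))) \<longlonglongrightarrow> 0"
proof (rule Lim_null_comparison)
  let ?r = "\<lambda>n. 2 * ((cmod a)\<^sup>2 * nsq (\<lambda>x. F n x - f x)) + 2 * ((cmod b)\<^sup>2 * nsq (\<lambda>x. G n x - g x))"
  show "\<forall>\<^sub>F n in sequentially. norm (nsq (\<lambda>x. (a * F n x + b * G n x) - (a * f x + b * g x))) \<le> ?r n"
  proof (intro always_eventually allI)
    fix n
    have "nsq (\<lambda>x. a * (F n x - f x) + b * (G n x - g x)) \<le> ?r n"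
      unfolding nsq_cmult[symmetric] by (intro L2_add L2_cmult L2_diff F G)
    then show "norm (nsq (\<lambda>x. (a * F n x + b * G n x) - (a * f x + b * g x))) \<le> ?r n"
      by (simp add: algebra_simps)
  qed
  have "?r \<longlonglongrightarrow> 2 * ((cmod a)\<^sup>2 * 0) + 2 * ((cmod b)\<^sup>2 * 0)"
    by (intro tendsto_intros F G)
  then show "?r \<longlonglongrightarrow> 0" by simp
qed

lemma fourier_pair_lin:
  assumes "fourier_pair f g" "fourier_pair f' g'"
  shows "fourier_pair (\<lambda>x. a * f x + b * f' x) (\<lambda>x. a * g x + b * g' x)"
proof -
  obtain F where F: "\<And>n. core (F n)" "tends_L2 F f" "tends_L2 (\<lambda>n. ft (F n)) g"
    by (rule fourier_pairE[OF assms(1)]) blast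
  obtain G where G: "\<And>n. core (G n)" "tends_L2 G f'" "tends_L2 (\<lambda>n. ft (G n)) g'"
    by (rule fourier_pairE[OF assms(2)]) blast
  note L2 = fourier_pair_L2[OF assms(1)] fourier_pair_L2[OF assms(2)]
  have 1: "(\<lambda>n. nsq (\<lambda>x. (a * F n x + b * G n x) - (a * f x + b * f' x))) \<longlonglongrightarrow> 0"
    by (intro nsq_lin_tendsto_0 core_L2 F G L2)
  have "(\<lambda>n. nsq (\<lambda>x. (a * ft (F n) x + b * ft (G n) x) - (a * g x + b * g' x))) \<longlonglongrightarrow> 0"
    by (intro nsq_lin_tendsto_0 ft_core F G L2)
  then have 2: "(\<lambda>n. nsq (\<lambda>x. ft (\<lambda>x. a * F n x + b * G n x) x - (a * g x + b * g' x))) \<longlonglongrightarrow> 0"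
    by (simp add: ft_lin[OF F(1) G(1)])
  show ?thesis
    unfolding fourier_pair_def
    using 1 2 by (intro conjI exI[of _ "\<lambda>n x. a * F n x + b * G n x"] L2_lin L2 allI core_lin F G) auto
qed

lemma fourier_pair_cmult: "fourier_pair f g \<Longrightarrow> fourier_pair (\<lambda>x. a * f x) (\<lambda>x. a * g x)"
  using fourier_pair_lin[of f g f g a 0] by simp

lemma fourier_pair_diff: "fourier_pair f g \<Longrightarrow> fourier_pair f' g' \<Longrightarrow> fourier_pair (\<lambda>x. f x - f' x) (\<lambda>x. g x - g' x)"
  using fourier_pair_lin[of f g f' g' 1 "-1"] by simp

lemma fourier_pair_cong_AE:
  assumes "fourier_pair f g" and f: "AE x in lebesgue. f x = f' x" and g: "AE x in lebesgue. g x = g' x"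
  shows "fourier_pair f' g'"
proof -
  have 1: "nsq (\<lambda>x. F x - f' x) = nsq (\<lambda>x. F x - f x)" for F
    by (rule nsq_cong_AE, rule eventually_mono[OF f]) simp
  have 2: "nsq (\<lambda>x. F x - g' x) = nsq (\<lambda>x. F x - g x)" for F
    by (rule nsq_cong_AE, rule eventually_mono[OF g]) simp
  have "L2 f'" "L2 g'"
    using L2_cong_AE[OF _ f] L2_cong_AE[OF _ g] assms(1) by (auto simp: fourier_pair_def)
  then show ?thesis
    using assms(1) unfolding fourier_pair_def 1 2 by simp
qed

text \<open>The isometry applied to the difference of the pairs: uniqueness of the transform and its
  injectivity at once.\<close>

lemma fourier_pair_AE_iff:
  assumes "fourier_pair f g" "fourier_pair f' g'"
  shows "(AE x in lebesgue. f x = f' x) \<longleftrightarrow> (AE x in lebesgue. g x = g' x)"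
proof -
  have FP: "fourier_pair (\<lambda>x. f x - f' x) (\<lambda>x. g x - g' x)"
    by (rule fourier_pair_diff[OF assms])
  show ?thesis
    using nsq_eq_0_iff[OF fourier_pair_L2(1)[OF FP]] nsq_eq_0_iff[OF fourier_pair_L2(2)[OF FP]] fourier_pair_nsq[OF FP]
    by simp
qed

text \<open>The coefficients 1 stay unsimplified so that each term has the shape produced by
  \<open>fourier_pair_lin\<close>; Parseval then follows by rewriting.\<close>

lemma L2_polarization:
  assumes "L2 f" "L2 g"
  shows "4 * (\<integral>x. f x * cnj (g x) \<partial>lebesgue) =
    complex_of_real (nsq (\<lambda>x. 1 * f x + 1 * g x)) - complex_of_real (nsq (\<lambda>x. 1 * f x + (-1) * g x))
    + \<i> * (complex_of_real (nsq (\<lambda>x. 1 * f x + \<i> * g x)) - complex_of_real (nsq (\<lambda>x. 1 * f x + (-\<i>) * g x)))"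
proof -
  let ?p = "\<lambda>a x. (1 * f x + a * g x) * cnj (1 * f x + a * g x)"
  have i: "integrable lebesgue (?p a)" for a
    by (intro L2_prod_integrable L2_cnj L2_lin assms)
  have "(\<lambda>x. 4 * (f x * cnj (g x))) = (\<lambda>x. ?p 1 x - ?p (-1) x + \<i> * (?p \<i> x - ?p (-\<i>) x))"
  proof
    fix x
    have p: "?p a x = f x * cnj (f x) + cnj a * (f x * cnj (g x)) + a * (g x * cnj (f x)) + (a * cnj a) * (g x * cnj (g x))" for a
      by (simp add: algebra_simps)
    show "4 * (f x * cnj (g x)) = ?p 1 x - ?p (-1) x + \<i> * (?p \<i> x - ?p (-\<i>) x)"
      unfolding p by (simp add: algebra_simps)
  qed
  then have "4 * (\<integral>x. f x * cnj (g x) \<partial>lebesgue) = (\<integral>x. ?p 1 x - ?p (-1) x + \<i> * (?p \<i> x - ?p (-\<i>) x) \<partial>lebesgue)"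
    unfolding integral_mult_right_zero[symmetric] by (rule arg_cong)
  also have "\<dots> = (\<integral>x. ?p 1 x \<partial>lebesgue) - (\<integral>x. ?p (-1) x \<partial>lebesgue)
       + \<i> * ((\<integral>x. ?p \<i> x \<partial>lebesgue) - (\<integral>x. ?p (-\<i>) x \<partial>lebesgue))"
    by (simp only: Bochner_Integration.integral_add Bochner_Integration.integral_diff integral_mult_right_zero
        Bochner_Integration.integrable_add Bochner_Integration.integrable_diff integrable_mult_right i)
  finally show ?thesis unfolding nsq_eq_prod .
qed

theorem fourier_pair_parseval:
  assumes "fourier_pair f g" "fourier_pair f' g'"
  shows "(\<integral>x. f x * cnj (f' x) \<partial>lebesgue) = (\<integral>x. g x * cnj (g' x) \<partial>lebesgue)"
proof -
  have "4 * (\<integral>x. f x * cnj (f' x) \<partial>lebesgue) = 4 * (\<integral>x. g x * cnj (g' x) \<partial>lebesgue)"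
    unfolding L2_polarization[OF fourier_pair_L2(1)[OF assms(1)] fourier_pair_L2(1)[OF assms(2)]]
      L2_polarization[OF fourier_pair_L2(2)[OF assms(1)] fourier_pair_L2(2)[OF assms(2)]]
      fourier_pair_nsq[OF fourier_pair_lin[OF assms]] ..
  then show ?thesis by simp
qed

text \<open>The preimage is the conjugate \<open>f\<close> of the transform of \<open>cnj g\<close>.
  With \<open>f'\<close> the transform of \<open>f\<close>, the multiplication formula evaluates the
  inner product of \<open>f'\<close> and \<open>g\<close> as \<open>nsq f\<close>, and the isometry
  makes \<open>nsq f\<close>, \<open>nsq f'\<close> and \<open>nsq g\<close> equal, so the expansion
  of \<open>nsq\<close> of \<open>f' - g\<close> cancels.\<close>

theorem fourier_pair_surj:
  assumes g: "L2 g"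
  shows "\<exists>f. fourier_pair f g"
proof -
  obtain r where r: "fourier_pair (\<lambda>x. cnj (g x)) r"
    using fourier_pair_exists[OF L2_cnj[OF g]] by blast
  define f where "f x = cnj (r x)" for x
  have f: "L2 f"
    unfolding f_def by (intro L2_cnj fourier_pair_L2(2)[OF r])
  obtain f' where f': "fourier_pair f f'"
    using fourier_pair_exists[OF f] by blast
  note L2 = fourier_pair_L2(2)[OF f']
  have r_eq: "r = (\<lambda>x. cnj (f x))" by (simp add: f_def)
  have nsq_f: "nsq f = nsq g"
    using fourier_pair_nsq[OF r] by (simp add: nsq_def f_def)
  have 1: "(\<integral>x. f' x * cnj (g x) \<partial>lebesgue) = of_real (nsq f)"
    using fourier_pair_mult_formula[OF f' r] by (simp add: r_eq nsq_eq_prod)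
  then have 2: "(\<integral>x. g x * cnj (f' x) \<partial>lebesgue) = of_real (nsq f)"
    using Bochner_Integration.integral_cnj[of lebesgue "\<lambda>x. f' x * cnj (g x)"] by (simp add: mult.commute)
  have "complex_of_real (nsq (\<lambda>x. f' x - g x)) =
     (\<integral>x. f' x * cnj (f' x) - f' x * cnj (g x) - g x * cnj (f' x) + g x * cnj (g x) \<partial>lebesgue)"
    unfolding nsq_eq_prod by (intro Bochner_Integration.integral_cong) (auto simp: algebra_simps)
  also have "\<dots> = of_real (nsq f') - (\<integral>x. f' x * cnj (g x) \<partial>lebesgue) - (\<integral>x. g x * cnj (f' x) \<partial>lebesgue) + of_real (nsq g)"
    unfolding nsq_eq_prod
    by (simp only: Bochner_Integration.integral_add Bochner_Integration.integral_diff
        Bochner_Integration.integrable_add Bochner_Integration.integrable_diff L2_prod_integrable L2_cnj L2 g)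
  also have "\<dots> = 0"
    unfolding 1 2 using nsq_f fourier_pair_nsq[OF f'] by simp
  finally have "nsq (\<lambda>x. f' x - g x) = 0"
    by simp
  then have "AE x in lebesgue. f' x = g x"
    using nsq_eq_0_iff[OF L2_diff(1)[OF L2 g]] by simp
  then have "fourier_pair f g"
    by (intro fourier_pair_cong_AE[OF f']) auto
  then show ?thesis by blast
qed

section \<open>Convolution operators\<close>

text \<open>\<open>L2\<close> lives on the completed measure, while Fubini and the affine
  substitutions work with \<open>lborel\<close> and Borel functions; this is the bridge.\<close>

lemma lebesgue_borel_representative:
  fixes f :: "'a::euclidean_space \<Rightarrow> complex"
  assumes [measurable]: "f \<in> borel_measurable lebesgue"
  obtains f' where "f' \<in> borel_measurable borel" "AE x in lebesgue. f x = f' x"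
proof -
  have "(\<lambda>x. Re (f x)) \<in> borel_measurable lebesgue" "(\<lambda>x. Im (f x)) \<in> borel_measurable lebesgue"
    by measurable
  then obtain u v where u: "u \<in> borel_measurable lborel" "AE x in lborel. Re (f x) = u x"
    and v: "v \<in> borel_measurable lborel" "AE x in lborel. Im (f x) = v x"
    using completion_ex_borel_measurable_real by metis
  show thesis
  proof
    show "(\<lambda>x. Complex (u x) (v x)) \<in> borel_measurable borel"
      using u(1) v(1) by (auto simp: borel_measurable_complex_iff)
    have "AE x in lborel. f x = Complex (u x) (v x)"
      using u(2) v(2) by eventually_elim (simp add: complex_eq_iff)
    then show "AE x in lebesgue. f x = Complex (u x) (v x)"
      by (rule AE_completion)
  qed
qed

lemma L2_borel_representative:
  fixes f :: "'a::euclidean_space \<Rightarrow> complex"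
  assumes "L2 f"
  obtains f' where "f' \<in> borel_measurable borel" "AE x in lebesgue. f x = f' x" "L2 f'" "nsq f' = nsq f"
proof -
  obtain f' where f': "f' \<in> borel_measurable borel" "AE x in lebesgue. f x = f' x"
    by (rule lebesgue_borel_representative[OF L2_measurable[OF assms]]) blast
  show thesis
    by (rule that[OF f' L2_cong_AE[OF assms f'(2)] nsq_cong_AE[OF f'(2), symmetric]])
qed

text \<open>Integrability alone is the premise, so that the discontinuous kernels of the problem,
  the smooth bumps and the Laplacians of the bumps share one convolution theory.\<close>

locale L1_kernel =
  fixes \<phi> :: "'a::euclidean_space \<Rightarrow> real"
  assumes kernel_integrable: "integrable lborel \<phi>"
begin

definition "K = (\<integral>x. \<bar>\<phi> x\<bar> \<partial>lborel)"

lemma kernel_measurable [measurable]: "\<phi> \<in> borel_measurable borel"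
  using borel_measurable_integrable[OF kernel_integrable] by simp

lemma K_nonneg: "K \<ge> 0"
  by (simp add: K_def)

lemma kernel_reflect:
  "integrable lborel (\<lambda>y. \<phi> (x - y))" "(\<integral>y. \<bar>\<phi> (x - y)\<bar> \<partial>lborel) = K"
  using lborel_integrable_affine[of "-1" \<phi> x] kernel_integrable
    lborel_integral_affine[of "-1" "\<lambda>x. \<bar>\<phi> x\<bar>" x]
  by (auto simp: K_def)

lemma kernel_translate:
  "integrable lborel (\<lambda>x. \<phi> (x - y))" "(\<integral>x. \<bar>\<phi> (x - y)\<bar> \<partial>lborel) = K"
  using lborel_integrable_affine[of 1 \<phi> "-y"] kernel_integrable
    lborel_integral_affine[of 1 "\<lambda>x. \<bar>\<phi> x\<bar>" "-y"]
  by (auto simp: K_def)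

lemma conv_borel:
  assumes [measurable]: "f \<in> borel_measurable borel"
  shows "conv \<phi> f x = (\<integral>y. complex_of_real (\<phi> (x - y)) * f y \<partial>lborel)"
  unfolding conv_def by (rule integral_completion) measurable

lemma conv_measurable:
  assumes [measurable]: "f \<in> borel_measurable borel"
  shows "conv \<phi> f \<in> borel_measurable borel"
proof -
  have "conv \<phi> f = (\<lambda>x. \<integral>y. complex_of_real (\<phi> (x - y)) * f y \<partial>lborel)"
    by (simp add: fun_eq_iff conv_borel)
  then show ?thesis by simp
qed

text \<open>Every value is an integral, so no value changes with \<open>f\<close> on a null set:
  Borel representatives can be substituted without exceptional points.\<close>

lemma conv_cong_AE:
  assumes "f \<in> borel_measurable lebesgue" "AE x in lebesgue. f x = g x"
  shows "conv \<phi> f x = conv \<phi> g x"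
proof -
  have [measurable]: "f \<in> borel_measurable lebesgue" "g \<in> borel_measurable lebesgue"
    using assms borel_measurable_AE by blast+
  have [measurable]: "(\<lambda>y. complex_of_real (\<phi> (x - y))) \<in> borel_measurable lebesgue"
    by (rule borel_imp_lebesgue_measurable) simp
  show ?thesis
    unfolding conv_def using assms(2) by (intro integral_cong_AE) auto
qed

text \<open>Young's inequality. Cauchy-Schwarz with respect to |phi(x - y)| dy bounds the squared
  convolution by \<open>K * ?J x\<close>, and Tonelli gives \<open>?J\<close> the integral
  \<open>K * nsq f\<close>. Finiteness of \<open>?J\<close> almost everywhere is also what makes the
  convolution integral exist.\<close>

lemma conv_L2_borel:
  assumes f [measurable]: "f \<in> borel_measurable borel" and L2: "L2 f"
  shows "AE x in lebesgue. integrable lborel (\<lambda>y. complex_of_real (\<phi> (x - y)) * f y)"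
    and "L2 (conv \<phi> f)" and "nsq (conv \<phi> f) \<le> K\<^sup>2 * nsq f"
proof -
  let ?J = "\<lambda>x. \<integral>\<^sup>+y. ennreal (\<bar>\<phi> (x - y)\<bar> * (cmod (f y))\<^sup>2) \<partial>lborel"
  have "(\<integral>\<^sup>+x. ?J x \<partial>lborel) = (\<integral>\<^sup>+y. (\<integral>\<^sup>+x. ennreal (\<bar>\<phi> (x - y)\<bar> * (cmod (f y))\<^sup>2) \<partial>lborel) \<partial>lborel)"
    by (rule lborel_pair.Fubini'[symmetric]) simp
  also have "\<dots> = (\<integral>\<^sup>+y. ennreal K * ennreal ((cmod (f y))\<^sup>2) \<partial>lborel)"
  proof (rule nn_integral_cong)
    fix y
    have "(\<integral>\<^sup>+x. ennreal (\<bar>\<phi> (x - y)\<bar>) \<partial>lborel) = ennreal K"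
      using kernel_translate[of y] nn_integral_eq_integral[of lborel "\<lambda>x. \<bar>\<phi> (x - y)\<bar>"] by simp
    then show "(\<integral>\<^sup>+x. ennreal (\<bar>\<phi> (x - y)\<bar> * (cmod (f y))\<^sup>2) \<partial>lborel) = ennreal K * ennreal ((cmod (f y))\<^sup>2)"
      by (simp add: ennreal_mult nn_integral_multc)
  qed
  also have "\<dots> = ennreal K * (\<integral>\<^sup>+y. ennreal ((cmod (f y))\<^sup>2) \<partial>lebesgue)"
    by (simp add: nn_integral_cmult nn_integral_completion)
  also have "\<dots> = ennreal (K * nsq f)"
    by (simp add: nn_integral_nsq[OF L2] ennreal_mult K_nonneg)
  finally have J: "(\<integral>\<^sup>+x. ?J x \<partial>lborel) = ennreal (K * nsq f)" .
  then have "AE x in lborel. ?J x \<noteq> \<infinity>"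
    by (intro nn_integral_PInf_AE) auto
  then have *: "AE x in lborel. integrable lborel (\<lambda>y. complex_of_real (\<phi> (x - y)) * f y) \<and>
       ennreal ((cmod (conv \<phi> f x))\<^sup>2) \<le> ennreal K * ?J x"
  proof eventually_elim
    fix x assume fin: "?J x \<noteq> \<infinity>"
    have i1: "integrable lborel (\<lambda>y. \<bar>\<phi> (x - y)\<bar> * (cmod (f y))\<^sup>2)"
      using fin by (intro integrableI_nonneg) (auto simp: top.not_eq_extremum)
    have i2: "integrable lborel (\<lambda>y. \<bar>\<phi> (x - y)\<bar>)"
      using kernel_reflect(1) by simp
    let ?j = "\<integral>y. \<bar>\<phi> (x - y)\<bar> * (cmod (f y))\<^sup>2 \<partial>lborel"
    have Jj: "?J x = ennreal ?j"
      by (rule nn_integral_eq_integral[OF i1]) auto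
    have pw: "2 * cmod (complex_of_real (\<phi> (x - y)) * f y) \<le> t * \<bar>\<phi> (x - y)\<bar> + 1 / t * (\<bar>\<phi> (x - y)\<bar> * (cmod (f y))\<^sup>2)"
      if "t > 0" for t y
    proof -
      have "0 \<le> (t - cmod (f y))\<^sup>2 / t" using that by simp
      also have "\<dots> = t + 1 / t * (cmod (f y))\<^sup>2 - 2 * cmod (f y)"
        using that by (simp add: field_simps power2_eq_square)
      finally have "0 \<le> \<bar>\<phi> (x - y)\<bar> * (t + 1 / t * (cmod (f y))\<^sup>2 - 2 * cmod (f y))"
        by simp
      then show ?thesis by (simp add: norm_mult algebra_simps)
    qed
    have i3: "integrable lborel (\<lambda>y. complex_of_real (\<phi> (x - y)) * f y)"
    proof (rule Bochner_Integration.integrable_bound[OF Bochner_Integration.integrable_add[OF i2 i1]])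
      show "AE y in lborel. norm (complex_of_real (\<phi> (x - y)) * f y) \<le>
          norm (\<bar>\<phi> (x - y)\<bar> + \<bar>\<phi> (x - y)\<bar> * (cmod (f y))\<^sup>2)"
      proof (intro AE_I2)
        fix y
        show "norm (complex_of_real (\<phi> (x - y)) * f y) \<le> norm (\<bar>\<phi> (x - y)\<bar> + \<bar>\<phi> (x - y)\<bar> * (cmod (f y))\<^sup>2)"
          using pw[of 1 y] norm_ge_zero[of "complex_of_real (\<phi> (x - y)) * f y"] unfolding real_norm_def by linarith
      qed
    qed auto
    have "cmod (conv \<phi> f x) \<le> sqrt K * sqrt ?j"
    proof (rule le_sqrt_mult_sqrtI)
      fix t :: real assume t: "t > 0"
      have "cmod (conv \<phi> f x) \<le> (\<integral>y. cmod (complex_of_real (\<phi> (x - y)) * f y) \<partial>lborel)"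
        unfolding conv_borel[OF f] by (rule integral_norm_bound)
      then have "2 * cmod (conv \<phi> f x) \<le> (\<integral>y. 2 * cmod (complex_of_real (\<phi> (x - y)) * f y) \<partial>lborel)"
        by simp
      also have "\<dots> \<le> (\<integral>y. t * \<bar>\<phi> (x - y)\<bar> + 1 / t * (\<bar>\<phi> (x - y)\<bar> * (cmod (f y))\<^sup>2) \<partial>lborel)"
        by (intro integral_mono pw t integrable_mult_right integrable_norm Bochner_Integration.integrable_add i1 i2 i3)
      also have "\<dots> = t * K + ?j / t"
        by (subst Bochner_Integration.integral_add[OF integrable_mult_right[OF i2] integrable_mult_right[OF i1]])
           (simp add: kernel_reflect(2))
      finally show "2 * cmod (conv \<phi> f x) \<le> t * K + ?j / t" .
    qed (auto simp: K_nonneg)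
    then have "(cmod (conv \<phi> f x))\<^sup>2 \<le> (sqrt K * sqrt ?j)\<^sup>2"
      by (intro power_mono) auto
    also have "\<dots> = K * ?j"
      by (simp add: power_mult_distrib K_nonneg)
    finally show "integrable lborel (\<lambda>y. complex_of_real (\<phi> (x - y)) * f y) \<and>
       ennreal ((cmod (conv \<phi> f x))\<^sup>2) \<le> ennreal K * ?J x"
      using i3 unfolding Jj by (simp add: ennreal_mult[symmetric] K_nonneg)
  qed
  then show "AE x in lebesgue. integrable lborel (\<lambda>y. complex_of_real (\<phi> (x - y)) * f y)"
    by (intro AE_completion) auto
  note [measurable] = conv_measurable[OF f]
  have "(\<integral>\<^sup>+x. ennreal ((cmod (conv \<phi> f x))\<^sup>2) \<partial>lebesgue) = (\<integral>\<^sup>+x. ennreal ((cmod (conv \<phi> f x))\<^sup>2) \<partial>lborel)"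
    by (rule nn_integral_completion)
  also have "\<dots> \<le> (\<integral>\<^sup>+x. ennreal K * ?J x \<partial>lborel)"
    using * by (intro nn_integral_mono_AE) auto
  also have "\<dots> = ennreal (K\<^sup>2 * nsq f)"
    by (subst nn_integral_cmult) (auto simp: J ennreal_mult[symmetric] K_nonneg power2_eq_square[of K] mult.assoc)
  finally have le: "(\<integral>\<^sup>+x. ennreal ((cmod (conv \<phi> f x))\<^sup>2) \<partial>lebesgue) \<le> ennreal (K\<^sup>2 * nsq f)" .
  show "L2 (conv \<phi> f)" "nsq (conv \<phi> f) \<le> K\<^sup>2 * nsq f"
    using L2I_nn_integral[OF borel_imp_lebesgue_measurable[OF conv_measurable[OF f]] le] by auto
qed

lemma conv_L2:
  assumes "L2 f"
  shows "L2 (conv \<phi> f)" and "nsq (conv \<phi> f) \<le> K\<^sup>2 * nsq f"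
proof -
  obtain f' where f': "f' \<in> borel_measurable borel" "AE x in lebesgue. f x = f' x" "L2 f'" "nsq f' = nsq f"
    by (rule L2_borel_representative[OF assms]) blast
  have "conv \<phi> f = conv \<phi> f'"
    by (intro ext conv_cong_AE f' L2_measurable assms)
  then show "L2 (conv \<phi> f)" "nsq (conv \<phi> f) \<le> K\<^sup>2 * nsq f"
    using conv_L2_borel[OF f'(1,3)] f'(4) by auto
qed

text \<open>Only almost everywhere, since at points where one of the integrals diverges its value is
  the default 0.\<close>

lemma conv_diff_AE:
  assumes "L2 f" "L2 g"
  shows "AE x in lebesgue. conv \<phi> (\<lambda>x. f x - g x) x = conv \<phi> f x - conv \<phi> g x"
proof -
  obtain f' where f': "f' \<in> borel_measurable borel" "AE x in lebesgue. f x = f' x" "L2 f'"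
    by (rule L2_borel_representative[OF assms(1)]) blast
  obtain g' where g': "g' \<in> borel_measurable borel" "AE x in lebesgue. g x = g' x" "L2 g'"
    by (rule L2_borel_representative[OF assms(2)]) blast
  note [measurable] = f'(1) g'(1)
  have "AE x in lebesgue. f x - g x = f' x - g' x"
    using f'(2) g'(2) by eventually_elim simp
  then have eq: "conv \<phi> (\<lambda>x. f x - g x) = conv \<phi> (\<lambda>x. f' x - g' x)" "conv \<phi> f = conv \<phi> f'" "conv \<phi> g = conv \<phi> g'"
    by (auto intro!: ext conv_cong_AE f' g' L2_measurable L2_diff assms)
  show ?thesis
    unfolding eq using conv_L2_borel(1)[OF f'(1,3)] conv_L2_borel(1)[OF g'(1,3)]
  proof eventually_elim
    case (elim x)
    then show ?case
      by (subst (1 2 3) conv_borel) (auto simp: algebra_simps)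
  qed
qed

abbreviation "\<phi>hat \<equiv> rhat \<phi>"

lemma kernel_hat_bound: "cmod (\<phi>hat \<xi>) \<le> K"
  using hat_bound[of "\<lambda>x. complex_of_real (\<phi> x)" \<xi>] kernel_integrable by (simp add: K_def)

lemma conv_core:
  assumes "core f"
  shows "core (conv \<phi> f)" "ft (conv \<phi> f) \<xi> = \<phi>hat \<xi> * ft f \<xi>"
proof -
  note f [measurable] = core_measurable[OF assms]
  have fi: "integrable lborel f" and fc: "continuous_on UNIV f" using assms by (auto simp: core_def)
  obtain B where B: "B > 0" "\<And>x. cmod (f x) \<le> B"
    by (rule core_bound[OF assms]) blast
  \<comment> \<open>Moves the shift onto the continuous factor, because the kernel may jump.\<close>
  have swap: "conv \<phi> f x = (\<integral>z. complex_of_real (\<phi> z) * f (x - z) \<partial>lborel)" for x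
    unfolding conv_borel[OF f]
    by (subst lborel_integral_affine[where c="-1" and t=x]) auto
  have bd: "cmod (complex_of_real (\<phi> z) * f (x - z)) \<le> B * \<bar>\<phi> z\<bar>" for x z
    using mult_left_mono[OF B(2)[of "x - z"], of "\<bar>\<phi> z\<bar>"] by (simp add: norm_mult mult.commute)
  have ik: "integrable lborel (\<lambda>z. B * \<bar>\<phi> z\<bar>)"
    using kernel_integrable by simp
  have cont: "continuous_on UNIV (conv \<phi> f)"
    unfolding continuous_on_sequentially
  proof (intro allI ballI impI, elim conjE)
    fix X :: "nat \<Rightarrow> 'a" and a assume X: "X \<longlonglongrightarrow> a"
    show "(conv \<phi> f \<circ> X) \<longlonglongrightarrow> conv \<phi> f a"
      unfolding comp_def swap
    proof (rule integral_dominated_convergence[OF _ _ ik])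
      show "AE z in lborel. (\<lambda>n. complex_of_real (\<phi> z) * f (X n - z)) \<longlonglongrightarrow> complex_of_real (\<phi> z) * f (a - z)"
        using fc by (intro AE_I2 tendsto_mult tendsto_const isCont_tendsto_compose[of _ f] tendsto_diff X)
           (auto simp: continuous_on_eq_continuous_at)
    qed (use bd in auto)
  qed
  have "cmod (conv \<phi> f x) \<le> B * K" for x
  proof -
    have "cmod (conv \<phi> f x) \<le> (\<integral>z. cmod (complex_of_real (\<phi> z) * f (x - z)) \<partial>lborel)"
      unfolding swap by (rule integral_norm_bound)
    also have "\<dots> \<le> (\<integral>z. B * \<bar>\<phi> z\<bar> \<partial>lborel)"
      using B by (intro integral_mono_AE' ik AE_I2 bd) auto
    finally show ?thesis by (simp add: K_def)
  qed
  then have bdd: "bounded (range (conv \<phi> f))"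
    by (auto simp: bounded_iff)
  let ?Q = "\<lambda>(y, x). complex_of_real (\<phi> (x - y)) * f y"
  have Q: "integrable (lborel \<Otimes>\<^sub>M lborel) ?Q"
  proof (rule lborel_pair.Fubini_integrable)
    have "(\<integral>x. norm (complex_of_real (\<phi> (x - y)) * f y) \<partial>lborel) = K * cmod (f y)" for y
      by (simp add: norm_mult kernel_translate(2))
    then show "integrable lborel (\<lambda>y. \<integral>x. norm (?Q (y, x)) \<partial>lborel)"
      using fi by simp
    show "AE y in lborel. integrable lborel (\<lambda>x. ?Q (y, x))"
      using kernel_translate(1) by simp
  qed simp
  have int: "integrable lborel (conv \<phi> f)"
    using lborel_pair.integrable_snd[OF Q] by (simp add: conv_borel[OF f, abs_def])
  show "core (conv \<phi> f)"
    unfolding core_def using cont bdd int by auto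
  have Q': "integrable (lborel \<Otimes>\<^sub>M lborel) (\<lambda>(y, x). of_real (\<phi> (x - y)) * f y * cis (- (\<xi> \<bullet> x)))"
    by (rule Bochner_Integration.integrable_bound[OF Q]) (auto simp: norm_mult)
  have "hat (conv \<phi> f) \<xi> = (\<integral>x. (\<integral>y. of_real (\<phi> (x - y)) * f y * cis (- (\<xi> \<bullet> x)) \<partial>lborel) \<partial>lborel)"
    unfolding hat_def conv_borel[OF f] by simp
  also have "\<dots> = (\<integral>y. (\<integral>x. of_real (\<phi> (x - y)) * f y * cis (- (\<xi> \<bullet> x)) \<partial>lborel) \<partial>lborel)"
    by (rule lborel_pair.Fubini_integral[OF Q'])
  also have "\<dots> = (\<integral>y. \<phi>hat \<xi> * (f y * cis (- (\<xi> \<bullet> y))) \<partial>lborel)"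
  proof (intro Bochner_Integration.integral_cong refl)
    fix y
    have cy: "cis (- (\<xi> \<bullet> (x + y))) = cis (- (\<xi> \<bullet> x)) * cis (- (\<xi> \<bullet> y))" for x
      by (simp add: cis_mult inner_add_right add.commute)
    have "(\<integral>x. of_real (\<phi> (x - y)) * f y * cis (- (\<xi> \<bullet> x)) \<partial>lborel) =
       (\<integral>x. (of_real (\<phi> x) * cis (- (\<xi> \<bullet> x))) * (f y * cis (- (\<xi> \<bullet> y))) \<partial>lborel)"
      by (subst lborel_integral_affine[where c=1 and t=y])
         (auto simp: cy ac_simps simp del: inner_add_right intro!: Bochner_Integration.integral_cong)
    then show "(\<integral>x. of_real (\<phi> (x - y)) * f y * cis (- (\<xi> \<bullet> x)) \<partial>lborel) = \<phi>hat \<xi> * (f y * cis (- (\<xi> \<bullet> y)))"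
      unfolding hat_def by simp
  qed
  also have "\<dots> = \<phi>hat \<xi> * hat f \<xi>"
    by (simp add: hat_def)
  finally show "ft (conv \<phi> f) \<xi> = \<phi>hat \<xi> * ft f \<xi>"
    by (simp add: ft_def)
qed

text \<open>Convolution and multiplication by the transform of the kernel are both bounded on L2 by
  the constant \<open>K\<close>, so their agreement on \<open>core\<close> passes to limits.\<close>

theorem fourier_pair_conv:
  assumes "fourier_pair f g"
  shows "fourier_pair (conv \<phi> f) (\<lambda>\<xi>. \<phi>hat \<xi> * g \<xi>)"
proof -
  obtain F where F: "\<And>n. core (F n)" "tends_L2 F f" "tends_L2 (\<lambda>n. ft (F n)) g"
    by (rule fourier_pairE[OF assms]) blast
  note L2 = fourier_pair_L2[OF assms]
  have hm: "\<phi>hat \<in> borel_measurable lebesgue"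
    by (rule borel_imp_lebesgue_measurable) simp
  have hat_mult: "L2 (\<lambda>\<xi>. \<phi>hat \<xi> * h \<xi>)" "nsq (\<lambda>\<xi>. \<phi>hat \<xi> * h \<xi>) \<le> K\<^sup>2 * nsq h" if "L2 h" for h
  proof -
    have m: "(\<lambda>\<xi>. \<phi>hat \<xi> * h \<xi>) \<in> borel_measurable lebesgue"
      using hm L2_measurable[OF that] by simp
    have "AE x in lebesgue. cmod (\<phi>hat x * h x) \<le> K * cmod (h x)"
      by (auto simp: norm_mult intro!: mult_right_mono kernel_hat_bound)
    then show "L2 (\<lambda>\<xi>. \<phi>hat \<xi> * h \<xi>)" "nsq (\<lambda>\<xi>. \<phi>hat \<xi> * h \<xi>) \<le> K\<^sup>2 * nsq h"
      using L2_bounded_by[OF that m] by auto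
  qed
  have z: "(\<lambda>n. K\<^sup>2 * u n) \<longlonglongrightarrow> 0" if "u \<longlonglongrightarrow> 0" for u :: "nat \<Rightarrow> real"
    using tendsto_mult[OF tendsto_const that, of "K\<^sup>2"] by simp
  have "tends_L2 (\<lambda>n. conv \<phi> (F n)) (conv \<phi> f)"
  proof (rule Lim_null_comparison[OF _ z[OF F(2)]], intro always_eventually allI)
    fix n
    have "nsq (\<lambda>x. conv \<phi> (F n) x - conv \<phi> f x) = nsq (conv \<phi> (\<lambda>x. F n x - f x))"
      by (rule nsq_cong_AE, rule eventually_mono[OF conv_diff_AE[OF core_L2[OF F(1)] L2(1)]]) (rule sym)
    also have "\<dots> \<le> K\<^sup>2 * nsq (\<lambda>x. F n x - f x)"
      by (intro conv_L2 L2_diff core_L2 F L2)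
    finally show "norm (nsq (\<lambda>x. conv \<phi> (F n) x - conv \<phi> f x)) \<le> K\<^sup>2 * nsq (\<lambda>x. F n x - f x)"
      by simp
  qed
  moreover have "(\<lambda>n. nsq (\<lambda>\<xi>. ft (conv \<phi> (F n)) \<xi> - \<phi>hat \<xi> * g \<xi>)) \<longlonglongrightarrow> 0"
  proof (rule Lim_null_comparison[OF _ z[OF F(3)]], intro always_eventually allI)
    fix n
    have "nsq (\<lambda>\<xi>. \<phi>hat \<xi> * (ft (F n) \<xi> - g \<xi>)) \<le> K\<^sup>2 * nsq (\<lambda>x. ft (F n) x - g x)"
      by (intro hat_mult L2_diff ft_core F L2)
    then show "norm (nsq (\<lambda>\<xi>. ft (conv \<phi> (F n)) \<xi> - \<phi>hat \<xi> * g \<xi>)) \<le> K\<^sup>2 * nsq (\<lambda>x. ft (F n) x - g x)"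
      by (simp add: conv_core(2)[OF F(1)] right_diff_distrib)
  qed
  ultimately show ?thesis
    unfolding fourier_pair_def using conv_core(1)[OF F(1)] conv_L2(1)[OF L2(1)] hat_mult(1)[OF L2(2)]
    by (intro conjI exI[of _ "\<lambda>n. conv \<phi> (F n)"]) auto
qed

end

section \<open>Test functions\<close>

text \<open>The classical smooth non-analytic function for n = 0, together with its quotients by
  powers: each derivative is a combination of two members, so the family is closed under
  differentiation.\<close>

definition flat :: "nat \<Rightarrow> real \<Rightarrow> real" where
  "flat n t = (if t > 0 then exp (- 1 / t) / t ^ n else 0)"

lemma flat_tendsto_0: "(flat n \<longlongrightarrow> 0) (at 0)"
proof -
  have "((\<lambda>t. (inverse t) ^ n / exp (inverse t)) \<longlongrightarrow> (0::real)) (at_right 0)"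
    by (rule filterlim_compose[OF tendsto_power_div_exp_0 filterlim_inverse_at_top_right])
  moreover have "\<forall>\<^sub>F t in at_right 0. (inverse t) ^ n / exp (inverse t) = flat n t"
    unfolding eventually_at_right_field
    by (intro exI[of _ 1]) (auto simp: flat_def exp_minus field_simps power_inverse)
  ultimately have right: "(flat n \<longlongrightarrow> 0) (at_right 0)"
    by (rule Lim_transform_eventually)
  have "\<forall>\<^sub>F t in at_left 0. 0 = flat n t"
    unfolding eventually_at_left_field by (intro exI[of _ "-1"]) (auto simp: flat_def)
  then have "(flat n \<longlongrightarrow> 0) (at_left 0)"
    by (rule Lim_transform_eventually[OF tendsto_const])
  with right show ?thesis
    by (simp add: filterlim_split_at)
qed

lemma flat_DERIV: "(flat n has_real_derivative (- real n * flat (Suc n) t + flat (Suc (Suc n)) t)) (at t)"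
proof -
  consider "t > 0" | "t < 0" | "t = 0" by linarith
  then show ?thesis
  proof cases
    case 1
    define E where "E = exp (- inverse t)"
    have fl: "flat k t = E * inverse t ^ k" for k
      using 1 by (simp add: flat_def E_def divide_inverse power_inverse)
    have "((\<lambda>t. exp (- inverse t)) has_real_derivative E * (inverse t)\<^sup>2) (at t)"
      using 1 unfolding E_def by (auto intro!: derivative_eq_intros simp: power2_eq_square)
    moreover have "((\<lambda>t. inverse t ^ n) has_real_derivative - (real n * inverse t ^ Suc n)) (at t)"
    proof -
      \<comment> \<open>The exponent \<open>n - Suc 0\<close> is truncated at \<open>n = 0\<close>,
        where the factor \<open>real n\<close> vanishes; hence the case split that follows.\<close>
      have "((\<lambda>t. inverse t ^ n) has_real_derivative real n * (- (inverse t * inverse t) * inverse t ^ (n - Suc 0))) (at t)"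
        using DERIV_power[OF DERIV_inverse[of t], of n] 1 by (simp add: power2_eq_square)
      then show ?thesis
        by (cases n) (simp_all add: mult.assoc)
    qed
    ultimately have "((\<lambda>t. exp (- inverse t) * inverse t ^ n) has_real_derivative
        E * (inverse t)\<^sup>2 * inverse t ^ n + (- (real n * inverse t ^ Suc n)) * exp (- inverse t)) (at t)"
      by (rule DERIV_mult)
    moreover have "E * (inverse t)\<^sup>2 * inverse t ^ n + (- (real n * inverse t ^ Suc n)) * exp (- inverse t) =
       - real n * flat (Suc n) t + flat (Suc (Suc n)) t"
      unfolding fl E_def[symmetric] by (simp add: power2_eq_square)
    ultimately have d: "((\<lambda>t. exp (- inverse t) * inverse t ^ n) has_real_derivative (- real n * flat (Suc n) t + flat (Suc (Suc n)) t)) (at t)"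
      by simp
    have e: "\<forall>\<^sub>F s in nhds t. exp (- inverse s) * inverse s ^ n = flat n s"
      using eventually_nhds_in_open[of "{0<..}" t] 1
      by (auto simp: flat_def divide_inverse power_inverse elim!: eventually_mono)
    show ?thesis
      by (rule DERIV_cong_ev[OF refl e refl, THEN iffD1, OF d])
  next
    case 2
    have e: "\<forall>\<^sub>F s in nhds t. 0 = flat n s"
      using eventually_nhds_in_open[of "{..<0}" t] 2 by (auto simp: flat_def elim!: eventually_mono)
    have d: "((\<lambda>t::real. 0::real) has_real_derivative (- real n * flat (Suc n) t + flat (Suc (Suc n)) t)) (at t)"
      using 2 by (simp add: flat_def)
    show ?thesis
      by (rule DERIV_cong_ev[OF refl e refl, THEN iffD1, OF d])
  next
    case 3
    \<comment> \<open>At the origin the difference quotient of \<open>flat n\<close> is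
      \<open>flat (Suc n)\<close> itself, whose limit is already known.\<close>
    have "(\<lambda>h. (flat n (0 + h) - flat n 0) / h) \<midarrow>0\<rightarrow> 0"
    proof (rule Lim_transform_eventually[OF flat_tendsto_0[of "Suc n"]])
      show "\<forall>\<^sub>F h in at 0. flat (Suc n) h = (flat n (0 + h) - flat n 0) / h"
        by (auto simp: flat_def eventually_at_filter)
    qed
    then show ?thesis
      using 3 by (simp add: DERIV_def flat_def)
  qed
qed

text \<open>A class closed under partial derivatives, so that one differentiability proof gives smoothness.\<close>

inductive smooth_gen :: "('a::euclidean_space \<Rightarrow> real) \<Rightarrow> bool" where
  const: "smooth_gen (\<lambda>x. c)"
| coord: "smooth_gen (\<lambda>x. x \<bullet> i)"
| add: "smooth_gen f \<Longrightarrow> smooth_gen g \<Longrightarrow> smooth_gen (\<lambda>x. f x + g x)"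
| mult: "smooth_gen f \<Longrightarrow> smooth_gen g \<Longrightarrow> smooth_gen (\<lambda>x. f x * g x)"
| flat: "smooth_gen f \<Longrightarrow> smooth_gen (\<lambda>x. flat n (f x))"

lemma partial_d_eq: "(f has_derivative f') (at x) \<Longrightarrow> partial_d i f x = f' i"
  unfolding partial_d_def using frechet_derivative_at by metis

lemma has_derivative_frechet: "f differentiable (at x) \<Longrightarrow> (f has_derivative frechet_derivative f (at x)) (at x)"
  by (simp add: frechet_derivative_works)

text \<open>Both claims go through one induction, since computing the partial derivative of a sum,
  product or composite uses differentiability of its parts.\<close>

lemma smooth_gen_partial:
  assumes "smooth_gen f"
  shows "(\<forall>x. f differentiable (at x)) \<and> smooth_gen (partial_d i f)"
  using assms
proof induction
  case (const c)
  have "partial_d i (\<lambda>x. c) = (\<lambda>x. 0)"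
    by (intro ext, subst partial_d_eq[OF has_derivative_const]) simp
  then show ?case by (auto intro: smooth_gen.const)
next
  case (coord j)
  have d: "((\<lambda>x. x \<bullet> j) has_derivative (\<lambda>h. h \<bullet> j)) (at x)" for x
    by (auto intro!: derivative_eq_intros)
  have "partial_d i (\<lambda>x. x \<bullet> j) = (\<lambda>x. i \<bullet> j)"
    by (intro ext partial_d_eq d)
  then show ?case using d by (auto intro: smooth_gen.const simp: differentiable_def)
next
  case (add f g)
  have "partial_d i (\<lambda>x. f x + g x) = (\<lambda>x. partial_d i f x + partial_d i g x)"
  proof
    fix x
    show "partial_d i (\<lambda>x. f x + g x) x = partial_d i f x + partial_d i g x"
      by (subst partial_d_eq[OF has_derivative_add[OF has_derivative_frechet[of f] has_derivative_frechet[of g]]])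
         (use add in \<open>auto simp: partial_d_def\<close>)
  qed
  then show ?case using add by (auto intro: smooth_gen.add)
next
  case (mult f g)
  have "partial_d i (\<lambda>x. f x * g x) = (\<lambda>x. f x * partial_d i g x + partial_d i f x * g x)"
  proof
    fix x
    show "partial_d i (\<lambda>x. f x * g x) x = f x * partial_d i g x + partial_d i f x * g x"
      by (subst partial_d_eq[OF has_derivative_mult[OF has_derivative_frechet[of f] has_derivative_frechet[of g]]])
         (use mult in \<open>auto simp: partial_d_def\<close>)
  qed
  then show ?case using mult by (auto intro: smooth_gen.add smooth_gen.mult)
next
  case (flat f n)
  have d: "((\<lambda>x. flat n (f x)) has_derivative
     (\<lambda>h. frechet_derivative f (at x) h * (- real n * flat (Suc n) (f x) + flat (Suc (Suc n)) (f x)))) (at x)" for x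
    by (rule has_derivative_compose[OF has_derivative_frechet[of f] flat_DERIV[unfolded has_field_derivative_def], THEN has_derivative_eq_rhs])
       (use flat in \<open>auto simp: fun_eq_iff\<close>)
  have "partial_d i (\<lambda>x. flat n (f x)) =
     (\<lambda>x. partial_d i f x * ((- real n) * flat (Suc n) (f x) + flat (Suc (Suc n)) (f x)))"
    by (intro ext, subst partial_d_eq[OF d]) (simp add: partial_d_def)
  moreover have "smooth_gen (\<lambda>x. partial_d i f x * ((- real n) * flat (Suc n) (f x) + flat (Suc (Suc n)) (f x)))"
    using flat by (intro smooth_gen.mult smooth_gen.add smooth_gen.const smooth_gen.flat) auto
  ultimately show ?case
    using d by (auto simp: differentiable_def)
qed

lemma smooth_gen_smooth_fun:
  assumes "smooth_gen f"
  shows "smooth_fun f"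
proof -
  have "smooth_gen (iter_pd is f)" for "is"
    by (induction "is") (use assms smooth_gen_partial in auto)
  then show ?thesis
    unfolding smooth_fun_def using smooth_gen_partial by blast
qed

lemma smooth_gen_sum:
  "finite A \<Longrightarrow> (\<And>a. a \<in> A \<Longrightarrow> smooth_gen (f a)) \<Longrightarrow> smooth_gen (\<lambda>x. \<Sum>a\<in>A. f a x)"
  by (induction A rule: finite_induct) (auto intro: smooth_gen.const smooth_gen.add)

text \<open>For positive \<open>k\<close> it vanishes outside the ball of radius
  \<open>1 / k\<close>. Shrinking the support pushes the zeros of the transform outwards, which is
  what the parameter is for.\<close>

definition bump :: "nat \<Rightarrow> 'a::euclidean_space \<Rightarrow> real" where
  "bump k y = flat 0 (1 - (real k * norm y)\<^sup>2)"

text \<open>Stated for reflected translates: paired with these, a weak identity reads as an equality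
  of convolutions at \<open>x\<close>.\<close>

lemma bump_test_fun:
  assumes "k > 0"
  shows "test_fun (\<lambda>y. bump k (x - y))"
proof -
  \<comment> \<open>The squared norm is spelled out as a polynomial in the coordinates, with
    subtraction as multiplication by -1, to match the rules of \<open>smooth_gen\<close>.\<close>
  have eq: "(\<lambda>y. bump k (x - y)) = (\<lambda>y. flat 0 (1 + (- ((real k)\<^sup>2)) * (\<Sum>b\<in>Basis. (x \<bullet> b + (-1) * (y \<bullet> b)) * (x \<bullet> b + (-1) * (y \<bullet> b)))))"
    unfolding bump_def power_mult_distrib power2_norm_eq_inner
    by (subst euclidean_inner) (simp add: inner_diff_left)
  have "smooth_fun (\<lambda>y. bump k (x - y))"
    unfolding eq by (intro smooth_gen_smooth_fun smooth_gen.flat smooth_gen.add smooth_gen.mult smooth_gen.const smooth_gen_sum smooth_gen.coord) auto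
  moreover have "{y. bump k (x - y) \<noteq> 0} \<subseteq> cball x 1"
  proof
    fix y assume "y \<in> {y. bump k (x - y) \<noteq> 0}"
    then have "(real k * norm (x - y))\<^sup>2 < 1"
      by (auto simp: bump_def flat_def split: if_splits)
    then have "real k * norm (x - y) < 1"
      by (simp add: power_less_one_iff abs_square_less_1)
    moreover have "norm (x - y) \<le> real k * norm (x - y)"
      using assms mult_right_mono[of 1 "real k" "norm (x - y)"] by simp
    ultimately show "y \<in> cball x 1" by (simp add: dist_norm)
  qed
  ultimately show ?thesis
    unfolding test_fun_def using bounded_subset[OF bounded_cball] by blast
qed

lemma bump_test_fun_0: "k > 0 \<Longrightarrow> test_fun (bump k)"
  using bump_test_fun[of k 0] by (simp add: bump_def[abs_def])

section \<open>Derivatives of test functions and their transforms\<close>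

lemma iter_pd_snoc: "iter_pd is (partial_d i f) = iter_pd (is @ [i]) f"
  by (induction "is") auto

lemma test_fun_differentiable: "test_fun w \<Longrightarrow> w differentiable (at x)"
  unfolding test_fun_def smooth_fun_def by (metis empty_subsetI iter_pd.simps(1) list.set(1))

lemma partial_d_zero_outside:
  fixes w :: "'a::euclidean_space \<Rightarrow> real"
  assumes "\<And>x. norm x > R \<Longrightarrow> w x = 0" "norm x > R"
  shows "partial_d i w x = 0"
proof -
  have "open {x::'a. norm x > R}"
    by (intro open_Collect_less continuous_intros)
  then have "(w has_derivative (\<lambda>h. 0)) (at x)"
    by (rule has_derivative_transform_within_open[OF has_derivative_const[of 0]]) (use assms in auto)
  then show ?thesis by (simp add: partial_d_eq)
qed

lemma test_fun_support:
  assumes "test_fun w"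
  obtains R where "R > 0" "\<And>x. norm x > R \<Longrightarrow> w x = 0"
proof -
  from assms obtain R where "R > 0" "\<forall>x\<in>{x. w x \<noteq> 0}. norm x \<le> R"
    unfolding test_fun_def bounded_pos by blast
  then show thesis by (intro that[of R]) force+
qed

lemma test_fun_partial:
  assumes "test_fun w" "i \<in> Basis"
  shows "test_fun (partial_d i w)"
proof -
  obtain R where R: "R > 0" "\<And>x. norm x > R \<Longrightarrow> w x = 0"
    by (rule test_fun_support[OF assms(1)]) blast
  have "norm x \<le> R" if "partial_d i w x \<noteq> 0" for x
    using partial_d_zero_outside[where R=R and w=w and x=x and i=i] R(2) that by (meson not_le)
  then have "bounded {x. partial_d i w x \<noteq> 0}"
    by (auto simp: bounded_iff)
  moreover have "smooth_fun (partial_d i w)"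
    unfolding smooth_fun_def iter_pd_snoc
    using assms unfolding test_fun_def smooth_fun_def by auto
  ultimately show ?thesis by (simp add: test_fun_def)
qed

lemma test_fun_iter_pd: "test_fun w \<Longrightarrow> set is \<subseteq> Basis \<Longrightarrow> test_fun (iter_pd is w)"
  by (induction "is") (auto intro: test_fun_partial)

lemma test_fun_continuous:
  assumes "test_fun w"
  shows "continuous_on UNIV w"
  using test_fun_differentiable[OF assms]
  by (auto intro!: differentiable_imp_continuous_on simp: differentiable_on_def)

lemma test_fun_bound:
  fixes w :: "'a::euclidean_space \<Rightarrow> real"
  assumes "test_fun w"
  obtains B R where "B > 0" "R > 0" "\<And>x. \<bar>w x\<bar> \<le> B" "\<And>x. norm x > R \<Longrightarrow> w x = 0"
proof -
  obtain R where R: "R > 0" "\<And>x. norm x > R \<Longrightarrow> w x = 0"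
    by (rule test_fun_support[OF assms(1)]) blast
  have "compact (w ` cball 0 R)"
    by (intro compact_continuous_image continuous_on_subset[OF test_fun_continuous[OF assms]]) auto
  then have "bounded (w ` cball 0 R)"
    by (rule compact_imp_bounded)
  then obtain B where "B > 0" "\<forall>y\<in>w ` cball 0 R. norm y \<le> B"
    unfolding bounded_pos by blast
  then have B: "B > 0" "\<And>x. x \<in> cball 0 R \<Longrightarrow> \<bar>w x\<bar> \<le> B"
    by auto
  have "\<bar>w x\<bar> \<le> B" for x
    using B R(2)[of x] by (cases "norm x > R") auto
  then show thesis using that B(1) R by blast
qed

lemma integrable_indicator_cball: "integrable lborel (\<lambda>x::'a::euclidean_space. c * indicator (cball 0 r) x :: real)"
  by (intro integrable_mult_right integrable_real_indicator) (use emeasure_bounded_finite[OF bounded_cball[of 0 r]] in auto)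

lemma test_fun_core:
  fixes w :: "'a::euclidean_space \<Rightarrow> real"
  assumes "test_fun w"
  shows "core (\<lambda>x. of_real (w x))"
proof -
  obtain B R where B: "B > 0" "R > 0" "\<And>x. \<bar>w x\<bar> \<le> B" "\<And>x. norm x > R \<Longrightarrow> w x = 0"
    by (rule test_fun_bound[OF assms]) blast
  have c: "continuous_on UNIV (\<lambda>x. complex_of_real (w x))"
    by (intro continuous_intros test_fun_continuous assms)
  have "integrable lborel (\<lambda>x. complex_of_real (w x))"
  proof (rule Bochner_Integration.integrable_bound[OF integrable_indicator_cball[of B R]])
    show "AE x in lborel. norm (complex_of_real (w x)) \<le> norm (B * indicator (cball 0 R) x)"
      using B by (auto split: split_indicator simp: not_le)
    show "(\<lambda>x. complex_of_real (w x)) \<in> borel_measurable lborel"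
      using borel_measurable_continuous_onI[OF c] by simp
  qed
  with c B(3) show ?thesis
    unfolding core_def bounded_iff by auto
qed

text \<open>The mean value theorem along the direction \<open>i\<close>; it dominates the difference
  quotients when the limit is taken under the integral.\<close>

lemma difference_quotient_bound:
  fixes w :: "'a::euclidean_space \<Rightarrow> real"
  assumes "test_fun w" "\<And>x. \<bar>partial_d i w x\<bar> \<le> B" "h > 0"
  shows "\<bar>w (x + h *\<^sub>R i) - w x\<bar> \<le> h * B"
proof -
  have d: "((\<lambda>t. w (x + t *\<^sub>R i)) has_real_derivative partial_d i w (x + t *\<^sub>R i)) (at t)" for t
  proof -
    have "((\<lambda>t. x + t *\<^sub>R i) has_derivative (\<lambda>s. s *\<^sub>R i)) (at t)"
      by (auto intro!: derivative_eq_intros)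
    from has_derivative_compose[OF this has_derivative_frechet[OF test_fun_differentiable[OF assms(1)]]]
    have *: "((\<lambda>t. w (x + t *\<^sub>R i)) has_derivative (\<lambda>s. frechet_derivative w (at (x + t *\<^sub>R i)) (s *\<^sub>R i))) (at t)" .
    have "linear (frechet_derivative w (at (x + t *\<^sub>R i)))"
      by (intro linear_frechet_derivative test_fun_differentiable assms)
    then have "(\<lambda>s. frechet_derivative w (at (x + t *\<^sub>R i)) (s *\<^sub>R i)) = (*) (partial_d i w (x + t *\<^sub>R i))"
      by (simp add: linear_cmul partial_d_def fun_eq_iff)
    with * show ?thesis
      unfolding has_field_derivative_def by simp
  qed
  obtain z where "w (x + h *\<^sub>R i) - w (x + 0 *\<^sub>R i) = (h - 0) * partial_d i w (x + z *\<^sub>R i)"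
    using MVT2[OF assms(3), of "\<lambda>t. w (x + t *\<^sub>R i)" "\<lambda>t. partial_d i w (x + t *\<^sub>R i)"] d by blast
  then show ?thesis
    using assms(2)[of "x + z *\<^sub>R i"] assms(3) by (simp add: abs_mult mult_left_mono)
qed

lemma difference_quotient_tendsto:
  fixes w :: "'a::euclidean_space \<Rightarrow> real"
  assumes "test_fun w" "H \<longlonglongrightarrow> 0" "\<And>n. H n > 0"
  shows "(\<lambda>n. (w (x + H n *\<^sub>R i) - w x) / H n) \<longlonglongrightarrow> partial_d i w x"
proof -
  have "((\<lambda>t. x + t *\<^sub>R i) has_derivative (\<lambda>s. s *\<^sub>R i)) (at 0)"
    by (auto intro!: derivative_eq_intros)
  moreover have "(w has_derivative frechet_derivative w (at x)) (at (x + 0 *\<^sub>R i))"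
    using has_derivative_frechet[OF test_fun_differentiable[OF assms(1)]] by simp
  ultimately have *: "((\<lambda>t. w (x + t *\<^sub>R i)) has_derivative (\<lambda>s. frechet_derivative w (at x) (s *\<^sub>R i))) (at 0)"
    by (rule has_derivative_compose)
  have "linear (frechet_derivative w (at x))"
    by (intro linear_frechet_derivative test_fun_differentiable assms)
  then have "(\<lambda>s. frechet_derivative w (at x) (s *\<^sub>R i)) = (*) (partial_d i w x)"
    by (simp add: linear_cmul partial_d_def fun_eq_iff)
  with * have "((\<lambda>t. w (x + t *\<^sub>R i)) has_real_derivative partial_d i w x) (at 0)"
    unfolding has_field_derivative_def by simp
  then have lim: "(\<lambda>h. (w (x + h *\<^sub>R i) - w x) / h) \<midarrow>0\<rightarrow> partial_d i w x"
    by (simp add: DERIV_def)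
  have "H n \<noteq> 0" for n
    using assms(3)[of n] by simp
  then have "filterlim H (at 0) sequentially"
    unfolding filterlim_at using assms(2) by auto
  from filterlim_compose[OF lim this] show ?thesis .
qed

lemma cis_quotient_tendsto:
  assumes "H \<longlonglongrightarrow> 0" "\<And>n. H n > (0::real)"
  shows "(\<lambda>n. (cis (H n * a) - 1) / of_real (H n)) \<longlonglongrightarrow> \<i> * of_real a"
proof -
  have "((\<lambda>z. exp (z * (\<i> * complex_of_real a))) has_field_derivative \<i> * complex_of_real a) (at 0)"
    by (auto intro!: derivative_eq_intros)
  then have lim: "(\<lambda>h. (exp (h * (\<i> * complex_of_real a)) - 1) / h) \<midarrow>0\<rightarrow> \<i> * complex_of_real a"
    by (simp add: DERIV_def)
  have "H n \<noteq> 0" for n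
    using assms(2)[of n] by simp
  then have "filterlim (\<lambda>n. complex_of_real (H n)) (at 0) sequentially"
    unfolding filterlim_at using tendsto_of_real[OF assms(1), where 'a=complex] by auto
  from filterlim_compose[OF lim this]
  show ?thesis
    by (simp add: cis_conv_exp mult.assoc mult.left_commute)
qed

text \<open>A limit of difference quotients takes the place of integration by parts: a shift by
  \<open>H n\<close> multiplies the transform by a phase, and the quotient of that phase converges
  to the symbol. As \<open>H n \<le> 1\<close>, all quotients vanish outside the ball of radius
  \<open>R + 1\<close>, which gives the integrable bound.\<close>

lemma hat_partial_d:
  fixes w :: "'a::euclidean_space \<Rightarrow> real"
  assumes w: "test_fun w" and i: "i \<in> Basis"
  shows "rhat (partial_d i w) \<xi> = \<i> * of_real (\<xi> \<bullet> i) * rhat w \<xi>"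
proof -
  obtain B R' where B: "B > 0" "R' > 0" "\<And>x. \<bar>partial_d i w x\<bar> \<le> B" "\<And>x. norm x > R' \<Longrightarrow> partial_d i w x = 0"
    by (rule test_fun_bound[OF test_fun_partial[OF w i]], rule that)
  obtain R where R: "R > 0" "\<And>x. norm x > R \<Longrightarrow> w x = 0"
    by (rule test_fun_support[OF w], rule that)
  define H where "H n = 1 / real (Suc n)" for n
  have H0: "H n > 0" "H n \<le> 1" for n by (auto simp: H_def)
  have H: "H \<longlonglongrightarrow> 0"
    unfolding H_def by (rule lim_1_over_n[THEN LIMSEQ_Suc])
  have [measurable]: "w \<in> borel_measurable borel" "partial_d i w \<in> borel_measurable borel"
    by (auto intro!: borel_measurable_continuous_onI test_fun_continuous test_fun_partial w i)
  have wi: "integrable lborel (\<lambda>x. complex_of_real (w x))"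
    using test_fun_core[OF w] by (simp add: core_def)
  have wi': "integrable lborel (\<lambda>x. complex_of_real (w (x + h *\<^sub>R i)))" for h
    using lborel_integrable_affine[of 1 "\<lambda>x. complex_of_real (w x)" "h *\<^sub>R i"] wi by (simp add: add.commute)
  let ?D = "\<lambda>n x. complex_of_real ((w (x + H n *\<^sub>R i) - w x) / H n)"
  have "(\<lambda>n. hat (?D n) \<xi>) \<longlonglongrightarrow> rhat (partial_d i w) \<xi>"
    unfolding hat_def
  proof (rule integral_dominated_convergence[OF _ _ integrable_indicator_cball[of B "R + 1"]])
    show "AE x in lborel. (\<lambda>n. ?D n x * cis (- (\<xi> \<bullet> x))) \<longlonglongrightarrow> of_real (partial_d i w x) * cis (- (\<xi> \<bullet> x))"
      by (intro AE_I2 tendsto_mult tendsto_const tendsto_of_real difference_quotient_tendsto w H H0)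
    show "AE x in lborel. norm (?D n x * cis (- (\<xi> \<bullet> x))) \<le> B * indicator (cball 0 (R + 1)) x" for n
    proof (intro AE_I2)
      fix x
      have le: "\<bar>w (x + H n *\<^sub>R i) - w x\<bar> \<le> H n * B"
        by (rule difference_quotient_bound[OF w B(3) H0(1)])
      show "norm (?D n x * cis (- (\<xi> \<bullet> x))) \<le> B * indicator (cball 0 (R + 1)) x"
      proof (cases "norm x \<le> R + 1")
        case True
        then show ?thesis
          using le H0(1)[of n] by (simp add: norm_mult norm_divide field_simps del: of_real_divide of_real_diff)
      next
        case False
        have "norm x \<le> norm (x + H n *\<^sub>R i) + norm (H n *\<^sub>R i)"
          using norm_triangle_ineq4[of "x + H n *\<^sub>R i" "H n *\<^sub>R i"] by simp
        also have "norm (H n *\<^sub>R i) \<le> 1"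
          using H0[of n] i by simp
        finally have "norm (x + H n *\<^sub>R i) > R" "norm x > R"
          using False by auto
        then show ?thesis using R B by simp
      qed
    qed
  qed measurable
  moreover have "hat (?D n) \<xi> = (cis (H n * (\<xi> \<bullet> i)) - 1) / of_real (H n) * rhat w \<xi>" for n
  proof -
    have "hat (\<lambda>x. of_real (w (x + H n *\<^sub>R i))) \<xi> = cis (H n * (\<xi> \<bullet> i)) * rhat w \<xi>"
    proof -
      have "rhat w \<xi> = (\<integral>x. of_real (w (x + H n *\<^sub>R i)) * cis (- (\<xi> \<bullet> (x + H n *\<^sub>R i))) \<partial>lborel)"
        unfolding hat_def by (subst lborel_integral_affine[where c=1 and t="H n *\<^sub>R i"]) (auto simp: add.commute)
      then have "cis (H n * (\<xi> \<bullet> i)) * rhat w \<xi> =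
         (\<integral>x. cis (H n * (\<xi> \<bullet> i)) * (of_real (w (x + H n *\<^sub>R i)) * cis (- (\<xi> \<bullet> (x + H n *\<^sub>R i)))) \<partial>lborel)"
        by simp
      also have "\<dots> = hat (\<lambda>x. of_real (w (x + H n *\<^sub>R i))) \<xi>"
        unfolding hat_def by (intro Bochner_Integration.integral_cong refl) (simp add: inner_add_right cis_mult mult.left_commute)
      finally show ?thesis by simp
    qed
    moreover have "hat (?D n) \<xi> = (1 / of_real (H n)) * hat (\<lambda>x. of_real (w (x + H n *\<^sub>R i)) - of_real (w x)) \<xi>"
      unfolding hat_cmult[symmetric] by (simp add: hat_def)
    ultimately show ?thesis
      by (simp add: hat_diff[OF wi' wi] algebra_simps diff_divide_distrib)
  qed
  moreover have "(\<lambda>n. (cis (H n * (\<xi> \<bullet> i)) - 1) / of_real (H n) * rhat w \<xi>)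
      \<longlonglongrightarrow> \<i> * of_real (\<xi> \<bullet> i) * rhat w \<xi>"
    by (intro tendsto_mult tendsto_const cis_quotient_tendsto H H0)
  ultimately show ?thesis
    by (simp add: LIMSEQ_unique)
qed

definition dsymbol :: "'a::euclidean_space list \<Rightarrow> 'a \<Rightarrow> complex" where
  "dsymbol is \<xi> = prod_list (map (\<lambda>i. \<i> * of_real (\<xi> \<bullet> i)) is)"

lemma hat_iter_pd:
  fixes w :: "'a::euclidean_space \<Rightarrow> real"
  assumes "test_fun w" "set is \<subseteq> Basis"
  shows "rhat (iter_pd is w) \<xi> = dsymbol is \<xi> * rhat w \<xi>"
  using assms(2)
proof (induction "is")
  case (Cons i "is")
  then show ?case
    using hat_partial_d[OF test_fun_iter_pd[OF assms(1)], of "is" i \<xi>] by (simp add: dsymbol_def)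
qed (simp add: dsymbol_def)

lemma hat_laplace_fun:
  fixes w :: "'a::euclidean_space \<Rightarrow> real"
  assumes "test_fun w"
  shows "core (\<lambda>x. of_real (laplace_fun w x))"
    and "rhat (laplace_fun w) \<xi> = - of_real ((norm \<xi>)\<^sup>2) * rhat w \<xi>"
proof -
  have *: "core (\<lambda>x. of_real (\<Sum>i\<in>A. iter_pd [i, i] w x)) \<and>
    hat (\<lambda>x. of_real (\<Sum>i\<in>A. iter_pd [i, i] w x)) \<xi> =
      - of_real (\<Sum>i\<in>A. (\<xi> \<bullet> i)\<^sup>2) * rhat w \<xi>" if "A \<subseteq> Basis" for A
    using finite_subset[OF that finite_Basis] that
  proof (induction A rule: finite_induct)
    case empty
    show ?case by (auto simp: core_def hat_def)
  next
    case (insert i A)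
    have c: "core (\<lambda>x. of_real (iter_pd [i, i] w x))"
      using insert.prems by (intro test_fun_core test_fun_iter_pd assms) auto
    have h: "hat (\<lambda>x. of_real (iter_pd [i, i] w x)) \<xi> = - of_real ((\<xi> \<bullet> i)\<^sup>2) * rhat w \<xi>"
      using insert.prems by (subst hat_iter_pd[OF assms]) (auto simp: dsymbol_def power2_eq_square algebra_simps)
    have IH: "core (\<lambda>x. of_real (\<Sum>i\<in>A. iter_pd [i, i] w x))"
      "hat (\<lambda>x. of_real (\<Sum>i\<in>A. iter_pd [i, i] w x)) \<xi> = - of_real (\<Sum>i\<in>A. (\<xi> \<bullet> i)\<^sup>2) * rhat w \<xi>"
      using insert by auto
    have eq: "(\<lambda>x. complex_of_real (\<Sum>i\<in>insert i A. iter_pd [i, i] w x)) =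
       (\<lambda>x. complex_of_real (iter_pd [i, i] w x) + complex_of_real (\<Sum>i\<in>A. iter_pd [i, i] w x))"
      using insert.hyps by (auto simp: fun_eq_iff)
    have "hat (\<lambda>x. of_real (iter_pd [i, i] w x) + of_real (\<Sum>i\<in>A. iter_pd [i, i] w x)) \<xi> =
      - of_real ((\<xi> \<bullet> i)\<^sup>2) * rhat w \<xi> + - of_real (\<Sum>i\<in>A. (\<xi> \<bullet> i)\<^sup>2) * rhat w \<xi>"
      using c IH(1) unfolding core_def h[symmetric] IH(2)[symmetric] by (intro hat_add) auto
    also have "\<dots> = - of_real (\<Sum>i\<in>insert i A. (\<xi> \<bullet> i)\<^sup>2) * rhat w \<xi>"
      using insert.hyps by (simp add: ring_distribs)
    finally show ?case
      unfolding eq using core_lin[OF c IH(1), of 1 1] by simp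
  qed
  have n: "(\<Sum>i\<in>Basis. (\<xi> \<bullet> i)\<^sup>2) = (norm \<xi>)\<^sup>2"
    unfolding power2_norm_eq_inner by (subst euclidean_inner[of \<xi> \<xi>]) (simp add: power2_eq_square)
  show "core (\<lambda>x. of_real (laplace_fun w x))"
    and "rhat (laplace_fun w) \<xi> = - of_real ((norm \<xi>)\<^sup>2) * rhat w \<xi>"
    using *[OF order_refl] unfolding laplace_fun_def n by auto
qed

lemma partial_d_reflect:
  fixes f :: "'a::euclidean_space \<Rightarrow> real"
  assumes "f differentiable (at (x - y))"
  shows "partial_d i (\<lambda>y. f (x - y)) y = - partial_d i f (x - y)"
proof -
  have "((\<lambda>y. x - y) has_derivative (\<lambda>h. - h)) (at y)"
    by (auto intro!: derivative_eq_intros)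
  from has_derivative_compose[OF this has_derivative_frechet[OF assms]]
  have "partial_d i (\<lambda>y. f (x - y)) y = frechet_derivative f (at (x - y)) (- i)"
    by (rule partial_d_eq)
  also have "\<dots> = - partial_d i f (x - y)"
    using linear_neg[OF linear_frechet_derivative[OF assms]] by (simp add: partial_d_def)
  finally show ?thesis .
qed

text \<open>Each derivative of the reflected function brings a sign -1; in second order the signs
  cancel.\<close>

lemma laplace_fun_reflect:
  fixes w :: "'a::euclidean_space \<Rightarrow> real"
  assumes "test_fun w"
  shows "laplace_fun (\<lambda>y. w (x - y)) y = laplace_fun w (x - y)"
  unfolding laplace_fun_def
proof (intro sum.cong refl)
  fix i :: 'a assume i: "i \<in> Basis"
  have "partial_d i (\<lambda>y. w (x - y)) = (\<lambda>y. (\<lambda>z. - partial_d i w z) (x - y))"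
    by (intro ext partial_d_reflect test_fun_differentiable assms)
  moreover have d: "partial_d i w differentiable (at z)" for z
    by (intro test_fun_differentiable test_fun_partial assms i)
  moreover have "partial_d i (\<lambda>z. - partial_d i w z) z = - partial_d i (partial_d i w) z" for z
    by (subst partial_d_eq[OF has_derivative_minus[OF has_derivative_frechet[OF d]]]) (simp add: partial_d_def[of i "partial_d i w"])
  moreover have "(\<lambda>z. - partial_d i w z) differentiable (at z)" for z
    by (intro differentiable_minus d)
  ultimately show "iter_pd [i, i] (\<lambda>y. w (x - y)) y = iter_pd [i, i] w (x - y)"
    by (simp add: partial_d_reflect[of "\<lambda>z. - partial_d i w z"])
qed

text \<open>On the support the phase has modulus below 1, hence below pi/2, so the cosine in the
  real part is positive there; an integral that is nonnegative throughout and positive on a ball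
  cannot vanish.\<close>

lemma hat_bump_nonzero:
  fixes \<xi> :: "'a::euclidean_space"
  assumes k: "k > 0" and \<xi>: "norm \<xi> \<le> real k"
  shows "rhat (bump k) \<xi> \<noteq> 0"
proof
  assume zero: "rhat (bump k) \<xi> = 0"
  have c: "core (\<lambda>x::'a. of_real (bump k x))"
    by (intro test_fun_core bump_test_fun_0 k)
  then have i: "integrable lborel (\<lambda>x. of_real (bump k x) * cis (- (\<xi> \<bullet> x)))"
    by (intro integrable_cis_mult) (auto simp: core_def)
  have "(\<integral>x. bump k x * cos (\<xi> \<bullet> x) \<partial>lborel) = Re (rhat (bump k) \<xi>)"
    unfolding hat_def by (subst integral_Re[OF i, symmetric]) simp
  then have 0: "(\<integral>x. bump k x * cos (\<xi> \<bullet> x) \<partial>lborel) = 0" using zero by simp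
  have ir: "integrable lborel (\<lambda>x. bump k x * cos (\<xi> \<bullet> x))"
    using integrable_Re[OF i] by simp
  have pos: "cos (\<xi> \<bullet> x) > 0 \<and> bump k x > 0" if "real k * norm x < 1" for x
  proof
    have "\<bar>\<xi> \<bullet> x\<bar> \<le> norm \<xi> * norm x"
      by (rule Cauchy_Schwarz_ineq2)
    also have "\<dots> \<le> real k * norm x"
      using \<xi> by (intro mult_right_mono) auto
    also have "\<dots> < pi / 2" using that pi_gt3 by simp
    finally show "cos (\<xi> \<bullet> x) > 0"
      by (intro cos_gt_zero_pi) auto
    have "(real k * norm x)\<^sup>2 < 1"
      using that by (simp add: abs_square_less_1)
    then show "bump k x > 0" by (simp add: bump_def flat_def)
  qed
  have nn: "bump k x * cos (\<xi> \<bullet> x) \<ge> 0" for x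
  proof (cases "real k * norm x < 1")
    case True
    then show ?thesis using pos[of x] by (simp add: less_imp_le)
  next
    case False
    then have "(real k * norm x)\<^sup>2 \<ge> 1"
      by (simp add: not_less)
    then show ?thesis by (simp add: bump_def flat_def)
  qed
  have "AE x in lborel. bump k x * cos (\<xi> \<bullet> x) = 0"
    using integral_nonneg_eq_0_iff_AE[OF ir] nn 0 by simp
  then have "AE x in lborel. x \<notin> ball (0::'a) (1 / real k)"
  proof eventually_elim
    case (elim x)
    then show ?case
      using pos[of x] k by (auto simp: field_simps)
  qed
  then have "ball (0::'a) (1 / real k) \<in> null_sets lborel"
    by (subst AE_iff_null_sets) auto
  then have "measure lborel (ball (0::'a) (1 / real k)) = 0"
    by (simp add: measure_eq_0_null_sets)
  moreover have "measure lborel (ball (0::'a) (1 / real k)) > 0"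
    using k by (intro content_ball_pos) auto
  ultimately show False by simp
qed

section \<open>The spectrum as a Fourier multiplier\<close>

lemma hat_tendsto:
  fixes f :: "'a::euclidean_space \<Rightarrow> complex"
  assumes f: "integrable lborel f" and X: "X \<longlonglongrightarrow> \<xi>"
  shows "(\<lambda>n. hat f (X n)) \<longlonglongrightarrow> hat f \<xi>"
  unfolding hat_def
proof (rule integral_dominated_convergence[where w="\<lambda>x. cmod (f x)"])
  note [measurable] = borel_measurable_integrable[OF f]
  show "(\<lambda>x. f x * cis (- (\<xi> \<bullet> x))) \<in> borel_measurable lborel"
    "(\<lambda>x. f x * cis (- (X n \<bullet> x))) \<in> borel_measurable lborel" for n by measurable
  show "AE x in lborel. (\<lambda>n. f x * cis (- (X n \<bullet> x))) \<longlonglongrightarrow> f x * cis (- (\<xi> \<bullet> x))"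
    using continuous_on_cis[OF continuous_on_id, of UNIV]
    by (intro AE_I2 tendsto_mult tendsto_const isCont_tendsto_compose[of _ cis] tendsto_minus tendsto_inner X)
       (auto simp: continuous_on_eq_continuous_at)
qed (use f in \<open>auto simp: norm_mult\<close>)

lemma hat_isCont:
  fixes f :: "'a::euclidean_space \<Rightarrow> complex"
  assumes "integrable lborel f"
  shows "isCont (hat f) \<xi>"
  unfolding continuous_at_sequentially comp_def using hat_tendsto[OF assms] by blast

section \<open>Weak derivatives on the Fourier side\<close>

lemma dsymbol_measurable: "dsymbol is \<in> borel_measurable borel"
proof (induction "is")
  case Nil
  then show ?case by (simp add: dsymbol_def[abs_def])
next
  case (Cons i "is")
  have "dsymbol (i # is) = (\<lambda>\<xi>. \<i> * of_real (\<xi> \<bullet> i) * dsymbol is \<xi>)"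
    by (simp add: dsymbol_def fun_eq_iff)
  with Cons show ?case by simp
qed

text \<open>The reason why a single weight controls all derivatives demanded by
  \<open>H2\<close>.\<close>

lemma dsymbol_bound:
  fixes \<xi> :: "'a::euclidean_space"
  assumes "set is \<subseteq> Basis" "length is \<le> 2"
  shows "cmod (dsymbol is \<xi>) \<le> 1 + (norm \<xi>)\<^sup>2"
proof -
  have 1: "cmod (\<i> * complex_of_real (\<xi> \<bullet> i)) \<le> norm \<xi>" if "i \<in> Basis" for i
    using Basis_le_norm[OF that, of \<xi>] by (simp add: norm_mult)
  have 2: "norm \<xi> \<le> 1 + (norm \<xi>)\<^sup>2"
  proof -
    have "0 \<le> (norm \<xi> - 1)\<^sup>2" by simp
    then have "norm \<xi> * 2 \<le> 1 + (norm \<xi>)\<^sup>2" by (simp add: power2_eq_square algebra_simps)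
    then show ?thesis using norm_ge_zero[of \<xi>] by linarith
  qed
  consider "is = []" | i where "is = [i]" | i j where "is = [i, j]"
    using assms(2) by (cases "is" rule: list.exhaust; cases "tl is") (auto simp: length_Suc_conv le_Suc_eq)
  then show ?thesis
  proof cases
    case 3
    have "cmod (dsymbol is \<xi>) = cmod (\<i> * of_real (\<xi> \<bullet> i)) * cmod (\<i> * of_real (\<xi> \<bullet> j))"
      using 3 by (simp add: dsymbol_def norm_mult)
    also have "\<dots> \<le> norm \<xi> * norm \<xi>"
      using 3 assms(1) by (intro mult_mono 1) auto
    finally show ?thesis by (simp add: power2_eq_square)
  qed (use assms(1) 1 2 in \<open>force simp: dsymbol_def\<close>)+
qed

text \<open>The factors are purely imaginary, so conjugation produces exactly the sign that
  integration by parts puts into \<open>has_weak_deriv\<close>.\<close>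

lemma dsymbol_cnj: "cnj (dsymbol is \<xi>) = (-1) ^ length is * dsymbol is \<xi>"
  by (induction "is") (auto simp: dsymbol_def)

lemma test_fun_parseval:
  fixes w :: "'a::euclidean_space \<Rightarrow> real"
  assumes "fourier_pair \<psi> p" "core (\<lambda>x. of_real (w x))"
  shows "(\<integral>x. \<psi> x * of_real (w x) \<partial>lebesgue) = (\<integral>\<xi>. p \<xi> * cnj (ft (\<lambda>x. of_real (w x)) \<xi>) \<partial>lebesgue)"
  using fourier_pair_parseval[OF assms(1) fourier_pair_core[OF assms(2)]] by simp

lemma fourier_pair_weak_deriv:
  assumes p: "fourier_pair \<psi> p" and g: "fourier_pair g (\<lambda>\<xi>. dsymbol is \<xi> * p \<xi>)" and sub: "set is \<subseteq> Basis"
  shows "has_weak_deriv is \<psi> g"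
  unfolding has_weak_deriv_def
proof (intro allI impI)
  fix w :: "'a \<Rightarrow> real" assume w: "test_fun w"
  have "(\<integral>x. \<psi> x * of_real (iter_pd is w x) \<partial>lebesgue) =
     (\<integral>\<xi>. p \<xi> * cnj (ft (\<lambda>x. of_real (iter_pd is w x)) \<xi>) \<partial>lebesgue)"
    by (intro test_fun_parseval p test_fun_core test_fun_iter_pd w sub)
  also have "\<dots> = (\<integral>\<xi>. (-1) ^ length is * ((dsymbol is \<xi> * p \<xi>) * cnj (ft (\<lambda>x. of_real (w x)) \<xi>)) \<partial>lebesgue)"
    unfolding ft_def hat_iter_pd[OF w sub] by (simp add: dsymbol_cnj ac_simps)
  also have "\<dots> = (-1) ^ length is * (\<integral>x. g x * complex_of_real (w x) \<partial>lebesgue)"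
    by (subst test_fun_parseval[OF g test_fun_core[OF w]]) simp
  finally show "(\<integral>x. \<psi> x * of_real (iter_pd is w x) \<partial>lebesgue) = (-1) ^ length is * (\<integral>x. g x * of_real (w x) \<partial>lebesgue)" .
qed

lemma fourier_pair_weak_laplacian:
  assumes p: "fourier_pair \<psi> p" and d: "fourier_pair d (\<lambda>\<xi>. - of_real ((norm \<xi>)\<^sup>2) * p \<xi>)"
  shows "has_weak_laplacian \<psi> d"
  unfolding has_weak_laplacian_def
proof (intro allI impI)
  fix w :: "'a \<Rightarrow> real" assume w: "test_fun w"
  have "(\<integral>x. \<psi> x * of_real (laplace_fun w x) \<partial>lebesgue) =
     (\<integral>\<xi>. p \<xi> * cnj (ft (\<lambda>x. of_real (laplace_fun w x)) \<xi>) \<partial>lebesgue)"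
    by (intro test_fun_parseval p hat_laplace_fun w)
  also have "\<dots> = (\<integral>\<xi>. (- of_real ((norm \<xi>)\<^sup>2) * p \<xi>) * cnj (ft (\<lambda>x. of_real (w x)) \<xi>) \<partial>lebesgue)"
    unfolding ft_def hat_laplace_fun(2)[OF w] by (simp add: ac_simps)
  also have "\<dots> = (\<integral>x. d x * complex_of_real (w x) \<partial>lebesgue)"
    by (rule test_fun_parseval[OF d test_fun_core[OF w], symmetric])
  finally show "(\<integral>x. \<psi> x * of_real (laplace_fun w x) \<partial>lebesgue) = (\<integral>x. d x * of_real (w x) \<partial>lebesgue)" .
qed

lemma core_L1_kernel: "core (\<lambda>x. of_real (w x)) \<Longrightarrow> L1_kernel w"
  unfolding core_def L1_kernel_def using integrable_Re[of lborel "\<lambda>x. of_real (w x)"] by simp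

text \<open>Convolving with the bumps turns the weak identity into a pointwise one; their transforms do not
  vanish on balls exhausting the space, so they can be divided out.\<close>

lemma weak_laplacian_fourier:
  fixes \<psi> d :: "'a::euclidean_space \<Rightarrow> complex"
  assumes lap: "has_weak_laplacian \<psi> d" and p: "fourier_pair \<psi> p" and q: "fourier_pair d q"
  shows "AE \<xi> in lebesgue. q \<xi> = - of_real ((norm \<xi>)\<^sup>2) * p \<xi>"
proof -
  have "AE \<xi> in lebesgue. rhat (bump (Suc k)) \<xi> * (q \<xi> + of_real ((norm \<xi>)\<^sup>2) * p \<xi>) = 0" for k
  proof -
    let ?W = "bump (Suc k) :: 'a \<Rightarrow> real"
    have W: "test_fun ?W" by (rule bump_test_fun_0) simp
    \<comment> \<open>The weak identity is tested with the reflected translates of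
      \<open>?W\<close>, one for each \<open>x\<close>, so the equality holds at every
      point.\<close>
    have "conv ?W d = conv (laplace_fun ?W) \<psi>"
    proof
      fix x
      have "test_fun (\<lambda>y. ?W (x - y))" by (rule bump_test_fun) simp
      from lap[unfolded has_weak_laplacian_def, rule_format, OF this]
      show "conv ?W d x = conv (laplace_fun ?W) \<psi> x"
        unfolding conv_def by (simp add: laplace_fun_reflect[OF W] mult.commute)
    qed
    moreover have "fourier_pair (conv ?W d) (\<lambda>\<xi>. rhat ?W \<xi> * q \<xi>)"
      by (rule L1_kernel.fourier_pair_conv[OF core_L1_kernel[OF test_fun_core[OF W]] q])
    moreover have "fourier_pair (conv (laplace_fun ?W) \<psi>) (\<lambda>\<xi>. rhat (laplace_fun ?W) \<xi> * p \<xi>)"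
      by (rule L1_kernel.fourier_pair_conv[OF core_L1_kernel[OF hat_laplace_fun(1)[OF W]] p])
    ultimately have "AE \<xi> in lebesgue. rhat ?W \<xi> * q \<xi> = rhat (laplace_fun ?W) \<xi> * p \<xi>"
      using fourier_pair_AE_iff[of "conv ?W d" _ "conv ?W d"] by simp
    then show ?thesis
      by eventually_elim (simp add: hat_laplace_fun(2)[OF W] algebra_simps)
  qed
  \<comment> \<open>The exceptional null sets depend on \<open>k\<close> and are merged first,
    because the suitable \<open>k\<close> depends on the point.\<close>
  then have "AE \<xi> in lebesgue. \<forall>k. rhat (bump (Suc k)) \<xi> * (q \<xi> + of_real ((norm \<xi>)\<^sup>2) * p \<xi>) = 0"
    unfolding AE_all_countable by blast
  then show ?thesis
  proof eventually_elim
    case (elim \<xi>)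
    obtain k where "norm \<xi> \<le> real k" using real_arch_simple by blast
    then have "rhat (bump (Suc k)) \<xi> \<noteq> 0"
      by (intro hat_bump_nonzero) auto
    then have "q \<xi> + of_real ((norm \<xi>)\<^sup>2) * p \<xi> = 0"
      using elim by (metis mult_eq_0_iff)
    then show ?case by (simp add: add_eq_0_iff2)
  qed
qed

section \<open>Resolvent and spectrum in terms of the symbol\<close>

context L1_kernel
begin

definition symb :: "real \<Rightarrow> 'a \<Rightarrow> complex" where
  "symb k2 \<xi> = of_real ((norm \<xi>)\<^sup>2) + of_real k2 * \<phi>hat \<xi>"

lemma symb_measurable: "symb k2 \<in> borel_measurable lebesgue"
  unfolding symb_def[abs_def] by (rule borel_imp_lebesgue_measurable) simp

lemma L_op_fourier:
  assumes L: "L_op k2 \<phi> \<psi> h" and p: "fourier_pair \<psi> p"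
  shows "fourier_pair h (\<lambda>\<xi>. symb k2 \<xi> * p \<xi>)"
proof -
  obtain d where d: "L2 d" "has_weak_laplacian \<psi> d"
    and h: "AE x in lebesgue. h x = - d x + of_real k2 * conv \<phi> \<psi> x"
    using L by (auto simp: L_op_def)
  obtain q where q: "fourier_pair d q"
    using fourier_pair_exists[OF d(1)] by blast
  have lin: "fourier_pair (\<lambda>x. (-1) * d x + of_real k2 * conv \<phi> \<psi> x) (\<lambda>\<xi>. (-1) * q \<xi> + of_real k2 * (\<phi>hat \<xi> * p \<xi>))"
    by (intro fourier_pair_lin q fourier_pair_conv p)
  show ?thesis
  proof (rule fourier_pair_cong_AE[OF lin])
    show "AE x in lebesgue. (-1) * d x + of_real k2 * conv \<phi> \<psi> x = h x"
      using h by eventually_elim simp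
    show "AE \<xi> in lebesgue. (-1) * q \<xi> + of_real k2 * (\<phi>hat \<xi> * p \<xi>) = symb k2 \<xi> * p \<xi>"
      using weak_laplacian_fourier[OF d(2) p q] by eventually_elim (simp add: symb_def algebra_simps)
  qed
qed

text \<open>The converse passage, from the Fourier side into the domain: the weak derivatives and
  the weak Laplacian are preimages of symbol times \<open>p\<close>. The weight makes these products
  square-integrable, and surjectivity of the transform provides the preimages.\<close>

lemma L_op_exists:
  assumes p: "fourier_pair \<psi> p" and w: "L2 (\<lambda>\<xi>. of_real (1 + (norm \<xi>)\<^sup>2) * p \<xi>)"
  shows "\<exists>h. L_op k2 \<phi> \<psi> h"
proof -
  note L2 = fourier_pair_L2[OF p]
  have mult: "L2 (\<lambda>\<xi>. a \<xi> * p \<xi>)" if "a \<in> borel_measurable borel" "\<And>\<xi>. cmod (a \<xi>) \<le> 1 + (norm \<xi>)\<^sup>2" for a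
  proof (rule L2_bounded_by(1)[OF w, where C=1])
    show "(\<lambda>\<xi>. a \<xi> * p \<xi>) \<in> borel_measurable lebesgue"
      using borel_imp_lebesgue_measurable[OF that(1)] L2_measurable[OF L2(2)] by simp
    have "\<bar>1 + (norm \<xi>)\<^sup>2\<bar> = 1 + (norm \<xi>)\<^sup>2" for \<xi> :: 'a by (simp add: abs_of_nonneg)
    then show "AE \<xi> in lebesgue. cmod (a \<xi> * p \<xi>) \<le> 1 * cmod (complex_of_real (1 + (norm \<xi>)\<^sup>2) * p \<xi>)"
      using that(2) unfolding norm_mult norm_of_real by (auto intro!: mult_right_mono)
  qed
  have "H2 \<psi>"
    unfolding H2_def
  proof (intro conjI allI impI L2)
    fix "is" :: "'a list" assume "is": "set is \<subseteq> Basis \<and> length is \<le> 2"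
    have "L2 (\<lambda>\<xi>. dsymbol is \<xi> * p \<xi>)"
      using "is" by (intro mult dsymbol_measurable dsymbol_bound) auto
    then obtain g where "fourier_pair g (\<lambda>\<xi>. dsymbol is \<xi> * p \<xi>)"
      using fourier_pair_surj by blast
    then show "\<exists>g. L2 g \<and> has_weak_deriv is \<psi> g"
      using fourier_pair_weak_deriv[OF p] "is" fourier_pair_L2(1) by blast
  qed
  moreover have "L2 (\<lambda>\<xi>. - of_real ((norm \<xi>)\<^sup>2) * p \<xi>)"
    by (intro mult) (auto simp: norm_power)
  then obtain d where d: "fourier_pair d (\<lambda>\<xi>. - of_real ((norm \<xi>)\<^sup>2) * p \<xi>)"
    using fourier_pair_surj by blast
  ultimately show ?thesis
    unfolding L_op_def using fourier_pair_weak_laplacian[OF p d] fourier_pair_L2(1)[OF d]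
    by (intro exI[of _ "\<lambda>x. - d x + of_real k2 * conv \<phi> \<psi> x"]) auto
qed

lemma L_op_resolvent_fourier:
  assumes "L_op k2 \<phi> \<psi> h" "fourier_pair \<psi> p"
  shows "fourier_pair (\<lambda>x. h x - \<mu> * \<psi> x) (\<lambda>\<xi>. (symb k2 \<xi> - \<mu>) * p \<xi>)"
  using fourier_pair_diff[OF L_op_fourier[OF assms] fourier_pair_cmult[OF assms(2), of \<mu>]]
  by (simp add: algebra_simps)

text \<open>The resolvent is division by \<open>symb k2 \<xi> - \<mu>\<close>. The gap
  \<open>\<delta>\<close> bounds it on L2; its values lie in the domain because the symbol grows
  like |xi|^2.\<close>

lemma L_resolventI:
  assumes \<delta>: "\<delta> > 0" "\<And>\<xi>. cmod (symb k2 \<xi> - \<mu>) \<ge> \<delta>" and k2: "k2 \<ge> 0"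
  shows "L_resolvent k2 \<phi> \<mu>"
proof -
  have symb_nz: "symb k2 \<xi> - \<mu> \<noteq> 0" for \<xi>
    using \<delta>(2)[of \<xi>] \<delta>(1) by auto
  have bound: "nsq \<psi> \<le> (1 / \<delta>)\<^sup>2 * nsq (\<lambda>x. h x - \<mu> * \<psi> x)" if L: "L_op k2 \<phi> \<psi> h" for \<psi> h
  proof -
    have "L2 \<psi>" using L by (simp add: L_op_def H2_def)
    then obtain p where p: "fourier_pair \<psi> p"
      using fourier_pair_exists by blast
    note r = L_op_resolvent_fourier[OF L p, of \<mu>]
    have "nsq p \<le> (1 / \<delta>)\<^sup>2 * nsq (\<lambda>\<xi>. (symb k2 \<xi> - \<mu>) * p \<xi>)"
    proof (rule L2_bounded_by(2)[OF fourier_pair_L2(2)[OF r]])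
      show "p \<in> borel_measurable lebesgue"
        by (rule L2_measurable[OF fourier_pair_L2(2)[OF p]])
      show "AE \<xi> in lebesgue. cmod (p \<xi>) \<le> 1 / \<delta> * cmod ((symb k2 \<xi> - \<mu>) * p \<xi>)"
      proof (intro AE_I2)
        fix \<xi>
        have "\<delta> * cmod (p \<xi>) \<le> cmod (symb k2 \<xi> - \<mu>) * cmod (p \<xi>)"
          by (intro mult_right_mono \<delta>) auto
        then show "cmod (p \<xi>) \<le> 1 / \<delta> * cmod ((symb k2 \<xi> - \<mu>) * p \<xi>)"
          using \<delta>(1) unfolding norm_mult by (simp add: pos_le_divide_eq mult.commute)
      qed
    qed
    then show ?thesis
      by (simp add: fourier_pair_nsq[OF p] fourier_pair_nsq[OF r])
  qed
  show ?thesis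
    unfolding L_resolvent_def
  proof (intro conjI allI impI)
    fix g :: "'a \<Rightarrow> complex" assume "L2 g"
    then obtain q where q: "fourier_pair g q"
      using fourier_pair_exists by blast
    note qL2 = fourier_pair_L2(2)[OF q]
    define p where "p \<xi> = q \<xi> / (symb k2 \<xi> - \<mu>)" for \<xi>
    have [measurable]: "p \<in> borel_measurable lebesgue"
      unfolding p_def[abs_def] using symb_measurable[of k2] L2_measurable[OF qL2] by measurable
    \<comment> \<open>|xi|^2 differs from \<open>symb k2 \<xi> - \<mu>\<close> by at most
      \<open>cmod \<mu> + k2 * K\<close>; this constant, and the 1 of the weight, are absorbed
      through 1 <= |symb - mu| / delta.\<close>
    let ?C = "1 + (1 + cmod \<mu> + k2 * K) / \<delta>"
    have C: "1 + (norm \<xi>)\<^sup>2 \<le> ?C * cmod (symb k2 \<xi> - \<mu>)" for \<xi>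
    proof -
      have "of_real ((norm \<xi>)\<^sup>2) = (symb k2 \<xi> - \<mu>) + \<mu> - of_real k2 * \<phi>hat \<xi>"
        by (simp add: symb_def)
      then have "(norm \<xi>)\<^sup>2 = cmod ((symb k2 \<xi> - \<mu>) + \<mu> - of_real k2 * \<phi>hat \<xi>)"
        by (metis abs_of_nonneg norm_of_real zero_le_power2)
      also have "\<dots> \<le> cmod (symb k2 \<xi> - \<mu>) + cmod \<mu> + cmod (complex_of_real k2 * \<phi>hat \<xi>)"
        by (intro order_trans[OF norm_triangle_ineq4] add_right_mono norm_triangle_ineq)
      also have "cmod (complex_of_real k2 * \<phi>hat \<xi>) \<le> k2 * K"
        using k2 by (auto simp: norm_mult intro!: mult_left_mono kernel_hat_bound)
      finally have "1 + (norm \<xi>)\<^sup>2 \<le> cmod (symb k2 \<xi> - \<mu>) + (1 + cmod \<mu> + k2 * K) * 1"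
        by simp
      also have "\<dots> \<le> cmod (symb k2 \<xi> - \<mu>) + (1 + cmod \<mu> + k2 * K) * (cmod (symb k2 \<xi> - \<mu>) / \<delta>)"
        using \<delta> k2 K_nonneg by (intro add_left_mono mult_left_mono) auto
      also have "\<dots> = ?C * cmod (symb k2 \<xi> - \<mu>)"
        by (simp add: algebra_simps add_divide_distrib)
      finally show ?thesis .
    qed
    have Cp: "(1 + (norm \<xi>)\<^sup>2) * cmod (p \<xi>) \<le> ?C * cmod (q \<xi>)" for \<xi>
      using mult_right_mono[OF C[of \<xi>], of "cmod (p \<xi>)"] symb_nz[of \<xi>] by (simp add: p_def norm_divide)
    have wp: "L2 (\<lambda>\<xi>. of_real (1 + (norm \<xi>)\<^sup>2) * p \<xi>)"
    proof (rule L2_bounded_by(1)[OF qL2])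
      have "(\<lambda>\<xi>::'a. complex_of_real (1 + (norm \<xi>)\<^sup>2)) \<in> borel_measurable lebesgue"
        by (rule borel_imp_lebesgue_measurable) simp
      then show "(\<lambda>\<xi>. of_real (1 + (norm \<xi>)\<^sup>2) * p \<xi>) \<in> borel_measurable lebesgue"
        by simp
      have "\<bar>1 + (norm \<xi>)\<^sup>2\<bar> = 1 + (norm \<xi>)\<^sup>2" for \<xi> :: 'a by (simp add: abs_of_nonneg)
      then show "AE \<xi> in lebesgue. cmod (complex_of_real (1 + (norm \<xi>)\<^sup>2) * p \<xi>) \<le> ?C * cmod (q \<xi>)"
        using Cp unfolding norm_mult norm_of_real by auto
    qed
    have "L2 p"
    proof (rule L2_bounded_by(1)[OF wp, where C=1])
      have "\<bar>1 + (norm \<xi>)\<^sup>2\<bar> = 1 + (norm \<xi>)\<^sup>2" for \<xi> :: 'a by (simp add: abs_of_nonneg)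
      then show "AE \<xi> in lebesgue. cmod (p \<xi>) \<le> 1 * cmod (complex_of_real (1 + (norm \<xi>)\<^sup>2) * p \<xi>)"
        unfolding norm_mult norm_of_real by (auto simp: mult_le_cancel_right1)
    qed measurable
    then obtain \<psi> where \<psi>: "fourier_pair \<psi> p"
      using fourier_pair_surj by blast
    obtain h where h: "L_op k2 \<phi> \<psi> h"
      using L_op_exists[OF \<psi> wp] by blast
    have "(\<lambda>\<xi>. (symb k2 \<xi> - \<mu>) * p \<xi>) = q"
      using symb_nz by (simp add: p_def fun_eq_iff)
    then have "fourier_pair (\<lambda>x. h x - \<mu> * \<psi> x) q"
      using L_op_resolvent_fourier[OF h \<psi>, of \<mu>] by simp
    from fourier_pair_AE_iff[OF this q] have "AE x in lebesgue. h x - \<mu> * \<psi> x = g x" by simp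
    with h show "\<exists>\<psi> h. L_op k2 \<phi> \<psi> h \<and> (AE x in lebesgue. h x - \<mu> * \<psi> x = g x)" by blast
  next
    fix \<psi> h assume *: "L_op k2 \<phi> \<psi> h \<and> (AE x in lebesgue. h x = \<mu> * \<psi> x)"
    then have "nsq (\<lambda>x. h x - \<mu> * \<psi> x) = nsq (\<lambda>x::'a. 0)"
      by (intro nsq_cong_AE) auto
    then have "nsq \<psi> \<le> 0"
      using bound[of \<psi> h] * by (simp add: nsq_def)
    then have "nsq \<psi> = 0" using nsq_nonneg[of \<psi>] by linarith
    moreover have "L2 \<psi>" using * by (simp add: L_op_def H2_def)
    ultimately show "AE x in lebesgue. \<psi> x = 0"
      by (simp add: nsq_eq_0_iff)
  next
    show "\<exists>C. \<forall>\<psi> h. L_op k2 \<phi> \<psi> h \<longrightarrow> L2norm \<psi> \<le> C * L2norm (\<lambda>x. h x - \<mu> * \<psi> x)"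
    proof (intro exI allI impI)
      fix \<psi> h assume L: "L_op k2 \<phi> \<psi> h"
      from real_sqrt_le_mono[OF bound[OF L]]
      show "L2norm \<psi> \<le> (1 / \<delta>) * L2norm (\<lambda>x. h x - \<mu> * \<psi> x)"
        using \<delta>(1) by (simp add: L2norm_nsq real_sqrt_mult real_sqrt_divide)
    qed
  qed
qed

text \<open>A real nonnegative symbol keeps distance at least \<open>\<bar>Im \<mu>\<bar>\<close>
  from a nonreal point and at least \<open>- Re \<mu>\<close> from a negative one, so both kinds of
  points admit the gap required by \<open>L_resolventI\<close>.\<close>

theorem spectrally_stableI:
  assumes k2: "k2 \<ge> 0" and H: "\<And>\<xi>. \<phi>hat \<xi> = of_real (H \<xi>)"
    and nonneg: "\<And>\<xi>. (norm \<xi>)\<^sup>2 + k2 * H \<xi> \<ge> 0"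
  shows "spectrally_stable k2 \<phi>"
  unfolding spectrally_stable_def L_spectrum_def
proof
  fix \<mu> assume "\<mu> \<in> {\<mu>. \<not> L_resolvent k2 \<phi> \<mu>}"
  then have not: "\<not> L_resolvent k2 \<phi> \<mu>" by simp
  have symb: "symb k2 \<xi> = of_real ((norm \<xi>)\<^sup>2 + k2 * H \<xi>)" for \<xi>
    by (simp add: symb_def H)
  show "\<mu> \<in> complex_of_real ` {0..}"
  proof (rule ccontr)
    assume out: "\<mu> \<notin> complex_of_real ` {0..}"
    have "L_resolvent k2 \<phi> \<mu>"
    proof (cases "Im \<mu> = 0")
      case False
      show ?thesis
      proof (rule L_resolventI[OF _ _ k2])
        show "\<bar>Im \<mu>\<bar> > 0" using False by simp
        show "\<bar>Im \<mu>\<bar> \<le> cmod (symb k2 \<xi> - \<mu>)" for \<xi>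
          using abs_Im_le_cmod[of "symb k2 \<xi> - \<mu>"] unfolding symb by simp
      qed
    next
      case True
      then have \<mu>: "\<mu> = complex_of_real (Re \<mu>)" by (simp add: complex_eq_iff)
      then have neg: "Re \<mu> < 0" using out by (metis atLeast_iff image_eqI not_le)
      show ?thesis
      proof (rule L_resolventI[OF _ _ k2])
        show "- Re \<mu> > 0" using neg by simp
        show "- Re \<mu> \<le> cmod (symb k2 \<xi> - \<mu>)" for \<xi>
          using complex_Re_le_cmod[of "symb k2 \<xi> - \<mu>"] nonneg[of \<xi>] unfolding symb by simp
      qed
    qed
    with not show False by simp
  qed
qed

text \<open>A wave packet whose transform is concentrated near \<open>\<xi>0\<close> is an approximate eigenfunction.\<close>

theorem spectrally_unstableI:
  assumes H: "\<phi>hat \<xi>0 = of_real H" and neg: "(norm \<xi>0)\<^sup>2 + k2 * H < 0"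
  shows "spectrally_unstable k2 \<phi>"
proof -
  define \<mu> where "\<mu> = (norm \<xi>0)\<^sup>2 + k2 * H"
  have \<mu>: "symb k2 \<xi>0 = of_real \<mu>"
    by (simp add: symb_def H \<mu>_def)
  have cont: "isCont (symb k2) \<xi>0"
    unfolding symb_def[abs_def] using kernel_integrable by (intro continuous_intros hat_isCont) auto
  have "\<not> L_resolvent k2 \<phi> (complex_of_real \<mu>)"
  proof
    assume "L_resolvent k2 \<phi> (complex_of_real \<mu>)"
    then obtain C where C: "\<And>\<psi> h. L_op k2 \<phi> \<psi> h \<Longrightarrow> L2norm \<psi> \<le> C * L2norm (\<lambda>x. h x - of_real \<mu> * \<psi> x)"
      unfolding L_resolvent_def by blast
    \<comment> \<open>Small enough that \<open>\<bar>C\<bar> * \<epsilon> < 1\<close> whatever the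
      sign of \<open>C\<close>: a residual of at most \<open>\<epsilon>\<close> times the norm then
      contradicts the resolvent estimate.\<close>
    define \<epsilon> where "\<epsilon> = 1 / (2 * (\<bar>C\<bar> + 1))"
    have \<epsilon>: "\<epsilon> > 0" "\<bar>C\<bar> * \<epsilon> < 1" by (auto simp: \<epsilon>_def field_simps)
    obtain r where r: "r > 0" "\<And>\<xi>. dist \<xi> \<xi>0 < r \<Longrightarrow> dist (symb k2 \<xi>) (symb k2 \<xi>0) < \<epsilon>"
      using cont \<epsilon>(1) unfolding continuous_at_eps_delta by blast
    \<comment> \<open>The packet is prescribed on the Fourier side; its bounded support keeps the
      weight bounded, so the preimage lies in the domain.\<close>
    define p where "p \<xi> = complex_of_real (indicator (ball \<xi>0 r) \<xi>)" for \<xi>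
    have [measurable]: "ball \<xi>0 r \<in> sets borel" by simp
    have p_meas [measurable]: "p \<in> borel_measurable lebesgue"
      unfolding p_def[abs_def] by (rule borel_imp_lebesgue_measurable) measurable
    have p2: "(\<lambda>\<xi>. (cmod (p \<xi>))\<^sup>2) = indicator (ball \<xi>0 r)"
      by (auto simp: p_def fun_eq_iff split: split_indicator)
    have "integrable lborel (indicator (ball \<xi>0 r) :: 'a \<Rightarrow> real)"
      by (intro integrable_real_indicator) (use emeasure_bounded_finite[OF bounded_ball[of \<xi>0 r]] in auto)
    then have p: "L2 p"
      unfolding L2_def p2 by (auto simp: integrable_completion)
    have nsq_p: "nsq p > 0"
      unfolding nsq_def p2 using content_ball_pos[OF r(1), of \<xi>0] by simp
    have wp: "L2 (\<lambda>\<xi>. of_real (1 + (norm \<xi>)\<^sup>2) * p \<xi>)"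
    proof (rule L2_bounded_by(1)[OF p])
      have "(\<lambda>\<xi>::'a. complex_of_real (1 + (norm \<xi>)\<^sup>2)) \<in> borel_measurable lebesgue"
        by (rule borel_imp_lebesgue_measurable) simp
      then show "(\<lambda>\<xi>. of_real (1 + (norm \<xi>)\<^sup>2) * p \<xi>) \<in> borel_measurable lebesgue"
        by simp
      show "AE \<xi> in lebesgue. cmod (complex_of_real (1 + (norm \<xi>)\<^sup>2) * p \<xi>) \<le> (1 + (norm \<xi>0 + r)\<^sup>2) * cmod (p \<xi>)"
      proof (intro AE_I2)
        fix \<xi>
        show "cmod (complex_of_real (1 + (norm \<xi>)\<^sup>2) * p \<xi>) \<le> (1 + (norm \<xi>0 + r)\<^sup>2) * cmod (p \<xi>)"
        proof (cases "\<xi> \<in> ball \<xi>0 r")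
          case True
          then have "norm \<xi> \<le> norm \<xi>0 + r"
            using norm_triangle_ineq2[of \<xi> \<xi>0] by (simp add: dist_norm norm_minus_commute)
          then have "(norm \<xi>)\<^sup>2 \<le> (norm \<xi>0 + r)\<^sup>2" by (intro power_mono) auto
          then show ?thesis using True unfolding norm_mult norm_of_real by (simp add: p_def abs_of_nonneg)
        qed (simp add: p_def)
      qed
    qed
    obtain \<psi> where \<psi>: "fourier_pair \<psi> p"
      using fourier_pair_surj[OF p] by blast
    obtain h where h: "L_op k2 \<phi> \<psi> h"
      using L_op_exists[OF \<psi> wp] by blast
    note F = L_op_resolvent_fourier[OF h \<psi>, of "of_real \<mu>"]
    have "nsq (\<lambda>\<xi>. (symb k2 \<xi> - of_real \<mu>) * p \<xi>) \<le> \<epsilon>\<^sup>2 * nsq p"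
    proof (rule L2_bounded_by(2)[OF p])
      show "(\<lambda>\<xi>. (symb k2 \<xi> - of_real \<mu>) * p \<xi>) \<in> borel_measurable lebesgue"
        using symb_measurable[of k2] by simp
      show "AE \<xi> in lebesgue. cmod ((symb k2 \<xi> - of_real \<mu>) * p \<xi>) \<le> \<epsilon> * cmod (p \<xi>)"
        using r(2) unfolding norm_mult \<mu>[symmetric]
        by (auto simp: p_def dist_norm norm_minus_commute less_imp_le split: split_indicator)
    qed
    then have "sqrt (nsq (\<lambda>x. h x - of_real \<mu> * \<psi> x)) \<le> sqrt (\<epsilon>\<^sup>2 * nsq p)"
      by (simp only: fourier_pair_nsq[OF F, symmetric] real_sqrt_le_mono)
    also have "\<dots> = \<epsilon> * sqrt (nsq p)"
      using \<epsilon>(1) by (simp add: real_sqrt_mult)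
    finally have le: "L2norm (\<lambda>x. h x - of_real \<mu> * \<psi> x) \<le> \<epsilon> * sqrt (nsq p)"
      by (simp add: L2norm_nsq)
    have "sqrt (nsq p) = L2norm \<psi>"
      by (simp add: L2norm_nsq fourier_pair_nsq[OF \<psi>])
    also have "\<dots> \<le> C * L2norm (\<lambda>x. h x - of_real \<mu> * \<psi> x)"
      by (rule C[OF h])
    also have "\<dots> \<le> \<bar>C\<bar> * L2norm (\<lambda>x. h x - of_real \<mu> * \<psi> x)"
      by (intro mult_right_mono) (auto simp: L2norm_nsq)
    also have "\<dots> \<le> \<bar>C\<bar> * (\<epsilon> * sqrt (nsq p))"
      by (intro mult_left_mono le) auto
    also have "\<dots> < 1 * sqrt (nsq p)"
      unfolding mult.assoc[symmetric] using \<epsilon>(2) nsq_p by (intro mult_strict_right_mono) auto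
    finally show False by simp
  qed
  then show ?thesis
    unfolding spectrally_unstable_def L_spectrum_def using neg by (auto simp: \<mu>_def[symmetric])
qed

end

section \<open>The kernels\<close>

definition sinc :: "real \<Rightarrow> real" where
  "sinc z = (if z = 0 then 1 else sin z / z)"

lemma integrable_phi_a:
  assumes "N > 0"
  shows "integrable lborel (phi_a N)"
  unfolding phi_a_def by (intro integrable_mult_right integrable_real_indicator) (use assms in auto)

lemma hat_phi_a:
  assumes N: "N > 0"
  shows "rhat (phi_a N) \<xi> = of_real (sinc (N * \<xi>))"
proof -
  have "rhat (phi_a N) \<xi> =
      (\<integral>x. of_real (1 / (2 * N)) * (indicator {-N..N} x *\<^sub>R cis (- (\<xi> * x))) \<partial>lborel)"
    unfolding hat_def phi_a_def
    by (intro Bochner_Integration.integral_cong refl) (auto split: split_indicator)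
  also have "\<dots> = of_real (1 / (2 * N)) * (\<integral>x. indicator {-N..N} x *\<^sub>R cis (- (\<xi> * x)) \<partial>lborel)"
    by (rule integral_mult_right_zero)
  also have "(\<integral>x. indicator {-N..N} x *\<^sub>R cis (- (\<xi> * x)) \<partial>lborel) = of_real (2 * N * sinc (N * \<xi>))"
  proof (cases "\<xi> = 0")
    case True
    then show ?thesis using N by (simp add: sinc_def scaleR_conv_of_real)
  next
    case False
    let ?F = "\<lambda>x::real. \<i> / complex_of_real \<xi> * exp (complex_of_real x * (- \<i> * complex_of_real \<xi>))"
    have "(?F has_vector_derivative exp (complex_of_real x * (- \<i> * complex_of_real \<xi>))) (at x within S)" for x S
      using False by (intro has_vector_derivative_real_field) (auto intro!: derivative_eq_intros)
    moreover have "cis (- (\<xi> * x)) = exp (of_real x * (- \<i> * of_real \<xi>))" for x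
      by (simp add: cis_conv_exp ac_simps)
    ultimately have "(?F has_vector_derivative cis (- (\<xi> * x))) (at x within S)" for x S
      by (simp only:)
    moreover have "continuous_on {-N..N} (\<lambda>x. cis (- (\<xi> * x)))"
      by (intro continuous_intros)
    ultimately have "(\<integral>x. indicator {-N..N} x *\<^sub>R cis (- (\<xi> * x)) \<partial>lborel) = ?F N - ?F (- N)"
      using N by (intro integral_FTC_Icc) auto
    also have "\<dots> = \<i> / of_real \<xi> * (cis (- (N * \<xi>)) - cis (N * \<xi>))"
      by (simp add: cis_conv_exp algebra_simps)
    also have "\<dots> = complex_of_real (2 * N * sinc (N * \<xi>))"
      using False N by (simp add: sinc_def complex_eq_iff)
    finally show ?thesis .
  qed
  finally show ?thesis using N by simp
qed

lemma hat_product: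
  fixes u :: "real \<Rightarrow> real" and v :: "'b::euclidean_space \<Rightarrow> real"
  assumes "integrable lborel u" "integrable lborel v"
  shows "integrable lborel (\<lambda>p. u (fst p) * v (snd p))"
    and "hat (\<lambda>p. of_real (u (fst p) * v (snd p))) (\<xi>, \<eta>) =
           rhat u \<xi> * rhat v \<eta>"
proof -
  show "integrable lborel (\<lambda>p. u (fst p) * v (snd p))"
    using integrable_pair_mult[OF assms] unfolding lborel_prod by (simp add: case_prod_beta')
  let ?u = "\<lambda>x. of_real (u x) * cis (- (\<xi> \<bullet> x))" and ?v = "\<lambda>y. of_real (v y) * cis (- (\<eta> \<bullet> y))"
  have i: "integrable (lborel \<Otimes>\<^sub>M lborel) (\<lambda>(x, y). ?u x * ?v y)"
    using assms by (intro integrable_pair_mult integrable_cis_mult integrable_of_real) auto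
  have "hat (\<lambda>p. of_real (u (fst p) * v (snd p))) (\<xi>, \<eta>) = integral\<^sup>L (lborel \<Otimes>\<^sub>M lborel) (\<lambda>(x, y). ?u x * ?v y)"
    unfolding hat_def lborel_prod
  proof (intro Bochner_Integration.integral_cong refl)
    fix p :: "real \<times> 'b"
    obtain a b where p: "p = (a, b)" by fastforce
    have "cis (- ((\<xi>, \<eta>) \<bullet> p)) = cis (- (\<xi> \<bullet> a)) * cis (- (\<eta> \<bullet> b))"
      by (simp add: p cis_mult)
    then show "of_real (u (fst p) * v (snd p)) * cis (- ((\<xi>, \<eta>) \<bullet> p)) = (case p of (x, y) \<Rightarrow> ?u x * ?v y)"
      by (simp only: p prod.case fst_conv snd_conv of_real_mult) (simp add: mult.assoc mult.left_commute)
  qed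
  also have "\<dots> = (\<integral>x. (\<integral>y. ?u x * ?v y \<partial>lborel) \<partial>lborel)"
    using lborel_pair.integral_fst'[OF i] by simp
  also have "\<dots> = rhat u \<xi> * rhat v \<eta>"
    unfolding hat_def by simp
  finally show "hat (\<lambda>p. of_real (u (fst p) * v (snd p))) (\<xi>, \<eta>) =
           rhat u \<xi> * rhat v \<eta>" .
qed

section \<open>Exponential kernels as mixtures of Gaussians\<close>

lemma gaussian_absolutely_integrable:
  "(\<lambda>w::real. exp (- w\<^sup>2)) absolutely_integrable_on UNIV" "integral UNIV (\<lambda>w::real. exp (- w\<^sup>2)) = sqrt pi"
proof -
  have "has_bochner_integral lborel (\<lambda>x::real. exp (- x\<^sup>2)) (sqrt pi / 2 + sqrt pi / 2)"
    using has_bochner_integral_even_function[OF gaussian_moment_0] by simp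
  then have "integrable lborel (\<lambda>x::real. exp (- x\<^sup>2))" "(\<integral>x. exp (- x\<^sup>2) \<partial>lborel) = sqrt pi"
    by (auto simp: has_bochner_integral_iff)
  then have *: "integrable lebesgue (\<lambda>x::real. exp (- x\<^sup>2))" "(\<integral>x. exp (- x\<^sup>2) \<partial>lebesgue) = sqrt pi"
    by (simp_all add: integrable_completion integral_completion)
  then show 1: "(\<lambda>w::real. exp (- w\<^sup>2)) absolutely_integrable_on UNIV"
    by (simp add: set_integrable_def)
  show "integral UNIV (\<lambda>w::real. exp (- w\<^sup>2)) = sqrt pi"
    using set_lebesgue_integral_eq_integral(2)[OF 1] *(2) by (simp add: set_lebesgue_integral_def)
qed

text \<open>The Cauchy--Schloemilch substitution: \<open>u \<mapsto> u - c / u\<close> maps the half line onto the line, and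
  \<open>u \<mapsto> c / u\<close> exchanges the two summands of its derivative \<open>1 + c / u\<^sup>2\<close>.\<close>

lemma cauchy_schloemilch_gaussian:
  fixes c :: real
  assumes c: "c > 0"
  shows "(\<lambda>u. exp (- (u - c / u)\<^sup>2)) absolutely_integrable_on {0<..}"
    and "integral {0<..} (\<lambda>u. exp (- (u - c / u)\<^sup>2)) = sqrt pi / 2"
proof -
  let ?S = "{0<..} :: real set" and ?g = "\<lambda>u. u - c / u" and ?F = "\<lambda>u. exp (- (u - c / u)\<^sup>2)"
  have inj: "inj_on ?g ?S"
  proof (rule inj_onI)
    fix x y assume xy: "x \<in> ?S" "y \<in> ?S" "?g x = ?g y"
    then have "(x - y) * (1 + c / (x * y)) = 0"
      by (simp add: field_simps)
    moreover have "1 + c / (x * y) > 0"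
      using xy c by (intro add_pos_pos) auto
    ultimately show "x = y" by simp
  qed
  have img: "?g ` ?S = UNIV"
  proof -
    have "\<exists>u>0. ?g u = w" for w
    proof -
      \<comment> \<open>The positive root of u^2 - w u - c = 0.\<close>
      define u where "u = (w + sqrt (w\<^sup>2 + 4 * c)) / 2"
      have "sqrt (w\<^sup>2 + 4 * c) > \<bar>w\<bar>"
        using c by (simp add: real_less_rsqrt)
      then have u: "u > 0" by (simp add: u_def)
      have u2: "2 * u - w = sqrt (w\<^sup>2 + 4 * c)" by (simp add: u_def field_simps)
      have "(2 * u - w)\<^sup>2 = w\<^sup>2 + 4 * c"
        unfolding u2 using c by simp
      then have "u * u - c = w * u" by (simp add: power2_eq_square algebra_simps)
      then have "?g u = w" using u by (simp add: field_simps)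
      with u show ?thesis by blast
    qed
    then show ?thesis by (metis (mono_tags, lifting) UNIV_eq_I greaterThan_iff image_eqI)
  qed
  have der: "(?g has_field_derivative 1 + c / u\<^sup>2) (at u within ?S)" if "u \<in> ?S" for u
    using that by (auto intro!: derivative_eq_intros simp: power2_eq_square)
  have 1: "(\<lambda>u. \<bar>1 + c / u\<^sup>2\<bar> * ?F u) absolutely_integrable_on ?S \<and> integral ?S (\<lambda>u. \<bar>1 + c / u\<^sup>2\<bar> * ?F u) = sqrt pi"
    using has_absolute_integral_change_of_variables_1'[OF _ der inj, of "\<lambda>w. exp (- w\<^sup>2)" "sqrt pi"]
      gaussian_absolutely_integrable unfolding img by simp
  show F: "?F absolutely_integrable_on ?S"
  proof (rule measurable_bounded_by_integrable_imp_absolutely_integrable)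
    show "?F \<in> borel_measurable (lebesgue_on ?S)"
      by (intro measurable_restrict_space1 measurable_completion) simp
    show "(\<lambda>u. \<bar>1 + c / u\<^sup>2\<bar> * ?F u) integrable_on ?S"
      using 1 set_lebesgue_integral_eq_integral(1) by blast
    show "norm (?F u) \<le> \<bar>1 + c / u\<^sup>2\<bar> * ?F u" if "u \<in> ?S" for u
      using c by (simp add: mult_le_cancel_right1)
  qed simp
  have der2: "((\<lambda>u. c / u) has_field_derivative - c / u\<^sup>2) (at u within ?S)" if "u \<in> ?S" for u
    using that by (auto intro!: derivative_eq_intros simp: power2_eq_square)
  have inj2: "inj_on (\<lambda>u. c / u) ?S"
    using c by (auto simp: inj_on_def)
  have img2: "(\<lambda>u. c / u) ` ?S = ?S"
  proof
    show "?S \<subseteq> (\<lambda>u. c / u) ` ?S"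
    proof
      fix x assume "x \<in> ?S"
      then show "x \<in> (\<lambda>u. c / u) ` ?S" using c by (intro image_eqI[of _ _ "c / x"]) auto
    qed
  qed (use c in auto)
  have 2: "(\<lambda>u. \<bar>- c / u\<^sup>2\<bar> * ?F (c / u)) absolutely_integrable_on ?S \<and> integral ?S (\<lambda>u. \<bar>- c / u\<^sup>2\<bar> * ?F (c / u)) = integral ?S ?F"
    using has_absolute_integral_change_of_variables_1'[OF _ der2 inj2, of ?F "integral ?S ?F"] F unfolding img2 by simp
  have eq: "?F (c / u) = ?F u" if "u \<in> ?S" for u
    using that c by (simp add: power2_commute)
  have "integral ?S (\<lambda>u. \<bar>1 + c / u\<^sup>2\<bar> * ?F u) = integral ?S (\<lambda>u. ?F u + \<bar>- c / u\<^sup>2\<bar> * ?F (c / u))"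
    by (rule Henstock_Kurzweil_Integration.integral_cong)
       (use c in \<open>auto simp: eq ring_distribs abs_of_nonneg power2_commute simp del: abs_divide\<close>)
  also have "\<dots> = integral ?S ?F + integral ?S ?F"
    using 2 F set_lebesgue_integral_eq_integral(1) by (subst Henstock_Kurzweil_Integration.integral_add) auto
  finally show "integral ?S ?F = sqrt pi / 2"
    using 1 by simp
qed

text \<open>Completing the square, u^2 + (c/u)^2 = (u - c/u)^2 + 2c, leaves the integral just
  computed. With \<open>c\<close> proportional to a norm, this displays an exponential of that norm
  as a positive mixture of Gaussians. At \<open>c = 0\<close> it is the half-line Gaussian
  integral.\<close>

lemma gaussian_subordination:
  fixes c :: real
  assumes "c \<ge> 0"
  shows "has_bochner_integral lborel (\<lambda>u. indicator {0<..} u * exp (- u\<^sup>2 - (c / u)\<^sup>2)) (sqrt pi / 2 * exp (- 2 * c))"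
proof (cases "c = 0")
  case True
  have "AE u in lborel. indicator {0..} u *\<^sub>R exp (- u\<^sup>2) = (indicator {0<..} u * exp (- u\<^sup>2 - (0 / u)\<^sup>2) :: real)"
    using AE_lborel_singleton[of "0::real"] by eventually_elim (auto split: split_indicator)
  from has_bochner_integral_cong_AE[THEN iffD1, OF _ _ this gaussian_moment_0]
  show ?thesis using True by simp
next
  case False
  then have c: "c > 0" using assms by simp
  let ?S = "{0<..} :: real set"
  let ?f = "\<lambda>u. indicator ?S u * exp (- u\<^sup>2 - (c / u)\<^sup>2)"
  note CS = cauchy_schloemilch_gaussian[OF c]
  have sq: "exp (- u\<^sup>2 - (c / u)\<^sup>2) = exp (- 2 * c) * exp (- (u - c / u)\<^sup>2)" if "u > 0" for u
    using that by (simp add: exp_add[symmetric] power2_diff)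
  have f: "?f = (\<lambda>u. exp (- 2 * c) * (indicator ?S u *\<^sub>R exp (- (u - c / u)\<^sup>2)))"
    using sq by (auto simp: fun_eq_iff split: split_indicator)
  have "integrable lebesgue ?f" "(\<integral>u. ?f u \<partial>lebesgue) = sqrt pi / 2 * exp (- 2 * c)"
    unfolding f using CS(1) set_lebesgue_integral_eq_integral(2)[OF CS(1)] CS(2)
    by (auto simp: set_integrable_def set_lebesgue_integral_def)
  then show ?thesis
    unfolding has_bochner_integral_iff by (simp_all add: integrable_completion integral_completion)
qed

text \<open>Subordination followed by Fubini: each Gaussian in the mixture has a known positive
  transform. In dimension \<open>2 * m + 1\<close> the transform at 0 is governed by the odd moment
  of \<open>exp (- u\<^sup>2)\<close> of that order, equal to \<open>fact m / 2\<close>, whence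
  \<open>A\<close>. Elsewhere an extra Gaussian factor of at most 1 appears, which gives the upper
  bound.\<close>

lemma hat_exp_norm:
  fixes \<alpha> :: real
  assumes \<alpha>: "\<alpha> > 0" and dim: "DIM('b::euclidean_space) = 2 * m + 1"
  defines "A \<equiv> fact m / sqrt pi * (2 * sqrt pi / \<alpha>) ^ (2 * m + 1)"
  shows "integrable lborel (\<lambda>y::'b. exp (- \<alpha> * norm y))" (is ?I)
    and "\<exists>V. \<forall>\<eta>::'b. hat (\<lambda>y. of_real (exp (- \<alpha> * norm y))) \<eta> = of_real (V \<eta>)
            \<and> 0 \<le> V \<eta> \<and> V \<eta> \<le> A \<and> V 0 = A" (is ?V)
proof -
  \<comment> \<open>Makes half the square of \<open>s u * norm y\<close> equal to the square of
    \<open>\<alpha> * norm y / (2 * u)\<close>, the exponent in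
    \<open>gaussian_subordination\<close> with \<open>c = \<alpha> * norm y / 2\<close>.\<close>
  define s where "s u = \<alpha> / (sqrt 2 * u)" for u
  let ?ind = "\<lambda>u::real. indicator {0<..} u :: real"
  let ?Q = "\<lambda>u (y::'b). ?ind u * exp (- u\<^sup>2) * exp (- ((s u * norm y)\<^sup>2 / 2))"
  have s: "s u > 0" if "u > 0" for u using \<alpha> that by (simp add: s_def)
  have [measurable]: "s \<in> borel_measurable borel" unfolding s_def[abs_def] by measurable
  have rad: "sqrt (2 * pi) / s u = 2 * sqrt pi / \<alpha> * u" if "u > 0" for u
    using \<alpha> that by (simp add: s_def real_sqrt_mult field_simps)
  have mix: "has_bochner_integral lborel (\<lambda>u. ?Q u y) (sqrt pi / 2 * exp (- \<alpha> * norm y))" for y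
  proof -
    have "(\<lambda>u. ?Q u y) = (\<lambda>u. ?ind u * exp (- u\<^sup>2 - (\<alpha> * norm y / 2 / u)\<^sup>2))"
      by (auto simp: fun_eq_iff s_def exp_add[symmetric] power_mult_distrib power_divide split: split_indicator)
    then show ?thesis
      using gaussian_subordination[of "\<alpha> * norm y / 2"] \<alpha> by simp
  qed
  have hatQ: "(\<integral>y. of_real (?Q u y) * cis (- (\<eta> \<bullet> y)) \<partial>lborel) =
      complex_of_real (?ind u * exp (- u\<^sup>2) * ((2 * sqrt pi / \<alpha> * u) ^ (2 * m + 1) * exp (- ((norm \<eta> / s u)\<^sup>2 / 2))))" for u \<eta>
  proof (cases "u > 0")
    case True
    have "(\<integral>y. of_real (?Q u y) * cis (- (\<eta> \<bullet> y)) \<partial>lborel) =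
        of_real (?ind u * exp (- u\<^sup>2)) * hat (\<lambda>y. of_real (exp (- ((s u * norm y)\<^sup>2 / 2)))) \<eta>"
      unfolding hat_def by (subst integral_mult_right_zero[symmetric]) (simp add: mult.assoc)
    then show ?thesis
      unfolding hat_gaussian[OF s[OF True]] rad[OF True] dim by simp
  qed simp
  let ?M = "\<lambda>u. ?ind u * exp (- u\<^sup>2) * (2 * sqrt pi / \<alpha> * u) ^ (2 * m + 1)"
  have M: "has_bochner_integral lborel ?M ((2 * sqrt pi / \<alpha>) ^ (2 * m + 1) * (fact m / 2))"
  proof -
    have "AE u in lborel. (2 * sqrt pi / \<alpha>) ^ (2 * m + 1) * (indicator {0..} u *\<^sub>R (exp (- u\<^sup>2) * u ^ (2 * m + 1))) = ?M u"
      unfolding power_mult_distrib[of "2 * sqrt pi / \<alpha>"] by (intro AE_I2) (auto split: split_indicator)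
    from has_bochner_integral_cong_AE[THEN iffD1, OF _ _ this has_bochner_integral_mult_right[OF gaussian_moment_odd_pos[of m]]]
    show ?thesis by simp
  qed
  have Q: "integrable (lborel \<Otimes>\<^sub>M lborel) (\<lambda>(u, y). ?Q u y)"
  proof (rule lborel_pair.Fubini_integrable)
    \<comment> \<open>The mass in \<open>y\<close> is the transform at frequency 0.\<close>
    have "complex_of_real (\<integral>y. ?Q u y \<partial>lborel) = complex_of_real (?M u)" for u
      using hatQ[of u 0] by (simp del: of_real_mult)
    then have "(\<integral>y. ?Q u y \<partial>lborel) = ?M u" for u
      using of_real_eq_iff by blast
    moreover have "(\<lambda>u. \<integral>y. norm (?Q u y) \<partial>lborel) = (\<lambda>u. \<integral>y. ?Q u y \<partial>lborel)"
      by (simp add: abs_mult)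
    ultimately show "integrable lborel (\<lambda>u. \<integral>y. norm (case (u, y) of (u, y) \<Rightarrow> ?Q u y) \<partial>lborel)"
      using M by (simp add: has_bochner_integral_iff)
    show "AE u in lborel. integrable lborel (\<lambda>y. case (u, y) of (u, y) \<Rightarrow> ?Q u y)"
    proof (intro AE_I2)
      fix u :: real
      show "integrable lborel (\<lambda>y. case (u, y) of (u, y) \<Rightarrow> ?Q u y)"
        using integrable_gaussian[OF s, of u, where 'a='b] by (cases "u > 0") auto
    qed
  qed measurable
  have "integrable lborel (\<lambda>y::'b. sqrt pi / 2 * exp (- \<alpha> * norm y))"
    using lborel_pair.integrable_snd[OF Q] unfolding has_bochner_integral_integral_eq[OF mix] .
  from integrable_mult_right[OF this, of "2 / sqrt pi"] show ?I by simp
  define V where "V \<eta> = 2 / sqrt pi * (\<integral>u. ?M u * exp (- ((norm \<eta> / s u)\<^sup>2 / 2)) \<partial>lborel)" for \<eta> :: 'b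
  have M_nonneg: "?M u \<ge> 0" for u
    using \<alpha> by (auto split: split_indicator)
  have V: "hat (\<lambda>y. of_real (exp (- \<alpha> * norm y))) \<eta> = of_real (V \<eta>)" for \<eta>
  proof -
    have Q': "integrable (lborel \<Otimes>\<^sub>M lborel) (\<lambda>(u, y). of_real (?Q u y) * cis (- (\<eta> \<bullet> y)))"
      by (rule Bochner_Integration.integrable_bound[OF Q]) (auto simp: norm_mult)
    have "of_real (sqrt pi / 2) * hat (\<lambda>y. of_real (exp (- \<alpha> * norm y))) \<eta> =
        (\<integral>y. of_real (\<integral>u. ?Q u y \<partial>lborel) * cis (- (\<eta> \<bullet> y)) \<partial>lborel)"
      unfolding hat_def has_bochner_integral_integral_eq[OF mix] by (simp only: of_real_mult mult.assoc integral_mult_right_zero)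
    also have "\<dots> = (\<integral>y. (\<integral>u. of_real (?Q u y) * cis (- (\<eta> \<bullet> y)) \<partial>lborel) \<partial>lborel)"
      by (simp only: integral_complex_of_real[symmetric] integral_mult_left_zero)
    also have "\<dots> = (\<integral>u. (\<integral>y. of_real (?Q u y) * cis (- (\<eta> \<bullet> y)) \<partial>lborel) \<partial>lborel)"
      by (rule lborel_pair.Fubini_integral[OF Q'])
    also have "\<dots> = complex_of_real (\<integral>u. ?M u * exp (- ((norm \<eta> / s u)\<^sup>2 / 2)) \<partial>lborel)"
      unfolding hatQ integral_complex_of_real by (simp only: mult.assoc)
    also have "\<dots> = complex_of_real (sqrt pi / 2) * complex_of_real (V \<eta>)"
      by (simp add: V_def)
    finally show ?thesis by simp
  qed
  have "0 \<le> V \<eta>" for \<eta>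
  proof -
    have "0 \<le> (\<integral>u. ?M u * exp (- ((norm \<eta> / s u)\<^sup>2 / 2)) \<partial>lborel)"
      by (rule Bochner_Integration.integral_nonneg, rule mult_nonneg_nonneg[OF M_nonneg]) simp
    then show ?thesis
      unfolding V_def by (rule mult_nonneg_nonneg[rotated]) simp
  qed
  moreover have A: "2 / sqrt pi * (\<integral>u. ?M u \<partial>lborel) = A"
    unfolding has_bochner_integral_integral_eq[OF M] A_def by simp
  then have "V 0 = A"
    by (simp add: V_def)
  moreover have "V \<eta> \<le> A" for \<eta>
  proof -
    have "V \<eta> \<le> 2 / sqrt pi * (\<integral>u. ?M u \<partial>lborel)"
      unfolding V_def
    proof (intro mult_left_mono integral_mono_AE')
      show "integrable lborel ?M" using M by (simp add: has_bochner_integral_iff)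
      show "AE u in lborel. ?M u * exp (- ((norm \<eta> / s u)\<^sup>2 / 2)) \<le> ?M u"
        by (intro AE_I2 mult_left_le[OF _ M_nonneg]) simp
      show "AE u in lborel. 0 \<le> ?M u" by (intro AE_I2 M_nonneg)
    qed auto
    then show ?thesis unfolding A .
  qed
  ultimately show ?V using V by blast
qed

section \<open>The threshold\<close>

text \<open>The derivative is 1/cos^2 - 1/3 and 1/cos^2 is at least 1. This fixes the sign of
  \<open>tan z - z / 3\<close> on either side of its zero \<open>z1\<close>.\<close>

lemma tan_minus_third_strict_mono:
  assumes "pi < a" "a < b" "b < 3 * pi / 2"
  shows "tan a - a / 3 < tan b - b / 3"
proof (rule DERIV_pos_imp_increasing[OF assms(2)])
  fix z assume z: "a \<le> z" "z \<le> b"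
  then have "cos z < 0"
    using assms cos_gt_zero_pi[of "z - pi"] by (simp add: cos_diff)
  moreover have "inverse ((cos z)\<^sup>2) - 1 / 3 > 0"
  proof -
    have "0 < (cos z)\<^sup>2" "(cos z)\<^sup>2 \<le> 1"
      using \<open>cos z < 0\<close> abs_cos_le_one[of z] by (auto simp: abs_square_le_1)
    then have "inverse ((cos z)\<^sup>2) \<ge> 1" by (simp add: one_le_inverse)
    then show ?thesis by simp
  qed
  ultimately show "\<exists>y. ((\<lambda>z. tan z - z / 3) has_real_derivative y) (at z) \<and> 0 < y"
    by (intro exI[of _ "inverse ((cos z)\<^sup>2) - 1 / 3"] conjI) (auto intro!: derivative_eq_intros)
qed

text \<open>On (pi, 3 pi/2) the numerator of the derivative is
  \<open>- 3 * cos z * (tan z - z / 3)\<close> with negative cosine, so the function falls up to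
  \<open>z1\<close> and rises afterwards. Up to pi it is nonnegative while its value at
  \<open>z1\<close> is negative; from 3 pi/2 on, the crude bound \<open>- 1 / z ^ 3\<close> is at
  least the value at 3 pi/2.\<close>

lemma sin_over_cube_min:
  assumes z1: "pi < z1" "z1 < 3 * pi / 2" "tan z1 = z1 / 3" and z: "z > 0"
  shows "sin z1 / z1 ^ 3 \<le> sin z / z ^ 3"
proof -
  let ?f = "\<lambda>z::real. sin z / z ^ 3"
  have der: "(?f has_real_derivative (z * cos z - 3 * sin z) / z ^ 4) (at z)" if "z > 0" for z
    using that by (auto intro!: derivative_eq_intros simp: field_simps eval_nat_numeral)
  have sign: "z * cos z - 3 * sin z = - 3 * cos z * (tan z - z / 3)" "cos z < 0" if "pi < z" "z < 3 * pi / 2" for z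
  proof -
    show "cos z < 0"
      using that cos_gt_zero_pi[of "z - pi"] by (simp add: cos_diff)
    then show "z * cos z - 3 * sin z = - 3 * cos z * (tan z - z / 3)"
      by (simp add: tan_def field_simps)
  qed
  have left: "?f z1 \<le> ?f z" if "pi < z" "z \<le> z1" for z
  proof (rule DERIV_nonpos_imp_nonincreasing[OF that(2)])
    fix x assume x: "z \<le> x" "x \<le> z1"
    have "tan x - x / 3 \<le> 0"
      using tan_minus_third_strict_mono[of x z1] x that z1 by (cases "x = z1") auto
    then have "x * cos x - 3 * sin x \<le> 0"
      using sign[of x] x that z1 by (auto simp: mult_nonpos_nonpos mult_le_0_iff zero_le_mult_iff)
    then show "\<exists>y. (?f has_real_derivative y) (at x) \<and> y \<le> 0"
      using der[of x] x that pi_gt_zero by (intro exI[of _ "(x * cos x - 3 * sin x) / x ^ 4"]) (auto intro: divide_nonpos_nonneg)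
  qed
  have right: "?f z1 \<le> ?f z" if "z1 \<le> z" "z < 3 * pi / 2" for z
  proof (rule DERIV_nonneg_imp_nondecreasing[OF that(1)])
    fix x assume x: "z1 \<le> x" "x \<le> z"
    have "tan x - x / 3 \<ge> 0"
      using tan_minus_third_strict_mono[of z1 x] x that z1 by (cases "x = z1") auto
    then have "x * cos x - 3 * sin x \<ge> 0"
      using sign[of x] x that z1 by (auto simp: mult_nonpos_nonpos mult_le_0_iff zero_le_mult_iff)
    then show "\<exists>y. (?f has_real_derivative y) (at x) \<and> 0 \<le> y"
      using der[of x] x that z1 pi_gt_zero by (intro exI[of _ "(x * cos x - 3 * sin x) / x ^ 4"]) auto
  qed
  \<comment> \<open>The tangent has its pole at this endpoint, so the comparison on the open
    interval is carried over by continuity from the left.\<close>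
  have cont: "isCont ?f (3 * pi / 2)"
    using pi_gt_zero by (intro continuous_intros) auto
  have "?f z1 \<le> ?f (3 * pi / 2)"
  proof (rule tendsto_lowerbound)
    show "(?f \<longlongrightarrow> ?f (3 * pi / 2)) (at_left (3 * pi / 2))"
      using cont unfolding isCont_def by (rule filterlim_mono) (auto simp: at_le)
    show "\<forall>\<^sub>F x in at_left (3 * pi / 2). ?f z1 \<le> ?f x"
      unfolding eventually_at_left_field using z1 right by (intro exI[of _ z1]) auto
  qed simp
  moreover have "sin (3 * pi / 2) = -1"
    using sin_3over2_pi by (simp add: mult.commute)
  ultimately have end_point: "?f z1 \<le> - 1 / (3 * pi / 2) ^ 3" by simp
  have neg: "?f z1 < 0"
  proof -
    have "sin z1 < 0"
      using z1 sin_gt_zero[of "z1 - pi"] by (simp add: sin_diff)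
    then show ?thesis using z1 pi_gt_zero by (intro divide_neg_pos) auto
  qed
  consider "z \<le> pi" | "pi < z" "z \<le> z1" | "z1 \<le> z" "z < 3 * pi / 2" | "z \<ge> 3 * pi / 2"
    by linarith
  then show ?thesis
  proof cases
    case 1
    then have "?f z \<ge> 0" using z by (intro divide_nonneg_pos sin_ge_zero) auto
    with neg show ?thesis by linarith
  next
    case 4
    have "- 1 / (3 * pi / 2) ^ 3 \<le> - 1 / z ^ 3"
      using 4 pi_gt_zero z by (simp add: frac_le power_mono)
    also have "\<dots> \<le> ?f z"
      using z by (intro divide_right_mono) auto
    finally show ?thesis using end_point by linarith
  qed (use left right in auto)
qed

text \<open>With z = N xi the positive factor \<open>k2 * z\<^sup>2 / N\<^sup>2\<close> splits off,
  and what remains is the threshold quantity, least at \<open>z1\<close>. Negative frequencies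
  reduce to positive ones since \<open>sinc\<close> is even.\<close>

lemma symbol_sign_threshold:
  fixes N k2 z1 :: real
  assumes N: "N > 0" and k2: "k2 > 0" and z1: "pi < z1" "z1 < 3 * pi / 2" "tan z1 = z1 / 3"
  shows "1 / k2 \<ge> - N\<^sup>2 * sin z1 / z1 ^ 3 \<Longrightarrow> \<xi>\<^sup>2 + k2 * sinc (N * \<xi>) \<ge> 0"
    and "1 / k2 < - N\<^sup>2 * sin z1 / z1 ^ 3 \<Longrightarrow> (z1 / N)\<^sup>2 + k2 * sinc (N * (z1 / N)) < 0"
proof -
  have z1_pos: "z1 > 0" using z1 pi_gt_zero by linarith
  have eq: "(z / N)\<^sup>2 + k2 * sinc z = k2 * z\<^sup>2 / N\<^sup>2 * (1 / k2 + N\<^sup>2 * (sin z / z ^ 3))" if "z \<noteq> 0" for z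
    using that N k2 by (simp add: sinc_def field_simps eval_nat_numeral)
  show "(z1 / N)\<^sup>2 + k2 * sinc (N * (z1 / N)) < 0" if "1 / k2 < - N\<^sup>2 * sin z1 / z1 ^ 3"
  proof -
    have "1 / k2 + N\<^sup>2 * (sin z1 / z1 ^ 3) < 0" using that by simp
    then have "k2 * z1\<^sup>2 / N\<^sup>2 * (1 / k2 + N\<^sup>2 * (sin z1 / z1 ^ 3)) < 0"
      using z1_pos N k2 by (intro mult_pos_neg) auto
    then show ?thesis using eq[of z1] z1_pos N by simp
  qed
  assume le: "1 / k2 \<ge> - N\<^sup>2 * sin z1 / z1 ^ 3"
  have pos: "(z / N)\<^sup>2 + k2 * sinc z \<ge> 0" if "z > 0" for z
  proof -
    have "N\<^sup>2 * (sin z1 / z1 ^ 3) \<le> N\<^sup>2 * (sin z / z ^ 3)"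
      by (intro mult_left_mono sin_over_cube_min z1 that) auto
    moreover have "0 \<le> 1 / k2 + N\<^sup>2 * (sin z1 / z1 ^ 3)" using le by simp
    ultimately have "0 \<le> 1 / k2 + N\<^sup>2 * (sin z / z ^ 3)" by linarith
    then have "0 \<le> k2 * z\<^sup>2 / N\<^sup>2 * (1 / k2 + N\<^sup>2 * (sin z / z ^ 3))"
      using k2 by (intro mult_nonneg_nonneg) auto
    then show ?thesis using eq[of z] that by simp
  qed
  consider "\<xi> = 0" | "\<xi> > 0" | "\<xi> < 0" by linarith
  then show "\<xi>\<^sup>2 + k2 * sinc (N * \<xi>) \<ge> 0"
  proof cases
    case 1
    then show ?thesis using k2 by (simp add: sinc_def)
  next
    case 2
    then show ?thesis using pos[of "N * \<xi>"] N by simp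
  next
    case 3
    have "sinc (- (N * \<xi>)) = sinc (N * \<xi>)" by (simp add: sinc_def)
    then show ?thesis using pos[of "- (N * \<xi>)"] 3 N by (simp add: mult_pos_neg)
  qed
qed

text \<open>Where \<open>sinc\<close> is negative, \<open>V \<le> 1\<close> moves the product
  towards 0 and the extra variables only add to the squared norm, so the one-dimensional inequality
  suffices. Conversely \<open>V 0 = 1\<close> carries the one-dimensional violation to the frequency
  \<open>(z1 / N, 0)\<close>.\<close>

lemma product_kernel_stability:
  fixes N k2 z1 :: real and v :: "'b::euclidean_space \<Rightarrow> real"
  assumes N: "N > 0" and k2: "k2 > 0" and z1: "pi < z1" "z1 < 3 * pi / 2" "tan z1 = z1 / 3"
    and v: "integrable lborel v"
    and V: "\<And>\<eta>. rhat v \<eta> = of_real (V \<eta>)"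
    and V_bounds: "\<And>\<eta>. 0 \<le> V \<eta>" "\<And>\<eta>. V \<eta> \<le> 1" "V 0 = 1"
  defines "\<phi> \<equiv> \<lambda>p. phi_a N (fst p) * v (snd p)"
  shows "1 / k2 \<ge> - N\<^sup>2 * sin z1 / z1 ^ 3 \<Longrightarrow> spectrally_stable k2 \<phi>"
    and "1 / k2 < - N\<^sup>2 * sin z1 / z1 ^ 3 \<Longrightarrow> spectrally_unstable k2 \<phi>"
proof -
  note u = integrable_phi_a[OF N]
  interpret L1_kernel \<phi>
    unfolding \<phi>_def by standard (rule hat_product(1)[OF u v])
  have H: "rhat \<phi> (\<xi>, \<eta>) = of_real (sinc (N * \<xi>) * V \<eta>)" for \<xi> \<eta>
    unfolding \<phi>_def hat_product(2)[OF u v] hat_phi_a[OF N] V by simp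
  note S = symbol_sign_threshold[OF N k2 z1]
  show "spectrally_stable k2 \<phi>" if le: "1 / k2 \<ge> - N\<^sup>2 * sin z1 / z1 ^ 3"
  proof (rule spectrally_stableI)
    show "rhat \<phi> \<zeta> = of_real (sinc (N * fst \<zeta>) * V (snd \<zeta>))" for \<zeta>
      using H[of "fst \<zeta>" "snd \<zeta>"] by simp
    show "(norm \<zeta>)\<^sup>2 + k2 * (sinc (N * fst \<zeta>) * V (snd \<zeta>)) \<ge> 0" for \<zeta>
    proof (cases "sinc (N * fst \<zeta>) \<ge> 0")
      case True
      then show ?thesis using k2 V_bounds by simp
    next
      case False
      have "sinc (N * fst \<zeta>) * 1 \<le> sinc (N * fst \<zeta>) * V (snd \<zeta>)"
        using False V_bounds by (intro mult_left_mono_neg) auto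
      then have "k2 * sinc (N * fst \<zeta>) \<le> k2 * (sinc (N * fst \<zeta>) * V (snd \<zeta>))"
        using k2 by simp
      moreover have "(norm \<zeta>)\<^sup>2 = (fst \<zeta>)\<^sup>2 + (norm (snd \<zeta>))\<^sup>2"
        by (simp add: norm_prod_def)
      moreover have "(norm (snd \<zeta>))\<^sup>2 \<ge> 0" by simp
      ultimately show ?thesis using S(1)[OF le, of "fst \<zeta>"] by linarith
    qed
  qed (use k2 in simp)
  show "spectrally_unstable k2 \<phi>" if less: "1 / k2 < - N\<^sup>2 * sin z1 / z1 ^ 3"
  proof (rule spectrally_unstableI)
    show "rhat \<phi> (z1 / N, 0) = of_real (sinc (N * (z1 / N)))"
      unfolding H V_bounds by simp
    have "(norm (z1 / N, 0 :: 'b))\<^sup>2 = (z1 / N)\<^sup>2" by (simp add: norm_prod_def power_divide)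
    then show "(norm (z1 / N, 0 :: 'b))\<^sup>2 + k2 * sinc (N * (z1 / N)) < 0"
      using S(2)[OF less] by simp
  qed
qed

lemma hat_gaussian_density:
  fixes \<alpha> :: real
  assumes "\<alpha> > 0"
  shows "integrable lborel (\<lambda>y::real. sqrt (\<alpha> / pi) * exp (- \<alpha> * y\<^sup>2))"
    and "hat (\<lambda>y. of_real (sqrt (\<alpha> / pi) * exp (- \<alpha> * y\<^sup>2))) \<eta> = of_real (exp (- (\<eta>\<^sup>2 / (4 * \<alpha>))))"
proof -
  define s where "s = sqrt (2 * \<alpha>)"
  have s: "s > 0" using assms by (simp add: s_def)
  have eq: "exp (- \<alpha> * y\<^sup>2) = exp (- ((s * norm y)\<^sup>2 / 2))" for y :: real
    using assms by (simp add: s_def power_mult_distrib)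
  show "integrable lborel (\<lambda>y::real. sqrt (\<alpha> / pi) * exp (- \<alpha> * y\<^sup>2))"
    unfolding eq by (intro integrable_mult_right integrable_gaussian s)
  have "hat (\<lambda>y. of_real (sqrt (\<alpha> / pi)) * of_real (exp (- ((s * norm y)\<^sup>2 / 2)))) \<eta> =
     complex_of_real (sqrt (\<alpha> / pi) * (sqrt (2 * pi) / s * exp (- ((norm \<eta> / s)\<^sup>2 / 2))))"
    unfolding hat_cmult hat_gaussian[OF s] by simp
  also have "sqrt (\<alpha> / pi) * (sqrt (2 * pi) / s * exp (- ((norm \<eta> / s)\<^sup>2 / 2))) = exp (- (\<eta>\<^sup>2 / (4 * \<alpha>)))"
    using assms by (simp add: s_def real_sqrt_divide real_sqrt_mult power_divide power_mult_distrib)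
  finally show "hat (\<lambda>y. of_real (sqrt (\<alpha> / pi) * exp (- \<alpha> * y\<^sup>2))) \<eta> = of_real (exp (- (\<eta>\<^sup>2 / (4 * \<alpha>))))"
    unfolding eq of_real_mult .
qed

text \<open>The premise on \<open>c\<close> says that the density has total mass 1, its integral
  being the transform at 0. It also makes \<open>c\<close> positive, so the bounds on the transform
  survive the scaling.\<close>

lemma hat_exp_density:
  fixes \<alpha> c :: real
  assumes \<alpha>: "\<alpha> > 0" and dim: "DIM('b::euclidean_space) = 2 * m + 1"
    and c: "c * (fact m / sqrt pi * (2 * sqrt pi / \<alpha>) ^ (2 * m + 1)) = 1"
  obtains V where "integrable lborel (\<lambda>y::'b. c * exp (- \<alpha> * norm y))"
    "\<And>\<eta>::'b. hat (\<lambda>y. of_real (c * exp (- \<alpha> * norm y))) \<eta> = of_real (V \<eta>)"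
    "\<And>\<eta>. 0 \<le> V \<eta>" "\<And>\<eta>. V \<eta> \<le> 1" "V 0 = 1"
proof -
  let ?A = "fact m / sqrt pi * (2 * sqrt pi / \<alpha>) ^ (2 * m + 1)"
  obtain V where V: "\<And>\<eta>::'b. hat (\<lambda>y. of_real (exp (- \<alpha> * norm y))) \<eta> = of_real (V \<eta>)"
    "\<And>\<eta>. 0 \<le> V \<eta>" "\<And>\<eta>. V \<eta> \<le> ?A" "V 0 = ?A"
    using hat_exp_norm(2)[OF \<alpha> dim] by metis
  have "?A > 0" using \<alpha> by simp
  then have c_pos: "c > 0" using c by (metis zero_less_mult_pos2 zero_less_one)
  show thesis
  proof (rule that[of "\<lambda>\<eta>. c * V \<eta>"])
    show "integrable lborel (\<lambda>y::'b. c * exp (- \<alpha> * norm y))"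
      by (intro integrable_mult_right hat_exp_norm(1)[OF \<alpha> dim])
    show "hat (\<lambda>y. of_real (c * exp (- \<alpha> * norm y))) \<eta> = of_real (c * V \<eta>)" for \<eta> :: 'b
      unfolding of_real_mult hat_cmult V ..
    show "0 \<le> c * V \<eta>" for \<eta> using V(2) c_pos by simp
    show "c * V \<eta> \<le> 1" for \<eta>
      using mult_left_mono[OF V(3)[of \<eta>], of c] c_pos c by simp
    show "c * V 0 = 1" using V(4) c by simp
  qed
qed

theorem theorem1:
  fixes N \<alpha> k2 z1 :: real
  assumes "N > 0" and "\<alpha> > 0" and "k2 > 0"
    and "pi < z1" and "z1 < 3 * pi / 2" and "tan z1 = z1 / 3"
  shows "(1 / k2 \<ge> - N\<^sup>2 * sin z1 / z1 ^ 3 \<longrightarrow>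
            spectrally_stable k2 (phi_a N) \<and> spectrally_stable k2 (phi_b N \<alpha>) \<and>
            spectrally_stable k2 (phi_c N \<alpha>) \<and> spectrally_stable k2 (phi_d N \<alpha>))
       \<and> (1 / k2 < - N\<^sup>2 * sin z1 / z1 ^ 3 \<longrightarrow>
            spectrally_unstable k2 (phi_a N) \<and> spectrally_unstable k2 (phi_b N \<alpha>) \<and>
            spectrally_unstable k2 (phi_c N \<alpha>) \<and> spectrally_unstable k2 (phi_d N \<alpha>))"
proof -
  note N = assms(1) and \<alpha> = assms(2) and k2 = assms(3) and z1 = assms(4-6)
  note product = product_kernel_stability[OF N k2 z1]
  note S = symbol_sign_threshold[OF N k2 z1]
  interpret a: L1_kernel "phi_a N"
    by standard (rule integrable_phi_a[OF N])
  have a: "1 / k2 \<ge> - N\<^sup>2 * sin z1 / z1 ^ 3 \<Longrightarrow> spectrally_stable k2 (phi_a N)"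
    "1 / k2 < - N\<^sup>2 * sin z1 / z1 ^ 3 \<Longrightarrow> spectrally_unstable k2 (phi_a N)"
    using a.spectrally_stableI[OF less_imp_le[OF k2] hat_phi_a[OF N]] S(1)
      a.spectrally_unstableI[OF hat_phi_a[OF N], of "z1 / N" k2] S(2) by (auto simp: power_divide)
  \<comment> \<open>Dimension 1 is \<open>m = 0\<close>, where the mass of the exponential is 2 /
    alpha.\<close>
  have dim1: "DIM(real) = 2 * 0 + 1" by simp
  have "\<alpha> / 2 * (fact 0 / sqrt pi * (2 * sqrt pi / \<alpha>) ^ (2 * 0 + 1)) = 1"
    using \<alpha> by simp
  from hat_exp_density[OF \<alpha> dim1 this]
  obtain V where "integrable lborel (\<lambda>y::real. \<alpha> / 2 * exp (- \<alpha> * norm y))"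
    "\<And>\<eta>::real. hat (\<lambda>y. of_real (\<alpha> / 2 * exp (- \<alpha> * norm y))) \<eta> = of_real (V \<eta>)"
    "\<And>\<eta>. 0 \<le> V \<eta>" "\<And>\<eta>. V \<eta> \<le> 1" "V 0 = 1"
    using that by blast
  from product[OF this] have b:
    "1 / k2 \<ge> - N\<^sup>2 * sin z1 / z1 ^ 3 \<Longrightarrow> spectrally_stable k2 (phi_b N \<alpha>)"
    "1 / k2 < - N\<^sup>2 * sin z1 / z1 ^ 3 \<Longrightarrow> spectrally_unstable k2 (phi_b N \<alpha>)"
    unfolding phi_a_def phi_b_def[abs_def] real_norm_def by blast+
  have "exp (- (\<eta>\<^sup>2 / (4 * \<alpha>))) \<le> 1" for \<eta> :: real using \<alpha> by simp
  from product[OF hat_gaussian_density[OF \<alpha>] _ this] have c: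
    "1 / k2 \<ge> - N\<^sup>2 * sin z1 / z1 ^ 3 \<Longrightarrow> spectrally_stable k2 (phi_c N \<alpha>)"
    "1 / k2 < - N\<^sup>2 * sin z1 / z1 ^ 3 \<Longrightarrow> spectrally_unstable k2 (phi_c N \<alpha>)"
    unfolding phi_a_def phi_c_def[abs_def] by auto
  \<comment> \<open>Dimension 3 is \<open>m = 1\<close>, where the mass of the exponential is 8 pi /
    alpha^3.\<close>
  have dim3: "DIM(real^3) = 2 * 1 + 1" by simp
  have "\<alpha> ^ 3 / (8 * pi) * (fact 1 / sqrt pi * (2 * sqrt pi / \<alpha>) ^ (2 * 1 + 1)) = 1"
    using \<alpha> by (simp add: power_divide power_mult_distrib eval_nat_numeral field_simps)
  from hat_exp_density[OF \<alpha> dim3 this]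
  obtain V where "integrable lborel (\<lambda>y::real^3. \<alpha> ^ 3 / (8 * pi) * exp (- \<alpha> * norm y))"
    "\<And>\<eta>::real^3. hat (\<lambda>y. of_real (\<alpha> ^ 3 / (8 * pi) * exp (- \<alpha> * norm y))) \<eta> = of_real (V \<eta>)"
    "\<And>\<eta>. 0 \<le> V \<eta>" "\<And>\<eta>. V \<eta> \<le> 1" "V 0 = 1"
    using that by blast
  from product[OF this] have d:
    "1 / k2 \<ge> - N\<^sup>2 * sin z1 / z1 ^ 3 \<Longrightarrow> spectrally_stable k2 (phi_d N \<alpha>)"
    "1 / k2 < - N\<^sup>2 * sin z1 / z1 ^ 3 \<Longrightarrow> spectrally_unstable k2 (phi_d N \<alpha>)"
    unfolding phi_a_def phi_d_def[abs_def] by blast+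
  show ?thesis
    using a b c d by blast
qed

end
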